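(* Let $n\geq 2$ be an integer, let $I=[a,b]$ with $a<b$ real, and let $a_i\in C^{n-i}(I)$ be real-valued for $i=1,\dots,n$. For $M\in\mathbb{R}$ put $$T_n[M]\,u(t)=u^{(n)}(t)+a_1(t)\,u^{(n-1)}(t)+\cdots+a_{n-1}(t)\,u'(t)+(a_n(t)+M)\,u(t),\quad t\in I,$$ and for $1\le k\le n-1$ put $$X_k=\left\{u\in C^n(I)\ \mid\ u(a)=\cdots=u^{(k-1)}(a)=u(b)=\cdots=u^{(n-k-1)}(b)=0\right\}.$$ Let $\bar M\in\mathbb{R}$ be such that the equation $T_n[\bar M]\,u(t)=0$ is disconjugate on $I$. Then, for $M\in\mathbb{R}$, the equation $T_n[M]\,u(t)=0$ is disconjugate on $I$ if and only if $M\in(\bar M-\lambda_1,\bar M-\lambda_2)$, where - $\lambda_1=+\infty$ if $n=2$ and, for $n>2$, $\lambda_1>0$ is the minimum, over all $k\in\{1,\dots,n-1\}$ with $n-k$ even, of the least positive eigenvalue of $T_n[\bar M]$ in $X_k$; - $\lambda_2<0$ is the maximum, over all $k\in\{1,\dots,n-1\}$ with $n-k$ odd, of the biggest negative eigenvalue of $T_n[\bar M]$ in $X_k$.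
   Context: A linear differential equation of order $n$ is said to be disconjugate on an interval $J$ if every nontrivial (real) solution has at most $n-1$ zeros on $J$, multiple zeros being counted according to their multiplicity. A real number $\lambda$ is an eigenvalue of $T_n[\bar M]$ in $X_k$ if there is a nontrivial $u\in X_k$ with $T_n[\bar M]\,u(t)=\lambda\,u(t)$ for all $t\in I$. It is a known fact that, when $T_n[\bar M]\,u(t)=0$ is disconjugate on $I$, the operator $T_n[\bar M]$ has a least positive eigenvalue in $X_k$ whenever $n-k$ is even, and a biggest negative eigenvalue in $X_k$ whenever $n-k$ is odd ($1\le k\le n-1$), so that $\lambda_1$ and $\lambda_2$ are well defined. When $n=2$, the interval $(\bar M-\lambda_1,\bar M-\lambda_2)$ is understood as $(-\infty,\bar M-\lambda_2)$. *)

theory Defs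
  imports "HOL-Analysis.Analysis"
begin

text \<open>
  Functions on an interval \<open>I\<close> are represented by total functions of type \<^typ>\<open>real \<Rightarrow> real\<close>, of
  which only the values on \<open>I\<close> matter. Derivatives are taken within \<open>I\<close>, so they are one-sided at
  the endpoints.
\<close>

definition nth_deriv :: "real set \<Rightarrow> nat \<Rightarrow> (real \<Rightarrow> real) \<Rightarrow> real \<Rightarrow> real" where
  "nth_deriv I j = ((\<lambda>f t. vector_derivative f (at t within I)) ^^ j)"

definition C_space :: "nat \<Rightarrow> real set \<Rightarrow> (real \<Rightarrow> real) set" where
  "C_space m I = {u. (\<forall>j<m. nth_deriv I j u differentiable_on I) \<and> continuous_on I (nth_deriv I m u)}"

text \<open>
  The coefficient of \<open>u\<^sup>(\<^sup>n\<^sup>-\<^sup>i\<^sup>)\<close> is \<open>c i\<close> (the letters \<open>a\<close>, \<open>b\<close> are kept for the endpoints of \<open>I\<close>);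
  only \<open>c 1, \<dots>, c n\<close> are used.
\<close>

definition T_op :: "nat \<Rightarrow> (nat \<Rightarrow> real \<Rightarrow> real) \<Rightarrow> real set \<Rightarrow> real \<Rightarrow> (real \<Rightarrow> real) \<Rightarrow> real \<Rightarrow> real" where
  "T_op n c I M u t =
     nth_deriv I n u t + (\<Sum>i=1..n-1. c i t * nth_deriv I (n - i) u t) + (c n t + M) * u t"

definition X_space :: "nat \<Rightarrow> nat \<Rightarrow> real \<Rightarrow> real \<Rightarrow> (real \<Rightarrow> real) set" where
  "X_space n k a b = {u \<in> C_space n {a..b}.
     (\<forall>j<k. nth_deriv {a..b} j u a = 0) \<and> (\<forall>j<n - k. nth_deriv {a..b} j u b = 0)}"

text \<open>
  The \<open>LEAST\<close> below is over a nonempty set when \<open>u\<close> is a nontrivial solution of a linear equation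
  of order \<open>n\<close>: by uniqueness for the initial value problem some derivative of order less than \<open>n\<close>
  is nonzero at \<open>t\<close>.
\<close>

definition zero_multiplicity :: "real set \<Rightarrow> (real \<Rightarrow> real) \<Rightarrow> real \<Rightarrow> nat" where
  "zero_multiplicity J u t = (LEAST m. nth_deriv J m u t \<noteq> 0)"

text \<open>Disconjugacy on \<open>J\<close> of the equation \<open>L u = 0\<close>, for a linear differential operator \<open>L\<close> of order
  \<open>n\<close> acting on functions on \<open>J\<close>.\<close>

definition disconjugate :: "nat \<Rightarrow> ((real \<Rightarrow> real) \<Rightarrow> real \<Rightarrow> real) \<Rightarrow> real set \<Rightarrow> bool" where
  "disconjugate n L J \<longleftrightarrow>
     (\<forall>u \<in> C_space n J. (\<forall>t\<in>J. L u t = 0) \<and> (\<exists>t\<in>J. u t \<noteq> 0) \<longrightarrow>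
        finite {t\<in>J. u t = 0} \<and> (\<Sum>t | t \<in> J \<and> u t = 0. zero_multiplicity J u t) \<le> n - 1)"

definition eigenvalue_in ::
  "((real \<Rightarrow> real) \<Rightarrow> real \<Rightarrow> real) \<Rightarrow> real set \<Rightarrow> (real \<Rightarrow> real) set \<Rightarrow> real \<Rightarrow> bool" where
  "eigenvalue_in L I X l \<longleftrightarrow> (\<exists>u\<in>X. (\<exists>t\<in>I. u t \<noteq> 0) \<and> (\<forall>t\<in>I. L u t = l * u t))"

definition least_pos_eigenvalue ::
  "nat \<Rightarrow> (nat \<Rightarrow> real \<Rightarrow> real) \<Rightarrow> real \<Rightarrow> real \<Rightarrow> real \<Rightarrow> nat \<Rightarrow> real" where
  "least_pos_eigenvalue n c a b M k =
     (LEAST l. l > 0 \<and> eigenvalue_in (T_op n c {a..b} M) {a..b} (X_space n k a b) l)"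

definition biggest_neg_eigenvalue ::
  "nat \<Rightarrow> (nat \<Rightarrow> real \<Rightarrow> real) \<Rightarrow> real \<Rightarrow> real \<Rightarrow> real \<Rightarrow> nat \<Rightarrow> real" where
  "biggest_neg_eigenvalue n c a b M k =
     (GREATEST l. l < 0 \<and> eigenvalue_in (T_op n c {a..b} M) {a..b} (X_space n k a b) l)"

text \<open>
  If the equation \<open>T\<^sub>n[M] u = 0\<close> is disconjugate, the eigenvalues above exist for the parities of
  \<open>n - k\<close> used here. The set of indices for \<open>\<lambda>\<^sub>1\<close> contains \<open>n - 2\<close> if \<open>n > 2\<close>, and the one for
  \<open>\<lambda>\<^sub>2\<close> contains \<open>n - 1\<close>, so both extrema are over nonempty finite sets.
\<close>

definition lambda1 ::
  "nat \<Rightarrow> (nat \<Rightarrow> real \<Rightarrow> real) \<Rightarrow> real \<Rightarrow> real \<Rightarrow> real \<Rightarrow> ereal" where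
  "lambda1 n c a b M =
     (if n = 2 then \<infinity>
      else ereal (Min (least_pos_eigenvalue n c a b M ` {k \<in> {1..n-1}. even (n - k)})))"

definition lambda2 ::
  "nat \<Rightarrow> (nat \<Rightarrow> real \<Rightarrow> real) \<Rightarrow> real \<Rightarrow> real \<Rightarrow> real \<Rightarrow> real" where
  "lambda2 n c a b M = Max (biggest_neg_eigenvalue n c a b M ` {k \<in> {1..n-1}. odd (n - k)})"

end

theory Submission
  imports Defs
begin

text \<open>
  Write \<open>M = Mbar - \<tau> \<kappa>\<close> with \<open>\<tau> = \<plusminus>1\<close> and \<open>\<kappa> \<ge> 0\<close>. On the space \<open>X\<^sub>k\<close> with \<open>(-1)\<^sup>n\<^sup>-\<^sup>k = \<tau>\<close>, the
  operator \<open>\<tau> T[Mbar]\<close> has a positive inverse. If the equation is also disconjugate at \<open>\<kappa>\<close>, the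
  positive solution of \<open>(\<tau> T[Mbar] - \<kappa>) y = 1\<close> is a strict supersolution that excludes eigenvalues
  in \<open>(0, \<kappa>]\<close>. Conversely, let \<open>\<beta>\<close> be the first \<open>\<kappa>\<close> at which disconjugacy fails. Some solution
  has \<open>k\<close> zeros at \<open>a\<close> and \<open>n - k\<close> zeros at a point \<open>c\<close>, since otherwise the Wronskians of the
  principal solutions at \<open>a\<close> do not vanish and Rolle's theorem yields disconjugacy. For the other
  parity of \<open>n - k\<close> the inverse operators decrease with \<open>\<kappa>\<close> and stay bounded, so \<open>(-1)\<^sup>n\<^sup>-\<^sup>k = \<tau>\<close>
  for every such \<open>k\<close>. Hence the zeros have exact orders \<open>k\<close>, \<open>n - k\<close> and the solution is unique up
  to scaling; a limit of solutions for \<open>\<kappa> < \<beta>\<close> with only \<open>n - k - 1\<close> zeros at \<open>c\<close> would change sign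
  at \<open>c\<close> in the wrong way if \<open>c < b\<close>. Thus \<open>c = b\<close> and \<open>\<tau> \<beta>\<close> is an eigenvalue in \<open>X\<^sub>k\<close>.
\<close>

section \<open>Linear systems, multiplicities of zeros and Wronskians\<close>

text \<open>Three obstacles shape the proof. \<open>LEAST\<close> and \<open>GREATEST\<close> mean
  nothing unless the extremal eigenvalues exist, so their existence has to be proved too. It rests
  on the sign of solutions of two-point problems, obtained by counting zeros: if \<open>f\<close>
  does not vanish in the interior, a solution of \<open>T u = f\<close> has at most \<open>n\<close>
  zeros, because joining it to \<open>n\<close> homogeneous solutions multiplies their Wronskian by
  \<open>f\<close>. Next, disconjugacy is about zeros in any position, eigenvalues about two points.
  The link is that the Wronskian of the first \<open>k\<close> principal solutions at
  \<open>a\<close> vanishes at \<open>c\<close> exactly when some nontrivial solution has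
  \<open>n - k\<close> zeros at \<open>a\<close> and \<open>k\<close> zeros at \<open>c\<close>.
  Finally, the first failure could involve a point \<open>c < b\<close>, which gives no eigenvalue
  on \<open>I\<close>. Solutions with \<open>n - 1\<close> prescribed zeros have no other zero
  before the failure, so their sign change at \<open>c\<close> is known. Their limit gains one zero
  at \<open>c\<close>, which reverses the parity. It cannot gain more: moving a zero from one point
  to the other changes the parity of \<open>n - k\<close>, and only one parity can occur.\<close>

lemma homogeneous_system_nontrivial:
  fixes A :: "nat \<Rightarrow> nat \<Rightarrow> real"
  assumes "m < n"
  shows "\<exists>v. (\<exists>p<n. v p \<noteq> 0) \<and> (\<forall>q<m. (\<Sum>p<n. A q p * v p) = 0)"
  using assms
proof (induction m arbitrary: n A)
  case 0
  then show ?case by (intro exI[of _ "\<lambda>_. 1"]) auto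
next
  case (Suc m)
  then obtain n' where n': "n = Suc n'" "m < n'" by (cases n) auto
  show ?case
  proof (cases "\<forall>p<n. A m p = 0")
    case True
    obtain v where "\<exists>p<n. v p \<noteq> 0" "\<forall>q<m. (\<Sum>p<n. A q p * v p) = 0"
      using Suc.IH[of n A] Suc.prems by auto
    then show ?thesis using True by (intro exI[of _ v]) (auto simp: less_Suc_eq)
  next
    case False
    then obtain j where j: "j < n" "A m j \<noteq> 0" by auto
    \<comment> \<open>Gaussian elimination with pivot \<open>A m j\<close>: \<open>sh\<close>
      enumerates the unknowns other than \<open>j\<close>, \<open>C\<close> is the matrix after row
      \<open>m\<close> has cleared column \<open>j\<close>, and \<open>v j\<close> is then fixed by
      row \<open>m\<close>.\<close>
    define sh where "sh p = (if p < j then p else Suc p)" for p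
    define C where "C q p = A q (sh p) - A q j * A m (sh p) / A m j" for q p
    obtain w where w: "\<exists>p<n'. w p \<noteq> 0" "\<forall>q<m. (\<Sum>p<n'. C q p * w p) = 0"
      using Suc.IH[OF n'(2), of C] by blast
    define s where "s = (\<Sum>p<n'. A m (sh p) * w p)"
    define v where "v p = (if p < j then w p else if p = j then - s / A m j else w (p - 1))" for p
    have bij: "bij_betw sh {..<n'} ({..<n} - {j})"
      using j n' by (intro bij_betwI[where g = "\<lambda>p. if p < j then p else p - 1"])
        (auto simp: sh_def split: if_splits)
    have split: "(\<Sum>p<n. g p * v p) = g j * v j + (\<Sum>p<n'. g (sh p) * w p)" for g :: "nat \<Rightarrow> real"
    proof -
      have "(\<Sum>p<n. g p * v p) = g j * v j + (\<Sum>p\<in>{..<n} - {j}. g p * v p)"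
        using j by (simp add: sum.remove)
      also have "(\<Sum>p\<in>{..<n} - {j}. g p * v p) = (\<Sum>p<n'. g (sh p) * v (sh p))"
        by (rule sum.reindex_bij_betw[OF bij, symmetric])
      also have "\<dots> = (\<Sum>p<n'. g (sh p) * w p)"
        by (intro sum.cong) (auto simp: v_def sh_def)
      finally show ?thesis .
    qed
    have vj: "v j = - s / A m j" by (simp add: v_def)
    have "(\<Sum>p<n. A m p * v p) = 0"
      unfolding split vj s_def[symmetric] using j by simp
    moreover have "(\<Sum>p<n. A q p * v p) = 0" if "q < m" for q
    proof -
      have "0 = (\<Sum>p<n'. C q p * w p)" using w that by auto
      also have "\<dots> = (\<Sum>p<n'. A q (sh p) * w p) - A q j / A m j * s"
        unfolding s_def sum_distrib_left sum_subtractf[symmetric]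
        by (intro sum.cong) (auto simp: C_def algebra_simps)
      finally show ?thesis unfolding split vj by simp
    qed
    moreover have "\<exists>p<n. v p \<noteq> 0"
    proof -
      obtain p where "p < n'" "w p \<noteq> 0" using w by auto
      moreover have "v (sh p) = w p" by (auto simp: v_def sh_def)
      moreover have "sh p < n" using n' \<open>p < n'\<close> by (auto simp: sh_def)
      ultimately show ?thesis by metis
    qed
    ultimately show ?thesis by (intro exI[of _ v]) (auto simp: less_Suc_eq)
  qed
qed

lemma bounded_sequences_convergent_subsequence:
  fixes X :: "nat \<Rightarrow> nat \<Rightarrow> real"
  assumes "\<And>j p. p < n \<Longrightarrow> \<bar>X j p\<bar> \<le> B"
  shows "\<exists>r l. strict_mono r \<and> (\<forall>p<n. (\<lambda>j. X (r j) p) \<longlonglongrightarrow> l p)"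
  using assms
proof (induction n)
  case 0
  then show ?case by (auto intro: strict_mono_id)
next
  case (Suc n)
  then obtain r l where r: "strict_mono r" "\<And>p. p < n \<Longrightarrow> (\<lambda>j. X (r j) p) \<longlonglongrightarrow> l p"
    by (metis less_SucI)
  have "\<forall>j. X (r j) n \<in> {-B..B}" using Suc.prems[of n] by (auto simp: abs_le_iff minus_le_iff)
  then obtain l' r' where r': "strict_mono r'" "((\<lambda>j. X (r j) n) \<circ> r') \<longlonglongrightarrow> l'"
    using compact_Icc[of "-B" B] unfolding compact_def by metis
  have "(\<lambda>j. X (r (r' j)) p) \<longlonglongrightarrow> (if p = n then l' else l p)" if "p < Suc n" for p
    using r' LIMSEQ_subseq_LIMSEQ[OF r(2) r'(1)] that by (auto simp: o_def less_Suc_eq)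
  then show ?case using strict_mono_o[OF r(1) r'(1)]
    by (intro exI[of _ "r \<circ> r'"] exI[of _ "\<lambda>p. if p = n then l' else l p"]) (auto simp: o_def)
qed

text \<open>A multiset of zeros is encoded by its multiplicity function. A function enters as the
  sequence \<open>U\<close> of its successive derivatives.\<close>

definition has_zeros :: "(nat \<Rightarrow> real \<Rightarrow> real) \<Rightarrow> (real \<Rightarrow> nat) \<Rightarrow> real set \<Rightarrow> bool" where
  "has_zeros U \<mu> S \<longleftrightarrow>
     finite {t. \<mu> t > 0} \<and> {t. \<mu> t > 0} \<subseteq> S \<and> (\<forall>t. \<forall>i<\<mu> t. U i t = 0)"

definition zero_count :: "(real \<Rightarrow> nat) \<Rightarrow> nat" where
  "zero_count \<mu> = (\<Sum>t | \<mu> t > 0. \<mu> t)"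

section \<open>Zero counting and Rolle's theorem\<close>

lemma zero_count_superset:
  assumes "finite T" "{t. \<mu> t > 0} \<subseteq> T"
  shows "zero_count \<mu> = (\<Sum>t\<in>T. \<mu> t)"
  unfolding zero_count_def using assms by (intro sum.mono_neutral_left) auto

text \<open>Induction adds the largest point. That \<open>Y\<close> stays strictly between the
  extreme points of \<open>Z\<close> later keeps the new zeros away from the endpoints
  \<open>lo\<close> and \<open>hi\<close>.\<close>

lemma interlacing_zeros:
  fixes Z :: "real set"
  assumes "finite Z" "Z \<noteq> {}"
    and "\<And>x y. x \<in> Z \<Longrightarrow> y \<in> Z \<Longrightarrow> x < y \<Longrightarrow> \<exists>z\<in>{x<..<y}. P z"
  shows "\<exists>Y. finite Y \<and> Y \<inter> Z = {} \<and> Suc (card Y) = card Z \<and> Y \<subseteq> {Min Z<..<Max Z} \<and> (\<forall>z\<in>Y. P z)"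
  using assms
proof (induction rule: finite_linorder_max_induct)
  case empty
  then show ?case by simp
next
  case (insert b A)
  show ?case
  proof (cases "A = {}")
    case True
    then show ?thesis by (intro exI[of _ "{}"]) auto
  next
    case False
    then obtain Y where Y: "finite Y" "Y \<inter> A = {}" "Suc (card Y) = card A"
      "Y \<subseteq> {Min A<..<Max A}" "\<forall>z\<in>Y. P z"
      using insert by (metis insertCI)
    have mA: "Max A \<in> A" "Max A < b" using insert False by auto
    then obtain z where z: "z \<in> {Max A<..<b}" "P z" using insert.prems(2)[of "Max A" b] by auto
    have b: "b \<notin> A" using insert by auto
    have z': "z \<notin> A" "z \<notin> Y" using z Y(4) Max_ge[OF insert.hyps(1), of z] by force+
    have "Y \<subseteq> {Min A<..<b}" using Y(4) mA by auto
    moreover have "Min A < z" using z mA Min_le[OF insert.hyps(1) mA(1)] by auto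
    moreover have "Min (insert b A) = Min A" "Max (insert b A) = b"
      using insert.hyps False mA
      by (auto intro!: Max_eqI simp: min_def not_le less_imp_le)
        (meson Min_le leD le_less_trans mA)
    ultimately show ?thesis using Y z z' b insert.hyps(1) mA
      by (intro exI[of _ "insert z Y"]) auto
  qed
qed

text \<open>The bookkeeping of Rolle's theorem, shared by derivatives and Wronskians: every old zero
  loses one order, which costs \<open>card Z\<close>, and \<open>card Z - 1\<close> new zeros
  appear, so the total drops by one. The orders at \<open>lo\<close> and \<open>hi\<close> are
  tracked because \<open>chebyshev_zero_bound\<close> needs them to stay small in its
  induction.\<close>

lemma zeros_of_derived:
  assumes U: "has_zeros U \<mu> S" and S: "S \<subseteq> {lo..hi}" and "zero_count \<mu> \<ge> Suc N"
    and between: "\<And>x y. x \<in> S \<Longrightarrow> y \<in> S \<Longrightarrow> x < y \<Longrightarrow> U 0 x = 0 \<Longrightarrow> U 0 y = 0 \<Longrightarrow>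
      \<exists>z\<in>{x<..<y}. V 0 z = 0"
    and order: "\<And>t m. t \<in> S \<Longrightarrow> (\<And>i. i < Suc m \<Longrightarrow> U i t = 0) \<Longrightarrow> (\<forall>i<m. V i t = 0)"
  shows "\<exists>\<mu>'. has_zeros V \<mu>' {lo..hi} \<and> zero_count \<mu>' \<ge> N \<and> \<mu>' lo \<le> \<mu> lo - 1 \<and> \<mu>' hi \<le> \<mu> hi - 1"
proof -
  define Z where "Z = {t. \<mu> t > 0}"
  have Z: "finite Z" "Z \<subseteq> S" "\<And>t i. i < \<mu> t \<Longrightarrow> U i t = 0"
    using U by (auto simp: has_zeros_def Z_def)
  have count: "zero_count \<mu> = (\<Sum>t\<in>Z. \<mu> t)" by (simp add: zero_count_def Z_def)
  have "Z \<noteq> {}" using assms(3) count by auto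
  have "\<exists>z\<in>{x<..<y}. V 0 z = 0" if "x \<in> Z" "y \<in> Z" "x < y" for x y
    using between[of x y] that Z by (auto simp: Z_def)
  then obtain Y where Y: "finite Y" "Y \<inter> Z = {}" "Suc (card Y) = card Z"
    "Y \<subseteq> {Min Z<..<Max Z}" "\<forall>z\<in>Y. V 0 z = 0"
    using interlacing_zeros[OF Z(1) \<open>Z \<noteq> {}\<close>, of "\<lambda>z. V 0 z = 0"] by blast
  \<comment> \<open>Points outside \<open>Z\<close> and \<open>Y\<close> get
    \<open>0 - 1 = 0\<close> by truncated subtraction.\<close>
  define \<mu>' where "\<mu>' t = (if t \<in> Y then 1 else \<mu> t - 1)" for t
  have MM: "Min Z \<in> Z" "Max Z \<in> Z" using Z \<open>Z \<noteq> {}\<close> by auto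
  then have lohi: "lo \<le> Min Z" "Max Z \<le> hi" using Z(2) S by force+
  then have Y': "lo \<notin> Y" "hi \<notin> Y" "Y \<subseteq> {lo..hi}" using Y(4) by force+
  have sub: "{t. \<mu>' t > 0} \<subseteq> Z \<union> Y" by (auto simp: \<mu>'_def Z_def)
  have "\<mu>' t = \<mu> t - 1" if "t \<in> Z" for t using that Y by (auto simp: \<mu>'_def)
  then have eq: "(\<Sum>t\<in>Z. \<mu> t) = (\<Sum>t\<in>Z. \<mu>' t) + card Z"
    unfolding card_eq_sum sum.distrib[symmetric] by (intro sum.cong) (auto simp: Z_def)
  have "zero_count \<mu>' = (\<Sum>t\<in>Z \<union> Y. \<mu>' t)" using Z Y sub by (intro zero_count_superset) auto
  also have "\<dots> = (\<Sum>t\<in>Z. \<mu>' t) + (\<Sum>t\<in>Y. \<mu>' t)" using Z Y by (intro sum.union_disjoint) auto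
  also have "(\<Sum>t\<in>Y. \<mu>' t) = card Y" by (simp add: \<mu>'_def)
  finally have "zero_count \<mu>' + 1 = zero_count \<mu>"
    using eq Y(3) count by simp
  moreover have "has_zeros V \<mu>' {lo..hi}" unfolding has_zeros_def
  proof (intro conjI allI impI)
    show "finite {t. \<mu>' t > 0}" using sub Z Y by (meson finite_UnI finite_subset)
    show "{t. \<mu>' t > 0} \<subseteq> {lo..hi}" using sub Z S Y' by blast
    fix t i assume i: "i < \<mu>' t"
    show "V i t = 0"
    proof (cases "t \<in> Y")
      case True
      then show ?thesis using i Y by (auto simp: \<mu>'_def)
    next
      case False
      then have "t \<in> Z" using i by (auto simp: \<mu>'_def Z_def)
      then have "\<forall>i<\<mu> t - 1. V i t = 0"
        using Z order[of t "\<mu> t - 1"] by auto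
      then show ?thesis using i False by (auto simp: \<mu>'_def)
    qed
  qed
  ultimately show ?thesis using assms(3) Y' by (intro exI[of _ \<mu>']) (auto simp: \<mu>'_def)
qed

section \<open>Wronskians with a fixed function and the Chebyshev property\<close>

text \<open>If \<open>U\<close> and \<open>F\<close> list the derivatives of \<open>u\<close> and
  \<open>f\<close>, this is the Leibniz formula for the \<open>i\<close>-th derivative of
  \<open>u' f - u f'\<close>, the numerator of \<open>(u / f)'\<close>.\<close>

definition wronskian :: "(nat \<Rightarrow> real \<Rightarrow> real) \<Rightarrow> (nat \<Rightarrow> real \<Rightarrow> real) \<Rightarrow> nat \<Rightarrow> real \<Rightarrow> real" where
  "wronskian F U i t =
     (\<Sum>j\<le>i. of_nat (i choose j) * (U (Suc j) t * F (i - j) t - U j t * F (Suc (i - j)) t))"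

lemma wronskian_order:
  assumes "\<And>i. i < Suc m \<Longrightarrow> U i t = 0" "i < m"
  shows "wronskian F U i t = 0"
  unfolding wronskian_def using assms by (intro sum.neutral) auto

text \<open>The Leibniz sum of index \<open>i\<close> contains \<open>U (Suc i) t * F 0 t\<close>,
  and all other terms involve derivatives of \<open>U\<close> of order at most \<open>i\<close>. So
  zeros of the Wronskian pass back to \<open>U\<close>, one order higher, once \<open>U 0\<close>
  itself vanishes.\<close>

lemma wronskian_order_converse:
  assumes "\<And>i. i < k \<Longrightarrow> wronskian F U i t = 0" and "F 0 t \<noteq> 0" and "U 0 t = 0" and "i \<le> k"
  shows "U i t = 0"
  using \<open>i \<le> k\<close>
proof (induction i rule: less_induct)
  case (less i)
  show ?case
  proof (cases i)
    case 0
    then show ?thesis using assms by simp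
  next
    case (Suc i')
    have "0 = wronskian F U i' t" using assms(1) Suc less.prems by simp
    also have "\<dots> = (\<Sum>j\<in>{i'}. of_nat (i' choose j) *
        (U (Suc j) t * F (i' - j) t - U j t * F (Suc (i' - j)) t))"
      unfolding wronskian_def using less Suc by (intro sum.mono_neutral_right) auto
    also have "\<dots> = U i t * F 0 t" using less Suc by simp
    finally show ?thesis using assms(2) by simp
  qed
qed

lemma wronskian_sum:
  "wronskian F (\<lambda>i t. \<Sum>p\<in>I. \<alpha> p * G p i t) i t = (\<Sum>p\<in>I. \<alpha> p * wronskian F (G p) i t)"
proof -
  have "(\<Sum>p\<in>I. \<alpha> p * wronskian F (G p) i t) = (\<Sum>j\<le>i. \<Sum>p\<in>I. \<alpha> p * (of_nat (i choose j) *
      (G p (Suc j) t * F (i - j) t - G p j t * F (Suc (i - j)) t)))"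
    unfolding wronskian_def sum_distrib_left by (rule sum.swap)
  also have "\<dots> = wronskian F (\<lambda>i t. \<Sum>p\<in>I. \<alpha> p * G p i t) i t"
    unfolding wronskian_def sum_distrib_left sum_distrib_right sum_subtractf[symmetric]
    by (intro sum.cong refl) (simp add: algebra_simps)
  finally show ?thesis by simp
qed

text \<open>\<open>F\<close> is an arbitrary sequence here, so this is an algebraic identity: the
  reflection of \<open>j\<close> to \<open>i - j\<close> exchanges the two halves of the
  sum.\<close>

lemma wronskian_self: "wronskian F F i t = 0"
proof -
  define g where "g j = of_nat (i choose j) * (F j t * F (Suc (i - j)) t)" for j
  have "wronskian F F i t = (\<Sum>j\<le>i. of_nat (i choose j) * (F (Suc j) t * F (i - j) t)) - (\<Sum>j\<le>i. g j)"
    unfolding wronskian_def g_def sum_subtractf[symmetric] by (simp add: algebra_simps)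
  also have "(\<Sum>j\<le>i. of_nat (i choose j) * (F (Suc j) t * F (i - j) t)) = (\<Sum>j\<le>i. g (i - j))"
    unfolding g_def by (intro sum.cong) (auto simp: binomial_symmetric[symmetric] mult.commute)
  also have "(\<Sum>j\<le>i. g (i - j)) = (\<Sum>j\<le>i. g j)"
    by (rule sum.reindex_bij_witness[of _ "\<lambda>j. i - j" "\<lambda>j. i - j"]) auto
  finally show ?thesis by simp
qed

lemma wronskian_has_derivative:
  assumes "\<And>j. j \<le> Suc i \<Longrightarrow> (U j has_real_derivative U (Suc j) t) (at t)"
    and "\<And>j. j \<le> Suc i \<Longrightarrow> (F j has_real_derivative F (Suc j) t) (at t)"
  shows "(wronskian F U i has_real_derivative wronskian F U (Suc i) t) (at t)"
proof -
  \<comment> \<open>The derivative of \<open>h a b\<close> is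
    \<open>h (Suc a) b + h a (Suc b)\<close>, because the mixed terms cancel; Pascal's rule then
    collects the binomial sum.\<close>
  define h where "h a b = U (Suc a) t * F b t - U a t * F (Suc b) t" for a b
  have pascal: "(\<Sum>j\<le>i. of_nat (i choose j) * (h (Suc j) (i - j) + h j (Suc (i - j)))) =
    (\<Sum>j\<le>Suc i. of_nat (Suc i choose j) * h j (Suc i - j))" for h :: "nat \<Rightarrow> nat \<Rightarrow> real"
  proof -
    have *: "(\<Sum>j\<le>i. of_nat (i choose Suc j) * h (Suc j) (i - j)) + h 0 (Suc i) =
       (\<Sum>j\<le>i. of_nat (i choose j) * h j (Suc i - j))"
    proof -
      have "(\<Sum>j\<le>i. of_nat (i choose Suc j) * h (Suc j) (i - j)) + h 0 (Suc i) =
         (\<Sum>j\<le>Suc i. of_nat (i choose j) * h j (Suc i - j))"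
        by (subst sum.atMost_Suc_shift) simp
      then show ?thesis by simp
    qed
    have "(\<Sum>j\<le>Suc i. of_nat (Suc i choose j) * h j (Suc i - j)) =
      h 0 (Suc i) + (\<Sum>j\<le>i. of_nat (Suc i choose Suc j) * h (Suc j) (i - j))"
      by (subst sum.atMost_Suc_shift) simp
    also have "\<dots> = (\<Sum>j\<le>i. of_nat (i choose j) * h (Suc j) (i - j)) +
       (\<Sum>j\<le>i. of_nat (i choose j) * h j (Suc i - j))"
      unfolding *[symmetric] by (simp add: algebra_simps sum.distrib)
    also have "\<dots> = (\<Sum>j\<le>i. of_nat (i choose j) * (h (Suc j) (i - j) + h j (Suc (i - j))))"
      unfolding sum.distrib[symmetric]
      by (intro sum.cong refl) (auto simp: Suc_diff_le algebra_simps)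
    finally show ?thesis by simp
  qed
  have "((\<lambda>t. \<Sum>j\<le>i. of_nat (i choose j) * (U (Suc j) t * F (i - j) t - U j t * F (Suc (i - j)) t))
     has_real_derivative (\<Sum>j\<le>i. of_nat (i choose j) * (h (Suc j) (i - j) + h j (Suc (i - j))))) (at t)"
    by (auto intro!: derivative_eq_intros assms sum.cong simp: h_def algebra_simps)
  from this[unfolded pascal, unfolded h_def] show ?thesis unfolding wronskian_def[abs_def] .
qed

text \<open>Rolle's theorem for \<open>U 0 / F 0\<close>, whose derivative is the Wronskian divided
  by \<open>(F 0 t)\<^sup>2\<close>.\<close>

lemma rolle_wronskian:
  assumes "x < y" "U 0 x = 0" "U 0 y = 0"
    and F: "\<And>t. t \<in> {x..y} \<Longrightarrow> F 0 t \<noteq> 0"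
    and dU: "\<And>t. t \<in> {x..y} \<Longrightarrow> (U 0 has_real_derivative U (Suc 0) t) (at t)"
    and dF: "\<And>t. t \<in> {x..y} \<Longrightarrow> (F 0 has_real_derivative F (Suc 0) t) (at t)"
  shows "\<exists>z\<in>{x<..<y}. wronskian F U 0 z = 0"
proof -
  have d: "((\<lambda>t. U 0 t / F 0 t) has_real_derivative wronskian F U 0 t / (F 0 t)\<^sup>2) (at t)"
    if "t \<in> {x..y}" for t
    by (rule DERIV_cong[OF DERIV_divide[OF dU dF]])
      (use F that in \<open>auto simp: wronskian_def power2_eq_square\<close>)
  have "\<exists>z. z > x \<and> z < y \<and> DERIV (\<lambda>t. U 0 t / F 0 t) z :> 0"
  proof (rule Rolle)
    show "continuous_on {x..y} (\<lambda>t. U 0 t / F 0 t)"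
      using d by (meson DERIV_isCont continuous_at_imp_continuous_on)
    show "(\<lambda>t. U 0 t / F 0 t) differentiable (at t)" if "x < t" "t < y" for t
      using d[of t] that by (auto simp: real_differentiable_def)
  qed (use assms in auto)
  then obtain z where z: "x < z" "z < y" "DERIV (\<lambda>t. U 0 t / F 0 t) z :> 0" by auto
  then have "wronskian F U 0 z / (F 0 z)\<^sup>2 = 0" using d[of z] DERIV_unique by fastforce
  then show ?thesis using z F[of z] by (intro bexI[of _ z]) auto
qed

text \<open>The Chebyshev property of a chain of systems with nonvanishing Wronskians, expressed without
  determinants: \<open>nondeg\<close> says that the Wronskian of the first \<open>k\<close> functions does not vanish at \<open>t\<close>.
  For all \<open>N\<close> functions this is only needed in the interior, since the multiplicities at the
  endpoints are less than \<open>N\<close>. The induction passes from \<open>F 0, \<dots>, F N\<close> to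
  \<open>(F (p+1) / F 0)'\<close>, up to the factor \<open>(F 0)\<^sup>2\<close>.\<close>

lemma chebyshev_zero_bound:
  fixes F :: "nat \<Rightarrow> nat \<Rightarrow> real \<Rightarrow> real"
  assumes "N \<ge> 1"
    and der: "\<And>p i t. p < N \<Longrightarrow> i < N - 1 \<Longrightarrow> t \<in> {lo..hi} \<Longrightarrow>
      (F p i has_real_derivative F p (Suc i) t) (at t)"
    and nondeg: "\<And>k t \<alpha>. 1 \<le> k \<Longrightarrow> k \<le> N \<Longrightarrow> t \<in> {lo..hi} \<Longrightarrow> (k = N \<Longrightarrow> t \<in> {lo<..<hi}) \<Longrightarrow>
      (\<And>i. i < k \<Longrightarrow> (\<Sum>p<k. \<alpha> p * F p i t) = 0) \<Longrightarrow> (\<forall>p<k. \<alpha> p = (0::real))"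
    and zeros: "has_zeros (\<lambda>i t. \<Sum>p<N. \<alpha> p * F p i t) \<mu> {lo..hi}" "zero_count \<mu> \<ge> N"
    and ends: "\<mu> lo < N" "\<mu> hi < N"
  shows "\<forall>p<N. \<alpha> p = 0"
  using assms
proof (induction N arbitrary: F \<alpha> \<mu>)
  case 0
  then show ?case by simp
next
  case (Suc N)
  define U where "U i t = (\<Sum>p<Suc N. \<alpha> p * F p i t)" for i t
  have Uz: "has_zeros U \<mu> {lo..hi}" using Suc.prems(4) by (simp add: U_def[abs_def])
  show ?case
  proof (cases "N = 0")
    case True
    have "\<exists>t. \<mu> t > 0"
    proof (rule ccontr)
      assume "\<nexists>t. \<mu> t > 0"
      then have "zero_count \<mu> = 0" by (simp add: zero_count_def)
      then show False using Suc.prems by simp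
    qed
    then obtain t where t: "\<mu> t > 0" by auto
    have "t \<in> {lo..hi}" "U 0 t = 0" using Uz t by (auto simp: has_zeros_def)
    moreover have "t \<noteq> lo" "t \<noteq> hi" using t Suc.prems(6,7) True by auto
    ultimately have "\<forall>p<1. \<alpha> p = 0"
      using True by (intro Suc.prems(3)[of 1 t \<alpha>]) (simp_all add: U_def)
    then show ?thesis using True by simp
  next
    case False
    \<comment> \<open>The full chain now has at least two functions, so the case
      \<open>k = 1\<close> of nondegeneracy includes the endpoints and one may divide by
      \<open>F 0 0\<close> on the whole interval.\<close>
    have F0: "F 0 0 t \<noteq> 0" if "t \<in> {lo..hi}" for t
    proof
      assume "F 0 0 t = 0"
      then have "\<forall>p<1::nat. (1::real) = 0"
        using False that by (intro Suc.prems(3)[of 1 t "\<lambda>_. 1"]) simp_all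
      then show False by (auto dest: spec[of _ 0])
    qed
    define G where "G p = wronskian (F 0) (F (Suc p))" for p
    define W where "W = wronskian (F 0) U"
    have WG: "W i t = (\<Sum>p<N. \<alpha> (Suc p) * G p i t)" for i t
    proof -
      have "W i t = (\<Sum>p<Suc N. \<alpha> p * wronskian (F 0) (F p) i t)"
        unfolding W_def U_def[abs_def] by (rule wronskian_sum)
      then show ?thesis unfolding sum.lessThan_Suc_shift by (simp add: wronskian_self G_def)
    qed
    have dU: "(U i has_real_derivative U (Suc i) t) (at t)" if "i < N" "t \<in> {lo..hi}" for i t
      unfolding U_def[abs_def] using that Suc.prems(2)
      by (intro DERIV_sum DERIV_cmult) auto
    obtain \<mu>' where \<mu>': "has_zeros W \<mu>' {lo..hi}" "zero_count \<mu>' \<ge> N"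
        "\<mu>' lo \<le> \<mu> lo - 1" "\<mu>' hi \<le> \<mu> hi - 1"
    proof -
      have "\<exists>\<mu>'. has_zeros W \<mu>' {lo..hi} \<and> zero_count \<mu>' \<ge> N \<and> \<mu>' lo \<le> \<mu> lo - 1 \<and> \<mu>' hi \<le> \<mu> hi - 1"
      proof (rule zeros_of_derived[OF Uz order.refl Suc.prems(5)])
        fix x y assume xy: "x \<in> {lo..hi}" "y \<in> {lo..hi}" "x < y" "U 0 x = 0" "U 0 y = 0"
        show "\<exists>z\<in>{x<..<y}. W 0 z = 0" unfolding W_def
          by (rule rolle_wronskian) (use xy F0 dU Suc.prems(2) False in auto)
      next
        fix t m assume "\<And>i. i < Suc m \<Longrightarrow> U i t = 0"
        then show "\<forall>i<m. W i t = 0" unfolding W_def by (blast intro: wronskian_order)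
      qed
      then show ?thesis using that by blast
    qed
    have "\<forall>p<N. \<alpha> (Suc p) = 0"
    proof (rule Suc.IH[of G "\<lambda>p. \<alpha> (Suc p)" \<mu>'])
      show "1 \<le> N" using False by simp
      show "(G p i has_real_derivative G p (Suc i) t) (at t)"
        if "p < N" "i < N - 1" "t \<in> {lo..hi}" for p i t
        unfolding G_def using that Suc.prems(2) by (intro wronskian_has_derivative) auto
      show "has_zeros (\<lambda>i t. \<Sum>p<N. \<alpha> (Suc p) * G p i t) \<mu>' {lo..hi}"
        using \<mu>'(1) by (simp add: WG[abs_def])
      show "N \<le> zero_count \<mu>'" "\<mu>' lo < N" "\<mu>' hi < N" using \<mu>' Suc.prems(6,7) False by auto
      fix k t \<beta> assume k: "1 \<le> k" "k \<le> N" and t: "t \<in> {lo..hi}" "k = N \<Longrightarrow> t \<in> {lo<..<hi}"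
        and z: "\<And>i. i < k \<Longrightarrow> (\<Sum>p<k. \<beta> p * G p i t) = 0"
      \<comment> \<open>\<open>c\<close> makes the combination \<open>V\<close> vanish at
        \<open>t\<close>. The Wronskian of \<open>V\<close> with \<open>F 0\<close> has
        \<open>k\<close> zeros there, hence \<open>V\<close> has \<open>k + 1\<close>, and
        nondegeneracy of the longer chain applies.\<close>
      define c where "c = - (\<Sum>p<k. \<beta> p * F (Suc p) 0 t) / F 0 0 t"
      define \<gamma> where "\<gamma> p = (case p of 0 \<Rightarrow> c | Suc p \<Rightarrow> \<beta> p)" for p
      define V where "V i t = (\<Sum>p<Suc k. \<gamma> p * F p i t)" for i t
      have "wronskian (F 0) V i t = (\<Sum>p<k. \<beta> p * G p i t)" for i
      proof -
        have "wronskian (F 0) V i t = (\<Sum>p<Suc k. \<gamma> p * wronskian (F 0) (F p) i t)"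
          unfolding V_def[abs_def] by (rule wronskian_sum)
        then show ?thesis unfolding sum.lessThan_Suc_shift by (simp add: wronskian_self G_def \<gamma>_def)
      qed
      then have w: "wronskian (F 0) V i t = 0" if "i < k" for i using z that by simp
      have "V 0 t = 0"
        unfolding V_def sum.lessThan_Suc_shift using F0[OF t(1)] by (simp add: \<gamma>_def c_def)
      then have "V i t = 0" if "i < Suc k" for i
        using wronskian_order_converse[OF w F0[OF t(1)]] that by auto
      then have "\<forall>p<Suc k. \<gamma> p = 0"
        using k t unfolding V_def by (intro Suc.prems(3)[of "Suc k" t \<gamma>]) simp_all
      then show "\<forall>p<k. \<beta> p = 0" by (auto simp: \<gamma>_def split: nat.splits)
    qed
    moreover have "\<alpha> 0 = 0"
    proof -
      have "\<exists>t. \<mu> t > 0"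
      proof (rule ccontr)
        assume "\<nexists>t. \<mu> t > 0"
        then have "zero_count \<mu> = 0" by (simp add: zero_count_def)
        then show False using Suc.prems by simp
      qed
      then obtain t where "\<mu> t > 0" by auto
      then have "t \<in> {lo..hi}" "U 0 t = 0" using Uz by (auto simp: has_zeros_def)
      then show ?thesis using F0[of t] calculation
        unfolding U_def sum.lessThan_Suc_shift by simp
    qed
    ultimately show ?thesis by (auto simp: less_Suc_eq_0_disj)
  qed
qed

text \<open>Iterated Rolle; it keeps the two zeros from coalescing in
  \<open>singular_limit\<close>.\<close>

lemma zeros_of_iterated_derivative:
  assumes "\<And>i t. i < N \<Longrightarrow> t \<in> {lo..hi} \<Longrightarrow> (U i has_real_derivative U (Suc i) t) (at t)"
    and "has_zeros U \<mu> {lo..hi}" "zero_count \<mu> > N"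
  shows "\<exists>t\<in>{lo..hi}. U N t = 0"
  using assms
proof (induction N arbitrary: U \<mu>)
  case 0
  then have "{t. \<mu> t > 0} \<noteq> {}" unfolding zero_count_def by force
  then show ?case using 0 by (auto simp: has_zeros_def)
next
  case (Suc N)
  have "\<exists>\<mu>'. has_zeros (\<lambda>i. U (Suc i)) \<mu>' {lo..hi} \<and> zero_count \<mu>' \<ge> Suc N \<and>
      \<mu>' lo \<le> \<mu> lo - 1 \<and> \<mu>' hi \<le> \<mu> hi - 1"
  proof (rule zeros_of_derived[OF Suc.prems(2) order.refl])
    show "Suc (Suc N) \<le> zero_count \<mu>" using Suc.prems(3) by simp
    fix x y assume xy: "x \<in> {lo..hi}" "y \<in> {lo..hi}" "x < y" "U 0 x = 0" "U 0 y = 0"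
    have d: "(U 0 has_real_derivative U (Suc 0) t) (at t)" if "t \<in> {x..y}" for t
      using Suc.prems(1)[of 0 t] xy that by auto
    have "\<exists>z. z > x \<and> z < y \<and> DERIV (U 0) z :> 0"
    proof (rule Rolle)
      show "continuous_on {x..y} (U 0)"
        using d by (meson DERIV_isCont continuous_at_imp_continuous_on)
      show "U 0 differentiable (at t)" if "x < t" "t < y" for t
        using d[of t] that by (auto simp: real_differentiable_def)
    qed (use xy in auto)
    then obtain z where z: "x < z" "z < y" "DERIV (U 0) z :> 0" by auto
    then have "U (Suc 0) z = 0" using d[of z] DERIV_unique by fastforce
    then show "\<exists>z\<in>{x<..<y}. U (Suc 0) z = 0" using z by (intro bexI[of _ z]) auto
  qed auto
  then obtain \<mu>' where "has_zeros (\<lambda>i. U (Suc i)) \<mu>' {lo..hi}" "zero_count \<mu>' \<ge> Suc N" by blast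
  then show ?case using Suc.IH[of "\<lambda>i. U (Suc i)" \<mu>'] Suc.prems(1) by auto
qed

section \<open>Sign of a function next to a zero of known order\<close>

lemma sign_right_of_zero:
  assumes "\<And>i t. i < k \<Longrightarrow> (U i has_real_derivative U (Suc i) t) (at t)"
    and "\<And>i. i < k \<Longrightarrow> U i x = 0" and "U k x > 0" and "isCont (U k) x"
  shows "\<exists>e>0. \<forall>t\<in>{x<..<x+e}. U 0 t > 0"
  using assms
proof (induction k arbitrary: U)
  case 0
  then have "\<forall>\<^sub>F t in at x. U 0 t > 0"
    unfolding continuous_at by (intro order_tendstoD(1)) auto
  then obtain e where "e > 0" "\<forall>t. t \<noteq> x \<and> dist t x < e \<longrightarrow> U 0 t > 0"
    unfolding eventually_at by auto
  then show ?case by (intro exI[of _ e]) (auto simp: dist_real_def)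
next
  case (Suc k)
  have "\<exists>e>0. \<forall>t\<in>{x<..<x+e}. U (Suc 0) t > 0"
    using Suc.IH[of "\<lambda>i. U (Suc i)"] Suc.prems by auto
  then obtain e where e: "e > 0" "\<And>t. t \<in> {x<..<x+e} \<Longrightarrow> U (Suc 0) t > 0" by auto
  have "U 0 t > 0" if t: "t \<in> {x<..<x+e}" for t
  proof -
    have d: "(U 0 has_real_derivative U (Suc 0) s) (at s)" for s using Suc.prems(1)[of 0] by simp
    have "U 0 x < U 0 t"
    proof (rule DERIV_pos_imp_increasing_open[of x t "U 0"])
      show "x < t" using t by auto
      show "\<exists>y. DERIV (U 0) s :> y \<and> y > 0" if "x < s" "s < t" for s using d e(2)[of s] that t by auto
      show "continuous_on {x..t} (U 0)"
        using d by (meson DERIV_isCont continuous_at_imp_continuous_on)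
    qed
    then show ?thesis using Suc.prems(2) by simp
  qed
  then show ?case using e(1) by blast
qed

lemma sign_left_of_zero:
  assumes "\<And>i t. i < k \<Longrightarrow> (U i has_real_derivative U (Suc i) t) (at t)"
    and "\<And>i. i < k \<Longrightarrow> U i x = 0" and "(-1) ^ k * U k x > 0" and "isCont (U k) x"
  shows "\<exists>e>0. \<forall>t\<in>{x-e<..<x}. U 0 t > 0"
proof -
  \<comment> \<open>Reflection at \<open>0\<close> reduces this to the right-hand case; the
    \<open>i\<close>-th derivative picks up the factor \<open>(-1) ^ i\<close>.\<close>
  define V where "V i t = (-1) ^ i * U i (- t)" for i t
  have "\<exists>e>0. \<forall>t\<in>{-x<..<-x+e}. V 0 t > 0"
  proof (rule sign_right_of_zero[where k = k])
    show "(V i has_real_derivative V (Suc i) t) (at t)" if "i < k" for i t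
    proof -
      have "((\<lambda>t. U i (- t)) has_real_derivative U (Suc i) (- t) * - 1) (at t)"
        by (rule DERIV_chain2[OF assms(1)[OF that]]) (auto intro!: derivative_eq_intros)
      from DERIV_cmult[OF this, of "(-1) ^ i"] show ?thesis by (simp add: V_def[abs_def])
    qed
    show "isCont (V k) (- x)" unfolding V_def[abs_def]
      using assms(4) by (intro continuous_intros isCont_o2[where f = uminus and g = "U k"]) auto
  qed (use assms in \<open>auto simp: V_def\<close>)
  then obtain e where e: "e > 0" "\<And>t. t \<in> {-x<..<-x+e} \<Longrightarrow> V 0 t > 0" by auto
  have "U 0 t > 0" if "t \<in> {x-e<..<x}" for t
    using e(2)[of "-t"] that by (auto simp: V_def)
  then show ?thesis using e(1) by blast
qed

section \<open>Linear differential equations on the line\<close>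

lemma antiderivative_exists:
  fixes g :: "real \<Rightarrow> real"
  assumes "continuous_on UNIV g"
  shows "\<exists>G. G s = 0 \<and> (\<forall>t. (G has_real_derivative g t) (at t))"
proof -
  define G where "G t = (if s \<le> t then integral {s..t} g else - integral {t..s} g)" for t
  have cont: "continuous_on S g" for S using assms continuous_on_subset by blast
  have int: "g integrable_on {x..y}" for x y by (intro integrable_continuous_real cont)
  have "(G has_real_derivative g t) (at t)" for t
  proof -
    define x where "x = min s t - 1"
    define y where "y = max s t + 1"
    have "x \<le> s" by (simp add: x_def)
    then have eq: "G r = integral {x..r} g - integral {x..s} g" if "x \<le> r" for r
      using Henstock_Kurzweil_Integration.integral_combine[of x s r g]
        Henstock_Kurzweil_Integration.integral_combine[of x r s g] that int
      by (auto simp: G_def)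
    have t: "t \<in> interior {x..y}" by (auto simp: x_def y_def)
    have "((\<lambda>r. integral {x..r} g) has_real_derivative g t) (at t within {x..y})"
      by (rule integral_has_real_derivative[OF cont]) (auto simp: x_def y_def)
    then have "((\<lambda>r. integral {x..r} g - integral {x..s} g) has_real_derivative g t) (at t within {x..y})"
      by (auto intro!: derivative_eq_intros)
    then have "(G has_real_derivative g t) (at t within {x..y})"
      by (rule has_field_derivative_transform_within[where d = 1]) (use eq t interior_subset in auto)
    then show ?thesis using t at_within_interior by metis
  qed
  moreover have "G s = 0" by (simp add: G_def)
  ultimately show ?thesis by blast
qed

text \<open>Integration from \<open>s\<close> gains the factor \<open>1 / K\<close> against the
  weight \<open>2 cosh (K (t - s))\<close>: a primitive of the weight is
  \<open>2 sinh (K (t - s)) / K\<close>, and adding \<open>A\<close> times it to \<open>G\<close>,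
  or subtracting it, gives monotone functions. This is the source of the contraction in
  \<open>sol_exists\<close>.\<close>

lemma antiderivative_weighted_bound:
  fixes g G :: "real \<Rightarrow> real"
  assumes G: "G s = 0" "\<And>t. (G has_real_derivative g t) (at t)" and K: "K > 0"
    and w: "\<And>t. w t = exp (K * (t - s)) + exp (- (K * (t - s)))"
    and g: "\<And>t. \<bar>g t\<bar> \<le> A * w t"
  shows "\<bar>G t\<bar> \<le> A / K * w t"
proof -
  define W where "W t = (exp (K * (t - s)) - exp (- (K * (t - s)))) / K" for t
  have dW: "(W has_real_derivative w t) (at t)" for t
    unfolding W_def[abs_def] w using K by (auto intro!: derivative_eq_intros simp: field_simps)
  have Ws: "W s = 0" by (simp add: W_def)
  have "A * w s \<ge> 0" using g[of s] by (meson abs_ge_zero order.trans)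
  then have A: "A \<ge> 0" by (simp add: w)
  have up: "G y - A * W y \<le> G x - A * W x" if "x \<le> y" for x y
    by (rule DERIV_nonpos_imp_nonincreasing[of x y "\<lambda>t. G t - A * W t"])
      (use that g in \<open>auto intro!: exI derivative_eq_intros G dW simp: abs_le_iff mult.commute\<close>)
  have g': "g t + A * w t \<ge> 0" for t using g[of t] by linarith
  have lo: "G x + A * W x \<le> G y + A * W y" if "x \<le> y" for x y
    by (rule DERIV_nonneg_imp_nondecreasing[of x y "\<lambda>t. G t + A * W t"])
      (use that g' in \<open>auto intro!: exI derivative_eq_intros G dW simp: mult.commute\<close>)
  have "\<bar>W t\<bar> \<le> w t / K"
    using K by (auto simp: W_def w divide_right_mono abs_le_iff)
  then have "A * \<bar>W t\<bar> \<le> A / K * w t"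
    using mult_left_mono[OF _ A] by fastforce
  moreover have "\<bar>G t\<bar> \<le> A * \<bar>W t\<bar>"
  proof (cases "s \<le> t")
    case True
    then have "\<bar>G t\<bar> \<le> A * W t" using up[of s t] lo[of s t] G Ws by auto
    also have "\<dots> \<le> A * \<bar>W t\<bar>" using A by (simp add: mult_left_mono)
    finally show ?thesis .
  next
    case False
    then have "\<bar>G t\<bar> \<le> A * (- W t)" using up[of t s] lo[of t s] G Ws by auto
    also have "\<dots> \<le> A * \<bar>W t\<bar>" using A by (intro mult_left_mono) auto
    finally show ?thesis .
  qed
  ultimately show ?thesis by linarith
qed

section \<open>The linear equation: Gronwall estimate, uniqueness, existence\<close>

locale linear_ode =
  fixes n :: nat and p :: "nat \<Rightarrow> real \<Rightarrow> real" and B :: real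
  assumes order_pos: "n \<ge> 1"
    and coeff_cont: "\<And>i. i < n \<Longrightarrow> continuous_on UNIV (p i)"
    and coeff_bound: "\<And>i t. i < n \<Longrightarrow> \<bar>p i t\<bar> \<le> B"
begin

definition L :: "real \<Rightarrow> (nat \<Rightarrow> real \<Rightarrow> real) \<Rightarrow> real \<Rightarrow> real" where
  "L M U t = U n t + (\<Sum>i<n. p i t * U i t) + M * U 0 t"

definition sol :: "real \<Rightarrow> (real \<Rightarrow> real) \<Rightarrow> (nat \<Rightarrow> real \<Rightarrow> real) \<Rightarrow> bool" where
  "sol M f U \<longleftrightarrow> continuous_on UNIV f \<and>
     (\<forall>i<n. \<forall>t. (U i has_real_derivative U (Suc i) t) (at t)) \<and> (\<forall>t. L M U t = f t)"

definition energy :: "(nat \<Rightarrow> real \<Rightarrow> real) \<Rightarrow> real \<Rightarrow> real" where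
  "energy U t = (\<Sum>i<n. (U i t)\<^sup>2)"

text \<open>The rate in Gronwall's inequality for \<open>energy\<close>: \<open>2 * n\<close> comes
  from products of consecutive derivatives, \<open>2 * n * B\<close> from the coefficients,
  \<open>2 * R\<close> from the parameter, and \<open>1\<close> from
  \<open>2 * (e * F) \<le> e\<^sup>2 + F\<^sup>2\<close>.\<close>

definition growth :: "real \<Rightarrow> real" where
  "growth R = 2 * n + 1 + 2 * n * B + 2 * R"

lemma B_nonneg: "B \<ge> 0"
  using coeff_bound[of 0 0] order_pos by (meson abs_ge_zero less_le_trans order.trans zero_less_one)

lemma energy_nonneg: "energy U t \<ge> 0"
  by (simp add: energy_def sum_nonneg)

lemma component_le_energy:
  assumes "i < n"
  shows "(U i t)\<^sup>2 \<le> energy U t"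
  unfolding energy_def using assms by (intro member_le_sum) auto

lemma abs_component_le_energy: "i < n \<Longrightarrow> \<bar>U i t\<bar> \<le> sqrt (energy U t)"
  using component_le_energy[of i U t] by (metis real_sqrt_abs real_sqrt_le_mono)

lemma energy_derivative_bound:
  assumes "\<bar>L M U t\<bar> \<le> F" "\<bar>M\<bar> \<le> R"
  shows "\<bar>\<Sum>i<n. 2 * U i t * U (Suc i) t\<bar> \<le> growth R * (energy U t + F\<^sup>2)"
proof -
  define e where "e = sqrt (energy U t)"
  have e: "e \<ge> 0" "e\<^sup>2 = energy U t" using energy_nonneg by (auto simp: e_def)
  have ui: "\<bar>U i t\<bar> \<le> e" if "i < n" for i using abs_component_le_energy[OF that] by (simp add: e_def)
  have "\<bar>\<Sum>i<n. p i t * U i t\<bar> \<le> (\<Sum>i<n. B * e)"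
    by (rule order.trans[OF sum_abs sum_mono])
      (auto simp: abs_mult intro!: mult_mono coeff_bound ui B_nonneg)
  moreover have "\<bar>M * U 0 t\<bar> \<le> R * e"
    unfolding abs_mult using ui[of 0] order_pos assms(2) by (intro mult_mono) auto
  ultimately have un: "\<bar>U n t\<bar> \<le> F + n * B * e + R * e"
    using assms(1) by (simp add: L_def mult.assoc)
  \<comment> \<open>Only the last product involves \<open>U n\<close>, which the equation bounds by
    \<open>un\<close>; \<open>h\<close> holds this extra contribution.\<close>
  define h where "h i = (if i = n - 1 then e * (F + n * B * e + R * e) else 0)" for i
  have t: "\<bar>2 * U i t * U (Suc i) t\<bar> \<le> 2 * (e\<^sup>2 + h i)" if "i < n" for i
  proof (cases "i = n - 1")
    case True
    then have "\<bar>U i t\<bar> * \<bar>U (Suc i) t\<bar> \<le> h i"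
      unfolding h_def using that un ui[OF that] e by (auto intro!: mult_mono)
    moreover have "e\<^sup>2 \<ge> 0" by simp
    ultimately have "\<bar>U i t\<bar> * \<bar>U (Suc i) t\<bar> \<le> e\<^sup>2 + h i" by (rule add_increasing[rotated])
    then show ?thesis by (simp add: abs_mult)
  next
    case False
    then have "\<bar>U i t\<bar> * \<bar>U (Suc i) t\<bar> \<le> e * e"
      using that ui[of i] ui[of "Suc i"] e by (intro mult_mono) auto
    then show ?thesis unfolding abs_mult using False by (simp add: h_def power2_eq_square)
  qed
  have "\<bar>\<Sum>i<n. 2 * U i t * U (Suc i) t\<bar> \<le> (\<Sum>i<n. 2 * (e\<^sup>2 + h i))"
    using t by (intro order.trans[OF sum_abs sum_mono]) auto
  also have "\<dots> = 2 * (n * e\<^sup>2 + e * (F + n * B * e + R * e))"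
    using order_pos by (simp add: sum_distrib_left[symmetric] sum.distrib h_def sum.delta)
  also have "\<dots> = (2 * n + 2 * n * B + 2 * R) * e\<^sup>2 + 2 * (e * F)"
    by (simp add: algebra_simps power2_eq_square)
  also have "2 * (e * F) \<le> e\<^sup>2 + F\<^sup>2" using sum_squares_bound[of e F] by simp
  also have "(2 * n + 2 * n * B + 2 * R) * e\<^sup>2 + (e\<^sup>2 + F\<^sup>2) \<le> growth R * (e\<^sup>2 + F\<^sup>2)"
  proof -
    have "0 \<le> (2 * n + 2 * n * B + 2 * R) * F\<^sup>2" using B_nonneg assms(2) by auto
    then show ?thesis by (simp add: growth_def algebra_simps)
  qed
  finally show ?thesis by (simp add: e)
qed

text \<open>Gronwall in both directions of time: \<open>energy\<close> plus
  \<open>F\<^sup>2\<close>, times an exponential with rate minus or plus \<open>growth R\<close>, is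
  monotone. Derivatives are taken within the interval so that the estimate also covers classical
  solutions on \<open>I\<close>, which are only one-sidedly differentiable at the endpoints.\<close>

lemma energy_growth:
  assumes d: "\<And>i t. i < n \<Longrightarrow> t \<in> {x..y} \<Longrightarrow> (U i has_real_derivative U (Suc i) t) (at t within {x..y})"
    and F: "\<And>t. t \<in> {x..y} \<Longrightarrow> \<bar>L M U t\<bar> \<le> F" and R: "\<bar>M\<bar> \<le> R"
    and s: "s \<in> {x..y}" and t: "t \<in> {x..y}"
  shows "energy U t + F\<^sup>2 \<le> (energy U s + F\<^sup>2) * exp (growth R * \<bar>t - s\<bar>)"
proof -
  define D where "D r = (\<Sum>i<n. 2 * U i r * U (Suc i) r)" for r
  have dE: "((\<lambda>r. energy U r) has_real_derivative D r) (at r within {x..y})" if "r \<in> {x..y}" for r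
    unfolding energy_def[abs_def] D_def
    by (rule DERIV_sum, rule DERIV_cong[OF DERIV_power[OF d]]) (use that in auto)
  have D: "\<bar>D r\<bar> \<le> growth R * (energy U r + F\<^sup>2)" if "r \<in> {x..y}" for r
    unfolding D_def by (rule energy_derivative_bound[OF F[OF that] R])
  define g where "g c r = (energy U r + F\<^sup>2) * exp (c * r)" for c r
  have dg: "(g c has_real_derivative (D r + c * (energy U r + F\<^sup>2)) * exp (c * r)) (at r within {x..y})"
    if "r \<in> {x..y}" for c r
    unfolding g_def[abs_def] using that
    by (auto intro!: derivative_eq_intros dE simp: algebra_simps)
  have cg: "continuous_on {u..v} (g c)" if "x \<le> u" "v \<le> y" for c u v
    by (rule continuous_on_subset[of "{x..y}"], rule DERIV_continuous_on[OF dg]) (use that in auto)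
  have dg': "(g c has_real_derivative (D r + c * (energy U r + F\<^sup>2)) * exp (c * r)) (at r)"
    if "x < r" "r < y" for c r
    using dg[of r c] that at_within_Icc_at[of x r y] by auto
  show ?thesis
  proof (cases "s \<le> t")
    case True
    have "g (- growth R) t \<le> g (- growth R) s"
    proof (rule DERIV_nonpos_imp_decreasing_open[OF True _ cg])
      fix r assume r: "s < r" "r < t"
      then have "D r + - growth R * (energy U r + F\<^sup>2) \<le> 0" using D[of r] s t by auto
      then show "\<exists>z. (g (- growth R) has_real_derivative z) (at r) \<and> z \<le> 0"
        by (intro exI[of _ "(D r + - growth R * (energy U r + F\<^sup>2)) * exp (- growth R * r)"]
            conjI dg' mult_nonpos_nonneg) (use r s t in auto)
    qed (use s t in auto)
    then have "g (- growth R) t * exp (growth R * t) \<le> g (- growth R) s * exp (growth R * t)" by simp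
    then show ?thesis using True by (simp add: g_def mult.assoc mult_exp_exp algebra_simps)
  next
    case False
    have "g (growth R) t \<le> g (growth R) s"
    proof (rule DERIV_nonneg_imp_increasing_open[OF _ _ cg])
      show "t \<le> s" using False by simp
      fix r assume r: "t < r" "r < s"
      then have "D r + growth R * (energy U r + F\<^sup>2) \<ge> 0" using D[of r] s t by auto
      then show "\<exists>z. (g (growth R) has_real_derivative z) (at r) \<and> z \<ge> 0"
        by (intro exI[of _ "(D r + growth R * (energy U r + F\<^sup>2)) * exp (growth R * r)"]
            conjI dg' mult_nonneg_nonneg) (use r s t in auto)
    qed (use s t in auto)
    then have "g (growth R) t * exp (- growth R * t) \<le> g (growth R) s * exp (- growth R * t)" by simp
    then show ?thesis using False by (simp add: g_def mult.assoc mult_exp_exp algebra_simps)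
  qed
qed

lemma sol_deriv: "sol M f U \<Longrightarrow> i < n \<Longrightarrow> (U i has_real_derivative U (Suc i) t) (at t)"
  by (simp add: sol_def)

lemma sol_L: "sol M f U \<Longrightarrow> L M U t = f t"
  by (simp add: sol_def)

lemma sol_top: "sol M f U \<Longrightarrow> U n t = f t - (\<Sum>i<n. p i t * U i t) - M * U 0 t"
  by (simp add: sol_def L_def algebra_simps)

lemma sol_isCont:
  assumes "sol M f U" "i \<le> n"
  shows "isCont (U i) t"
proof (cases "i < n")
  case True
  then show ?thesis using sol_deriv[OF assms(1)] DERIV_isCont by blast
next
  case False
  have c: "isCont (U i) t" if "i < n" for i t using sol_deriv[OF assms(1) that] DERIV_isCont by blast
  have "U n = (\<lambda>t. f t - (\<Sum>i<n. p i t * U i t) - M * U 0 t)"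
    using sol_top[OF assms(1)] by blast
  moreover have "isCont f t" "\<And>i. i < n \<Longrightarrow> isCont (p i) t"
    using assms(1) coeff_cont by (auto simp: sol_def continuous_on_eq_continuous_at)
  then have "isCont (\<lambda>t. f t - (\<Sum>i<n. p i t * U i t) - M * U 0 t) t"
    using c order_pos by (intro continuous_intros) auto
  ultimately show ?thesis using False assms(2) by (simp add: le_less)
qed

lemma sol_continuous_on: "sol M f U \<Longrightarrow> i \<le> n \<Longrightarrow> continuous_on S (U i)"
  using sol_isCont by (blast intro: continuous_at_imp_continuous_on)

lemma L_add: "L M (\<lambda>i t. \<alpha> * U i t + \<beta> * V i t) t = \<alpha> * L M U t + \<beta> * L M V t"
  by (simp add: L_def algebra_simps sum.distrib sum_distrib_left)

lemma sol_add:
  assumes "sol M f U" "sol M g V"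
  shows "sol M (\<lambda>t. \<alpha> * f t + \<beta> * g t) (\<lambda>i t. \<alpha> * U i t + \<beta> * V i t)"
  unfolding sol_def
proof (intro conjI allI impI)
  show "continuous_on UNIV (\<lambda>t. \<alpha> * f t + \<beta> * g t)"
    using assms by (intro continuous_intros) (auto simp: sol_def)
  show "((\<lambda>t. \<alpha> * U i t + \<beta> * V i t) has_real_derivative \<alpha> * U (Suc i) t + \<beta> * V (Suc i) t) (at t)"
    if "i < n" for i t
    by (intro DERIV_add DERIV_cmult sol_deriv[OF assms(1) that] sol_deriv[OF assms(2) that])
qed (use assms in \<open>simp add: L_add sol_def\<close>)

text \<open>Moving a multiple of \<open>u\<close> to the right-hand side turns solutions for
  different parameters into solutions for one parameter; all comparison arguments below rest on
  this.\<close>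

lemma sol_shift:
  assumes "sol M f U"
  shows "sol M' (\<lambda>t. f t + (M' - M) * U 0 t) U"
  unfolding sol_def
proof (intro conjI allI impI)
  have "continuous_on UNIV (U 0)" using sol_continuous_on[OF assms] by simp
  then show "continuous_on UNIV (\<lambda>t. f t + (M' - M) * U 0 t)"
    using assms by (intro continuous_intros) (auto simp: sol_def)
qed (use assms in \<open>auto simp: sol_def L_def algebra_simps\<close>)

lemma sol_sum:
  fixes m :: nat
  assumes "\<And>q. q < m \<Longrightarrow> sol M (f q) (U q)"
  shows "sol M (\<lambda>t. \<Sum>q<m. \<alpha> q * f q t) (\<lambda>i t. \<Sum>q<m. \<alpha> q * U q i t)"
  using assms
proof (induction m)
  case 0
  then show ?case by (auto simp: sol_def L_def intro!: derivative_eq_intros)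
next
  case (Suc m)
  then have "sol M (\<lambda>t. \<Sum>q<m. \<alpha> q * f q t) (\<lambda>i t. \<Sum>q<m. \<alpha> q * U q i t)" "sol M (f m) (U m)"
    by auto
  from sol_add[OF this, of 1 "\<alpha> m"] show ?case by simp
qed

lemma sol_zero_on:
  assumes d: "\<And>i t. i < n \<Longrightarrow> t \<in> {x..y} \<Longrightarrow> (U i has_real_derivative U (Suc i) t) (at t within {x..y})"
    and "\<And>t. t \<in> {x..y} \<Longrightarrow> L M U t = 0"
    and s: "s \<in> {x..y}" "\<And>i. i < n \<Longrightarrow> U i s = 0" and t: "t \<in> {x..y}" and "i \<le> n"
  shows "U i t = 0"
proof -
  have "energy U s = 0" using s by (simp add: energy_def)
  then have "energy U t \<le> 0"
    using energy_growth[where x = x and y = y and U = U and M = M and F = 0 and R = "\<bar>M\<bar>"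
        and s = s and t = t] assms by simp
  then have e: "energy U t = 0" using energy_nonneg[of U t] by simp
  have z: "U i t = 0" if "i < n" for i
    using component_le_energy[OF that, of U t] e by simp
  then show ?thesis
    using assms(2)[OF t] \<open>i \<le> n\<close> order_pos by (cases "i = n") (auto simp: L_def)
qed

lemma sol_unique_on:
  assumes "sol M f U" "sol M g V" and fg: "\<And>t. t \<in> {x..y} \<Longrightarrow> f t = g t"
    and s: "s \<in> {x..y}" "\<And>i. i < n \<Longrightarrow> U i s = V i s" and t: "t \<in> {x..y}" and "i \<le> n"
  shows "U i t = V i t"
proof -
  define D where "D i t = 1 * U i t + (-1) * V i t" for i t
  have D: "sol M (\<lambda>t. 1 * f t + (-1) * g t) D"
    unfolding D_def[abs_def] by (rule sol_add[OF assms(1,2)])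
  have "D i t = 0"
  proof (rule sol_zero_on[where M = M and s = s, OF _ _ s(1) _ t \<open>i \<le> n\<close>])
    show "(D i has_real_derivative D (Suc i) t) (at t within {x..y})" if "i < n" for i t
      using sol_deriv[OF D that] has_field_derivative_at_within by blast
    show "L M D t = 0" if "t \<in> {x..y}" for t using sol_L[OF D, of t] fg[OF that] by simp
  qed (use s in \<open>simp add: D_def\<close>)
  then show ?thesis by (simp add: D_def)
qed

lemma sol_unique:
  assumes "sol M f U" "sol M f V" "\<And>i. i < n \<Longrightarrow> U i s = V i s" "i \<le> n"
  shows "U i t = V i t"
  by (rule sol_unique_on[OF assms(1,2), where x = "min s t" and y = "max s t" and s = s])
    (use assms in auto)

text \<open>The highest derivative of the solution is the fixed point of a Volterra operator, which is a
  contraction for the supremum norm weighted by \<open>1 / w\<close> with \<open>w t = 2 cosh (K (t - s))\<close>, \<open>K\<close> large.\<close>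

lemma sol_exists:
  assumes f: "continuous_on UNIV f" "\<And>t. \<bar>f t\<bar> \<le> C"
  shows "\<exists>U. sol M f U \<and> (\<forall>i<n. U i s = v i)"
proof -
  define Q where "Q = B + \<bar>M\<bar>"
  \<comment> \<open>Large enough for the contraction constant \<open>n * Q / K\<close> to be at most
    \<open>1 / 2\<close>.\<close>
  define K where "K = 2 * n * Q + 1"
  define w where "w t = exp (K * (t - s)) + exp (- (K * (t - s)))" for t
  define q where "q i t = p i t + (if i = 0 then M else 0)" for i t
  define V where "V = (\<Sum>i<n. \<bar>v i\<bar>)"
  define prim where "prim g = (SOME G. G s = 0 \<and> (\<forall>t. (G has_real_derivative g t) (at t)))"
    for g :: "real \<Rightarrow> real"
  have prim: "prim g s = 0" "(prim g has_real_derivative g t) (at t)" if "continuous_on UNIV g" for g t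
    using someI_ex[OF antiderivative_exists[OF that, of s]] unfolding prim_def by auto
  \<comment> \<open>If \<open>\<phi>\<close> is the \<open>n\<close>-th derivative,
    \<open>ch \<phi> j\<close> is the derivative of order \<open>n - j\<close>, rebuilt by
    integration from the initial values \<open>v\<close> at \<open>s\<close>.\<close>
  define ch where "ch \<phi> j = rec_nat \<phi> (\<lambda>j g t. v (n - Suc j) + prim g t) j" for \<phi> j
  have ch0: "ch \<phi> 0 = \<phi>" and chS: "ch \<phi> (Suc j) = (\<lambda>t. v (n - Suc j) + prim (ch \<phi> j) t)" for \<phi> j
    by (simp_all add: ch_def)
  have Q: "Q \<ge> 0" using B_nonneg by (simp add: Q_def)
  have K: "K \<ge> 1" using Q by (simp add: K_def)
  have q: "\<bar>q i t\<bar> \<le> Q" "continuous_on UNIV (q i)" if "i < n" for i t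
    using coeff_bound[OF that, of t] coeff_cont[OF that]
    by (auto simp: q_def[abs_def] Q_def intro!: continuous_intros)
  have w1: "w t \<ge> 1" for t
  proof (cases "K * (t - s) \<ge> 0")
    case True
    then have "exp (K * (t - s)) \<ge> 1" by simp
    then show ?thesis using exp_ge_zero[of "- (K * (t - s))"] unfolding w_def by linarith
  next
    case False
    then have "exp (- (K * (t - s))) \<ge> 1" by simp
    then show ?thesis using exp_ge_zero[of "K * (t - s)"] unfolding w_def by linarith
  qed
  have wc: "continuous_on UNIV w" unfolding w_def[abs_def] by (intro continuous_intros)
  have chc: "continuous_on UNIV (ch \<phi> j)" if "continuous_on UNIV \<phi>" for \<phi> j
  proof (induction j)
    case (Suc j)
    have "continuous_on UNIV (prim (ch \<phi> j))"
      using prim(2)[OF Suc] by (meson DERIV_isCont continuous_at_imp_continuous_on)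
    then show ?case unfolding chS by (intro continuous_intros)
  qed (simp add: ch0 that)
  have V: "V \<ge> 0" "\<And>i. i < n \<Longrightarrow> \<bar>v i\<bar> \<le> V"
    unfolding V_def by (auto intro!: sum_nonneg member_le_sum[of _ "{..<n}" "\<lambda>i. \<bar>v i\<bar>"])
  have ch_bound: "\<bar>ch \<phi> j t\<bar> \<le> (A + j * V) * w t"
    if "continuous_on UNIV \<phi>" "\<And>t. \<bar>\<phi> t\<bar> \<le> A * w t" "j \<le> n" for \<phi> A j t
    using that(3)
  proof (induction j arbitrary: t)
    case 0
    then show ?case using that by (simp add: ch0)
  next
    case (Suc j)
    have A: "A \<ge> 0" using that(2)[of s] w1[of s] abs_ge_zero[of "\<phi> s"]
      by (meson mult_neg_pos not_le order.strict_trans2 order.trans zero_less_one)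
    have "\<bar>prim (ch \<phi> j) t\<bar> \<le> (A + j * V) / K * w t"
      by (rule antiderivative_weighted_bound[OF prim(1) prim(2)])
        (use that Suc K in \<open>auto simp: w_def intro!: chc\<close>)
    also have "\<dots> \<le> (A + j * V) * w t"
    proof (intro mult_right_mono)
      have "A + j * V \<ge> 0" using A V by simp
      then show "(A + j * V) / K \<le> A + j * V" using K by (simp add: divide_le_eq mult_le_cancel_left1)
    qed (use w1[of t] in auto)
    finally have "\<bar>prim (ch \<phi> j) t\<bar> \<le> (A + j * V) * w t" .
    moreover have "\<bar>v (n - Suc j)\<bar> \<le> V * w t"
    proof -
      have "\<bar>v (n - Suc j)\<bar> \<le> V" using V(2) Suc.prems by simp
      also have "\<dots> \<le> V * w t" using V(1) w1[of t] by (simp add: mult_le_cancel_left1)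
      finally show ?thesis .
    qed
    ultimately show ?case unfolding chS by (simp add: algebra_simps)
  qed
  \<comment> \<open>The initial values cancel in the difference. Only the last integration has to
    supply the factor \<open>1 / K\<close>; the earlier ones do not increase the bound, as
    \<open>K \<ge> 1\<close>.\<close>
  have ch_lip: "\<bar>ch \<phi> (Suc j) t - ch \<psi> (Suc j) t\<bar> \<le> d / K * w t"
    if c: "continuous_on UNIV \<phi>" "continuous_on UNIV \<psi>" and d: "\<And>t. \<bar>\<phi> t - \<psi> t\<bar> \<le> d * w t"
    for \<phi> \<psi> d j t
  proof -
    have d0: "d \<ge> 0" using d[of s] w1[of s] abs_ge_zero[of "\<phi> s - \<psi> s"]
      by (meson mult_neg_pos not_le order.strict_trans2 order.trans zero_less_one)
    have step: "\<bar>ch \<phi> (Suc j) t - ch \<psi> (Suc j) t\<bar> \<le> d' / K * w t"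
      if "\<And>t. \<bar>ch \<phi> j t - ch \<psi> j t\<bar> \<le> d' * w t" for d' j t
    proof -
      have "\<bar>prim (ch \<phi> j) t - prim (ch \<psi> j) t\<bar> \<le> d' / K * w t"
        by (rule antiderivative_weighted_bound[of "\<lambda>t. prim (ch \<phi> j) t - prim (ch \<psi> j) t" s
              "\<lambda>t. ch \<phi> j t - ch \<psi> j t" K w d'])
          (use that K prim chc c in \<open>auto simp: w_def intro!: DERIV_diff\<close>)
      then show ?thesis by (simp add: chS)
    qed
    show ?thesis
    proof (induction j arbitrary: t)
      case 0
      show ?case using d by (intro step) (simp add: ch0)
    next
      case (Suc j)
      have "\<bar>ch \<phi> (Suc j) t - ch \<psi> (Suc j) t\<bar> \<le> d * w t" for t
      proof -
        have "d / K \<le> d" using K d0 by (simp add: divide_le_eq mult_le_cancel_left1)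
        then show ?thesis using Suc[of t] w1[of t] mult_right_mono[of "d / K" d "w t"] by linarith
      qed
      then show ?case by (rule step)
    qed
  qed
  \<comment> \<open>The unknown is \<open>\<psi> = \<phi> / w\<close>: this turns the weighted norm
    into the supremum norm of bounded continuous functions, where the Banach fixed point theorem is
    available.\<close>
  define \<Psi> where "\<Psi> \<psi> t = (f t - (\<Sum>i<n. q i t * ch (\<lambda>t. apply_bcontfun \<psi> t * w t) (n - i) t)) / w t" for \<psi> t
  have \<psi>c: "continuous_on UNIV (\<lambda>t. apply_bcontfun \<psi> t * w t)" for \<psi>
    by (intro continuous_on_mult wc continuous_on_apply_bcontfun)
  have \<Psi>: "\<Psi> \<psi> \<in> bcontfun" for \<psi>
  proof (rule bcontfun_normI)
    have "w t \<noteq> 0" for t using w1[of t] by linarith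
    then show "continuous_on UNIV (\<Psi> \<psi>)"
      unfolding \<Psi>_def[abs_def] by (intro continuous_intros f wc q chc \<psi>c) auto
    fix t
    define A where "A = norm \<psi>"
    have A: "\<bar>apply_bcontfun \<psi> t * w t\<bar> \<le> A * w t" for t
      using norm_bounded[of \<psi> t] w1[of t] by (auto simp: abs_mult A_def intro!: mult_mono)
    have "\<bar>\<Sum>i<n. q i t * ch (\<lambda>t. apply_bcontfun \<psi> t * w t) (n - i) t\<bar> \<le> (\<Sum>i<n. Q * ((A + n * V) * w t))"
    proof (rule order.trans[OF sum_abs sum_mono])
      fix i assume i: "i \<in> {..<n}"
      have "\<bar>ch (\<lambda>t. apply_bcontfun \<psi> t * w t) (n - i) t\<bar> \<le> (A + (n - i) * V) * w t"
        by (rule ch_bound[OF \<psi>c A]) simp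
      also have "\<dots> \<le> (A + n * V) * w t"
        using w1[of t] V by (intro mult_right_mono add_left_mono) auto
      finally show "\<bar>q i t * ch (\<lambda>t. apply_bcontfun \<psi> t * w t) (n - i) t\<bar> \<le> Q * ((A + n * V) * w t)"
        unfolding abs_mult using q[of i] i Q by (intro mult_mono) auto
    qed
    then have "\<bar>f t - (\<Sum>i<n. q i t * ch (\<lambda>t. apply_bcontfun \<psi> t * w t) (n - i) t)\<bar>
        \<le> C + n * Q * (A + n * V) * w t"
      using f(2)[of t] by (simp add: mult.assoc)
    also have "\<dots> \<le> (C + n * Q * (A + n * V)) * w t"
      using w1[of t] f(2)[of t] by (simp add: distrib_right mult_le_cancel_left1)
    finally show "norm (\<Psi> \<psi> t) \<le> C + n * Q * (A + n * V)"
      using w1[of t] by (simp add: \<Psi>_def abs_divide divide_le_eq)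
  qed
  have app: "apply_bcontfun (Bcontfun (\<Psi> \<psi>)) = \<Psi> \<psi>" for \<psi> by (rule Bcontfun_inverse[OF \<Psi>])
  have "\<exists>!\<psi>. Bcontfun (\<Psi> \<psi>) = \<psi>"
  proof (rule banach_fix_type[of "1/2"])
    show "\<forall>\<phi> \<psi>. dist (Bcontfun (\<Psi> \<phi>)) (Bcontfun (\<Psi> \<psi>)) \<le> 1 / 2 * dist \<phi> \<psi>"
    proof (intro allI dist_bound, unfold app)
      fix \<phi> \<psi> :: "real \<Rightarrow>\<^sub>C real" and t
      define d where "d = dist \<phi> \<psi>"
      have d: "\<bar>apply_bcontfun \<phi> t * w t - apply_bcontfun \<psi> t * w t\<bar> \<le> d * w t" for t
        using dist_bounded[of \<phi> t \<psi>] w1[of t]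
        by (simp add: left_diff_distrib[symmetric] abs_mult d_def dist_real_def mult_mono)
      have d0: "d \<ge> 0" by (simp add: d_def)
      have "\<bar>\<Psi> \<phi> t - \<Psi> \<psi> t\<bar> = \<bar>\<Sum>i<n. q i t * (ch (\<lambda>t. apply_bcontfun \<phi> t * w t) (n - i) t
          - ch (\<lambda>t. apply_bcontfun \<psi> t * w t) (n - i) t)\<bar> / w t"
        using w1[of t] unfolding \<Psi>_def diff_divide_distrib[symmetric] abs_divide
        by (simp add: right_diff_distrib sum_subtractf abs_minus_commute)
      also have "\<dots> \<le> (\<Sum>i<n. Q * (d / K * w t)) / w t"
      proof (intro divide_right_mono order.trans[OF sum_abs sum_mono])
        fix i assume i: "i \<in> {..<n}"
        have "\<bar>ch (\<lambda>t. apply_bcontfun \<phi> t * w t) (Suc (n - Suc i)) t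
            - ch (\<lambda>t. apply_bcontfun \<psi> t * w t) (Suc (n - Suc i)) t\<bar> \<le> d / K * w t"
          by (rule ch_lip[OF \<psi>c \<psi>c d])
        then have "\<bar>ch (\<lambda>t. apply_bcontfun \<phi> t * w t) (n - i) t
            - ch (\<lambda>t. apply_bcontfun \<psi> t * w t) (n - i) t\<bar> \<le> d / K * w t"
          using i by (simp add: Suc_diff_Suc)
        then show "\<bar>q i t * (ch (\<lambda>t. apply_bcontfun \<phi> t * w t) (n - i) t
            - ch (\<lambda>t. apply_bcontfun \<psi> t * w t) (n - i) t)\<bar> \<le> Q * (d / K * w t)"
          unfolding abs_mult using q[of i] i Q by (intro mult_mono) auto
      qed (use w1[of t] in auto)
      also have "\<dots> = n * Q * d / K" using w1[of t] by auto
      also have "\<dots> \<le> 1 / 2 * d"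
        using K d0 by (simp add: divide_le_eq) (simp add: K_def algebra_simps)
      finally show "dist (\<Psi> \<phi> t) (\<Psi> \<psi> t) \<le> 1 / 2 * dist \<phi> \<psi>" by (simp add: dist_real_def d_def)
    qed
  qed auto
  then obtain \<psi> where "Bcontfun (\<Psi> \<psi>) = \<psi>" by blast
  then have fp: "apply_bcontfun \<psi> t = \<Psi> \<psi> t" for t using app[of \<psi>] by metis
  define \<phi> where "\<phi> t = apply_bcontfun \<psi> t * w t" for t
  define U where "U i = ch \<phi> (n - i)" for i
  have \<phi>c: "continuous_on UNIV \<phi>" unfolding \<phi>_def[abs_def] by (rule \<psi>c)
  have "\<phi> t = f t - (\<Sum>i<n. q i t * U i t)" for t
    using w1[of t] fp[of t] by (simp add: \<phi>_def[abs_def] \<Psi>_def U_def)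
  moreover have "(\<Sum>i<n. q i t * U i t) = (\<Sum>i<n. p i t * U i t) + M * U 0 t" for t
    using order_pos
    by (simp add: q_def distrib_right sum.distrib if_distrib[of "\<lambda>x. x * _"] sum.delta cong: if_cong)
  ultimately have eq: "L M U t = f t" for t by (simp add: L_def U_def ch0)
  have Ui: "U i = (\<lambda>t. v i + prim (U (Suc i)) t)" if "i < n" for i
    using chS[of \<phi> "n - Suc i"] that by (simp add: U_def Suc_diff_Suc)
  have Uc: "continuous_on UNIV (U i)" for i unfolding U_def by (rule chc[OF \<phi>c])
  have "(U i has_real_derivative U (Suc i) t) (at t)" if "i < n" for i t
    by (subst Ui[OF that]) (auto intro!: derivative_eq_intros prim(2) Uc)
  moreover have "U i s = v i" if "i < n" for i using Ui[OF that] prim(1)[OF Uc] by simp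
  ultimately show ?thesis using f eq by (intro exI[of _ U]) (auto simp: sol_def)
qed

section \<open>Compactness of solutions and disconjugacy\<close>

abbreviation hom :: "real \<Rightarrow> (nat \<Rightarrow> real \<Rightarrow> real) \<Rightarrow> bool" where
  "hom M \<equiv> sol M (\<lambda>_. 0)"

definition vanishes :: "(nat \<Rightarrow> real \<Rightarrow> real) \<Rightarrow> nat \<Rightarrow> real \<Rightarrow> bool" where
  "vanishes U k t \<longleftrightarrow> (\<forall>i<k. U i t = 0)"

definition trivial :: "(nat \<Rightarrow> real \<Rightarrow> real) \<Rightarrow> bool" where
  "trivial U \<longleftrightarrow> (\<forall>i\<le>n. \<forall>t. U i t = 0)"

text \<open>\<open>y\<close> is a conjugate point of \<open>x\<close> of type
  \<open>(k, n - k)\<close>. For the endpoints of \<open>I\<close> this says that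
  \<open>Mbar - M\<close> is an eigenvalue of the operator with parameter \<open>Mbar\<close> in
  \<open>X_space n k a b\<close>.\<close>

definition singular :: "real \<Rightarrow> nat \<Rightarrow> real \<Rightarrow> real \<Rightarrow> bool" where
  "singular M k x y \<longleftrightarrow> (\<exists>U. hom M U \<and> \<not> trivial U \<and> vanishes U k x \<and> vanishes U (n - k) y)"

text \<open>\<open>\<mu>\<close> may undercount the zeros of \<open>U\<close>, so neither exact
  multiplicities nor finiteness of the zero set enter the arguments.\<close>

definition dis :: "real \<Rightarrow> real \<Rightarrow> real \<Rightarrow> bool" where
  "dis M x y \<longleftrightarrow> (\<forall>U \<mu>. hom M U \<and> has_zeros U \<mu> {x..y} \<and> n \<le> zero_count \<mu> \<longrightarrow> trivial U)"

lemma vanishes_mono: "vanishes U k t \<Longrightarrow> l \<le> k \<Longrightarrow> vanishes U l t"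
  by (auto simp: vanishes_def)

lemma vanishes_Suc: "vanishes U (Suc k) t \<longleftrightarrow> vanishes U k t \<and> U k t = 0"
  by (auto simp: vanishes_def less_Suc_eq)

lemma vanishes_combination:
  "vanishes U k t \<Longrightarrow> vanishes V k t \<Longrightarrow> vanishes (\<lambda>i t. \<alpha> * U i t + \<beta> * V i t) k t"
  by (auto simp: vanishes_def)

lemma hom_zero: "hom M (\<lambda>_ _. 0)"
  by (simp add: sol_def L_def)

lemma hom_trivial:
  assumes "hom M U" "vanishes U n s"
  shows "trivial U"
  unfolding trivial_def
  using sol_unique[OF assms(1) hom_zero[of M], of s] assms(2) by (simp add: vanishes_def)

lemma hom_combination: "hom M U \<Longrightarrow> hom M V \<Longrightarrow> hom M (\<lambda>i t. \<alpha> * U i t + \<beta> * V i t)"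
  using sol_add[of M "\<lambda>_. 0" U "\<lambda>_. 0" V \<alpha> \<beta>] by simp

lemma hom_sum:
  fixes m :: nat
  assumes "\<And>q. q < m \<Longrightarrow> hom M (U q)"
  shows "hom M (\<lambda>i t. \<Sum>q<m. \<alpha> q * U q i t)"
  using sol_sum[of m M "\<lambda>_ _. 0" U \<alpha>] assms by simp

lemma energy_pos:
  assumes "hom M U" "\<not> trivial U"
  shows "energy U s > 0"
proof (rule ccontr)
  assume "\<not> ?thesis"
  then have "energy U s = 0" using energy_nonneg[of U s] by simp
  then have "vanishes U n s"
    using component_le_energy[of _ U s] by (auto simp: vanishes_def)
  then show False using hom_trivial assms by blast
qed

lemma energy_normalize:
  assumes "energy U s > 0"
  shows "energy (\<lambda>i t. U i t / sqrt (energy U s)) s = 1"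
proof -
  have "energy (\<lambda>i t. U i t / sqrt (energy U s)) s = energy U s / energy U s"
    unfolding energy_def[of "\<lambda>i t. U i t / sqrt (energy U s)"]
    using assms by (simp add: power_divide sum_divide_distrib[symmetric]) (simp add: energy_def)
  then show ?thesis using assms by simp
qed

lemma sol_divide:
  assumes "sol M f U"
  shows "sol M (\<lambda>t. f t / c) (\<lambda>i t. U i t / c)"
  using sol_add[OF assms assms, of "1 / c" 0] by simp

lemma basis_exists:
  "\<exists>Y. \<forall>q<n. hom M (Y q) \<and> (\<forall>i<n. Y q i s = (if i = q then 1 else 0))"
proof -
  have "\<exists>U. hom M U \<and> (\<forall>i<n. U i s = (if i = q then 1 else 0))" for q
    using sol_exists[of "\<lambda>_. 0" 0 M s "\<lambda>i. if i = q then 1 else 0"] by simp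
  then show ?thesis by metis
qed

section \<open>Interpolation conditions\<close>

lemma interpolation_hom:
  assumes "m < n"
  shows "\<exists>U. hom M U \<and> \<not> trivial U \<and> (\<forall>q<m. U (ii q) (tt q) = 0)"
proof -
  obtain Y where Y: "\<And>q. q < n \<Longrightarrow> hom M (Y q)"
    "\<And>q i. q < n \<Longrightarrow> i < n \<Longrightarrow> Y q i 0 = (if i = q then 1 else 0)"
    using basis_exists[of M 0] by blast
  obtain v where v: "\<exists>p<n. v p \<noteq> 0" "\<forall>q<m. (\<Sum>p<n. Y p (ii q) (tt q) * v p) = 0"
    using homogeneous_system_nontrivial[OF assms, of "\<lambda>q p. Y p (ii q) (tt q)"] by blast
  define U where "U i t = (\<Sum>p<n. v p * Y p i t)" for i t
  have "hom M U" unfolding U_def[abs_def] by (rule hom_sum) (rule Y)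
  moreover have "U i 0 = v i" if "i < n" for i
  proof -
    have "U i 0 = (\<Sum>p<n. if p = i then v i else 0)"
      unfolding U_def using Y(2) that by (intro sum.cong) auto
    then show ?thesis using that by simp
  qed
  then have "\<not> trivial U" using v by (auto simp: trivial_def) (metis less_imp_le_nat)
  ultimately show ?thesis using v by (intro exI[of _ U]) (auto simp: U_def mult.commute)
qed

text \<open>The Fredholm alternative without determinants: a particular solution joined to a basis
  of the homogeneous ones gives \<open>n + 1\<close> unknowns for \<open>n\<close> conditions, and
  uniqueness forces the particular solution to occur with a nonzero coefficient.\<close>

lemma interpolation:
  assumes uniq: "\<And>U. hom M U \<Longrightarrow> (\<And>q. q < n \<Longrightarrow> U (ii q) (tt q) = 0) \<Longrightarrow> trivial U"
    and f: "continuous_on UNIV f" "\<And>t. \<bar>f t\<bar> \<le> C"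
  shows "\<exists>U. sol M f U \<and> (\<forall>q<n. U (ii q) (tt q) = 0)"
proof -
  obtain Y where Y: "\<And>q. q < n \<Longrightarrow> hom M (Y q)"
    "\<And>q i. q < n \<Longrightarrow> i < n \<Longrightarrow> Y q i 0 = (if i = q then 1 else 0)"
    using basis_exists[of M 0] by blast
  obtain V where V: "sol M f V" using sol_exists[OF f] by blast
  define X where "X p = (if p < n then Y p else V)" for p
  obtain v where v: "\<exists>p<Suc n. v p \<noteq> 0" "\<forall>q<n. (\<Sum>p<Suc n. X p (ii q) (tt q) * v p) = 0"
    using homogeneous_system_nontrivial[of n "Suc n" "\<lambda>q p. X p (ii q) (tt q)"] by blast
  define W where "W i t = (\<Sum>p<n. v p * Y p i t)" for i t
  have W: "hom M W" unfolding W_def[abs_def] by (rule hom_sum) (rule Y)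
  have W0: "W i 0 = v i" if "i < n" for i
  proof -
    have "W i 0 = (\<Sum>p<n. if p = i then v i else 0)"
      unfolding W_def using Y(2) that by (intro sum.cong) auto
    then show ?thesis using that by simp
  qed
  have z: "W (ii q) (tt q) + v n * V (ii q) (tt q) = 0" if "q < n" for q
    using v(2) that by (simp add: X_def W_def mult.commute)
  have "v n \<noteq> 0"
  proof
    assume v0: "v n = 0"
    then have "trivial W" using uniq[OF W] z by simp
    then have "v i = 0" if "i < n" for i using W0[OF that] that by (simp add: trivial_def)
    then show False using v(1) v0 by (auto simp: less_Suc_eq)
  qed
  then show ?thesis
    using sol_add[OF W V, of "1 / v n" 1] z
    by (intro exI[of _ "\<lambda>i t. 1 / v n * W i t + 1 * V i t"]) (auto simp: field_simps)
qed

lemma two_point_conditions: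
  "(\<forall>q<k + l. U (if q < k then q else q - k) (if q < k then x else y) = 0) \<longleftrightarrow>
     vanishes U k x \<and> vanishes U l y"
proof
  assume H: "\<forall>q<k + l. U (if q < k then q else q - k) (if q < k then x else y) = 0"
  have "U i x = 0" if "i < k" for i using H[rule_format, of i] that by simp
  moreover have "U i y = 0" if "i < l" for i using H[rule_format, of "k + i"] that by simp
  ultimately show "vanishes U k x \<and> vanishes U l y" by (simp add: vanishes_def)
qed (auto simp: vanishes_def)

lemma two_point_hom:
  assumes "k + l < n"
  shows "\<exists>U. hom M U \<and> \<not> trivial U \<and> vanishes U k x \<and> vanishes U l y"
  using interpolation_hom[OF assms, of M "\<lambda>q. if q < k then q else q - k" "\<lambda>q. if q < k then x else y"]
  unfolding two_point_conditions .

lemma bvp_exists: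
  assumes "\<not> singular M k x y" "k \<le> n" "continuous_on UNIV f" "\<And>t. \<bar>f t\<bar> \<le> C"
  shows "\<exists>U. sol M f U \<and> vanishes U k x \<and> vanishes U (n - k) y"
proof -
  have conds: "(\<forall>q<n. U (if q < k then q else q - k) (if q < k then x else y) = 0) \<longleftrightarrow>
     vanishes U k x \<and> vanishes U (n - k) y" for U
    using two_point_conditions[of k "n - k" U x y] assms(2) by simp
  have "\<exists>U. sol M f U \<and> (\<forall>q<n. U (if q < k then q else q - k) (if q < k then x else y) = 0)"
  proof (rule interpolation[OF _ assms(3,4)])
    fix U assume "hom M U" "\<And>q. q < n \<Longrightarrow> U (if q < k then q else q - k) (if q < k then x else y) = 0"
    then show "trivial U" using conds[of U] assms(1) unfolding singular_def by blast
  qed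
  then show ?thesis unfolding conds .
qed

text \<open>Initial data of unit energy have a convergent subsequence, whose limit determines
  \<open>U\<close>. The difference from \<open>U\<close> solves the limit equation up to a source
  bounded by \<open>\<eta>\<close>, and Gronwall makes the convergence uniform on
  \<open>{x..y}\<close>; this is why the evaluation points \<open>T j\<close> may move.\<close>

lemma sol_compactness:
  assumes Ms: "Ms \<longlonglongrightarrow> M" and sols: "\<And>j. sol (Ms j) (fs j) (Us j)"
    and fs: "\<And>j t. t \<in> {x..y} \<Longrightarrow> \<bar>fs j t\<bar> \<le> \<epsilon> j" and \<epsilon>: "\<epsilon> \<longlonglongrightarrow> 0"
    and s: "s \<in> {x..y}" and e1: "\<And>j. energy (Us j) s = 1"
  shows "\<exists>r U. strict_mono r \<and> hom M U \<and> energy U s = 1 \<and>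
    (\<forall>i T t. i < n \<longrightarrow> (\<forall>j. T j \<in> {x..y}) \<longrightarrow> T \<longlonglongrightarrow> t \<longrightarrow> (\<lambda>j. Us (r j) i (T j)) \<longlonglongrightarrow> U i t)"
proof -
  have "\<bar>Us j i s\<bar> \<le> 1" if "i < n" for i j
    using abs_component_le_energy[OF that, of "Us j" s] e1 by simp
  then obtain r l where r: "strict_mono r" "\<And>i. i < n \<Longrightarrow> (\<lambda>j. Us (r j) i s) \<longlonglongrightarrow> l i"
    using bounded_sequences_convergent_subsequence[of n "\<lambda>j i. Us j i s" 1] by blast
  obtain U where U: "hom M U" "\<And>i. i < n \<Longrightarrow> U i s = l i"
    using sol_exists[of "\<lambda>_. 0" 0 M s l] by auto
  have "(\<lambda>j. energy (Us (r j)) s) \<longlonglongrightarrow> energy U s"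
    unfolding energy_def using r U by (intro tendsto_intros) auto
  then have eU: "energy U s = 1" using LIMSEQ_unique[OF _ tendsto_const] by (simp add: e1)
  obtain R where R: "\<And>j. \<bar>Ms j\<bar> \<le> R"
    using convergent_imp_bounded[OF Ms] by (auto simp: bounded_iff)
  obtain E where E: "\<And>j. \<bar>\<epsilon> j\<bar> \<le> E"
    using convergent_imp_bounded[OF \<epsilon>] by (auto simp: bounded_iff)
  define K where "K = sqrt ((1 + E\<^sup>2) * exp (growth R * (y - x)))"
  have R0: "R \<ge> 0" using R[of 0] by linarith
  have gr: "growth c \<ge> 0" if "c \<ge> 0" for c using that B_nonneg by (simp add: growth_def)
  have Us_bound: "\<bar>Us j 0 t\<bar> \<le> K" if t: "t \<in> {x..y}" for j t
  proof -
    have "energy (Us j) t + (\<epsilon> j)\<^sup>2 \<le> (energy (Us j) s + (\<epsilon> j)\<^sup>2) * exp (growth R * \<bar>t - s\<bar>)"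
    proof (rule energy_growth[where x = x and y = y and M = "Ms j"])
      show "(Us j i has_real_derivative Us j (Suc i) t) (at t within {x..y})" if "i < n" for i t
        using sol_deriv[OF sols that] has_field_derivative_at_within by blast
      show "\<bar>L (Ms j) (Us j) t\<bar> \<le> \<epsilon> j" if "t \<in> {x..y}" for t
        using fs[OF that] by (simp add: sol_L[OF sols])
    qed (use R s t in auto)
    also have "\<dots> \<le> (1 + E\<^sup>2) * exp (growth R * (y - x))"
    proof (intro mult_mono)
      have "(\<epsilon> j)\<^sup>2 \<le> E\<^sup>2" using E[of j] by (meson abs_le_square_iff abs_ge_self order.trans)
      then show "energy (Us j) s + (\<epsilon> j)\<^sup>2 \<le> 1 + E\<^sup>2" by (simp add: e1)
      have "\<bar>t - s\<bar> \<le> y - x" using s t by auto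
      then show "exp (growth R * \<bar>t - s\<bar>) \<le> exp (growth R * (y - x))"
        using gr[OF R0] by (simp add: mult_left_mono)
    qed auto
    finally have "(Us j 0 t)\<^sup>2 \<le> (1 + E\<^sup>2) * exp (growth R * (y - x))"
      using component_le_energy[of 0 "Us j" t] order_pos zero_le_power2[of "\<epsilon> j"] by linarith
    then show ?thesis unfolding K_def by (metis real_sqrt_abs real_sqrt_le_mono)
  qed
  define \<eta> where "\<eta> j = \<epsilon> (r j) + \<bar>M - Ms (r j)\<bar> * K" for j
  have \<eta>: "\<eta> \<longlonglongrightarrow> 0"
  proof -
    have "(\<lambda>j. Ms (r j)) \<longlonglongrightarrow> M" "(\<lambda>j. \<epsilon> (r j)) \<longlonglongrightarrow> 0"
      using LIMSEQ_subseq_LIMSEQ[OF Ms r(1)] LIMSEQ_subseq_LIMSEQ[OF \<epsilon> r(1)] by (auto simp: o_def)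
    then have "\<eta> \<longlonglongrightarrow> 0 + \<bar>M - M\<bar> * K" unfolding \<eta>_def by (intro tendsto_intros)
    then show ?thesis by simp
  qed
  define D where "D j i t = 1 * Us (r j) i t + (-1) * U i t" for j i t
  define f' where "f' j t = fs (r j) t + (M - Ms (r j)) * Us (r j) 0 t" for j t
  have D: "sol M (\<lambda>t. 1 * f' j t + (-1) * 0) (D j)" for j
    unfolding D_def[abs_def] f'_def by (intro sol_add sol_shift sols U)
  define \<rho> where "\<rho> j = sqrt ((energy (D j) s + (\<eta> j)\<^sup>2) * exp (growth \<bar>M\<bar> * (y - x)))" for j
  have D_bound: "\<bar>D j i t\<bar> \<le> \<rho> j" if "i < n" "t \<in> {x..y}" for i j t
  proof -
    have "energy (D j) t + (\<eta> j)\<^sup>2 \<le> (energy (D j) s + (\<eta> j)\<^sup>2) * exp (growth \<bar>M\<bar> * \<bar>t - s\<bar>)"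
    proof (rule energy_growth[where x = x and y = y and M = M])
      show "(D j i has_real_derivative D j (Suc i) t) (at t within {x..y})" if "i < n" for i t
        using sol_deriv[OF D that] has_field_derivative_at_within by blast
      show "\<bar>L M (D j) t\<bar> \<le> \<eta> j" if "t \<in> {x..y}" for t
      proof -
        have "\<bar>f' j t\<bar> \<le> \<bar>fs (r j) t\<bar> + \<bar>M - Ms (r j)\<bar> * \<bar>Us (r j) 0 t\<bar>"
          unfolding f'_def abs_mult[symmetric] by (rule abs_triangle_ineq)
        also have "\<dots> \<le> \<eta> j"
          unfolding \<eta>_def using that by (intro add_mono fs mult_left_mono Us_bound) auto
        finally show ?thesis using sol_L[OF D, of j t] by simp
      qed
    qed (use s that in auto)
    also have "\<dots> \<le> (energy (D j) s + (\<eta> j)\<^sup>2) * exp (growth \<bar>M\<bar> * (y - x))"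
    proof (intro mult_left_mono)
      have "\<bar>t - s\<bar> \<le> y - x" using s that by auto
      then show "exp (growth \<bar>M\<bar> * \<bar>t - s\<bar>) \<le> exp (growth \<bar>M\<bar> * (y - x))"
        using gr[of "\<bar>M\<bar>"] by (simp add: mult_left_mono)
    qed (use energy_nonneg in auto)
    finally have "(D j i t)\<^sup>2 \<le> (energy (D j) s + (\<eta> j)\<^sup>2) * exp (growth \<bar>M\<bar> * (y - x))"
      using component_le_energy[OF that(1), of "D j" t] zero_le_power2[of "\<eta> j"] by linarith
    then show ?thesis unfolding \<rho>_def by (metis real_sqrt_abs real_sqrt_le_mono)
  qed
  have "(\<lambda>j. energy (D j) s) \<longlonglongrightarrow> (\<Sum>i<n. (1 * l i + (-1) * l i)\<^sup>2)"
    unfolding energy_def D_def using r U by (intro tendsto_intros) auto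
  then have "\<rho> \<longlonglongrightarrow> sqrt ((0 + 0\<^sup>2) * exp (growth \<bar>M\<bar> * (y - x)))"
    unfolding \<rho>_def by (intro tendsto_intros \<eta>) simp
  then have \<rho>: "\<rho> \<longlonglongrightarrow> 0" by simp
  have "(\<lambda>j. Us (r j) i (T j)) \<longlonglongrightarrow> U i t"
    if i: "i < n" and T: "\<forall>j. T j \<in> {x..y}" "T \<longlonglongrightarrow> t" for i T t
  proof -
    have "(\<lambda>j. D j i (T j)) \<longlonglongrightarrow> 0"
      by (rule Lim_null_comparison[OF _ \<rho>]) (use D_bound[OF i] T in auto)
    moreover have "(\<lambda>j. U i (T j)) \<longlonglongrightarrow> U i t"
      using sol_isCont[OF U(1), of i t] i T(2) by (auto intro: isCont_tendsto_compose)
    ultimately have "(\<lambda>j. D j i (T j) + U i (T j)) \<longlonglongrightarrow> 0 + U i t" by (rule tendsto_add)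
    then show ?thesis by (simp add: D_def)
  qed
  then show ?thesis using r(1) U(1) eU by blast
qed

lemma has_zeros_three:
  assumes "vanishes U k u" "vanishes U l v" "vanishes U m w"
    and "u \<in> S" "v \<in> S" "w \<in> S" "u \<noteq> v" "u \<noteq> w" "v \<noteq> w"
  shows "\<exists>\<mu>. has_zeros U \<mu> S \<and> zero_count \<mu> = k + l + m \<and> \<mu> u = k \<and> \<mu> v = l"
proof -
  define \<mu> where "\<mu> t = (if t = u then k else if t = v then l else if t = w then m else 0)" for t
  have sub: "{t. \<mu> t > 0} \<subseteq> {u, v, w}" by (auto simp: \<mu>_def split: if_splits)
  then have "zero_count \<mu> = (\<Sum>t\<in>{u, v, w}. \<mu> t)" by (intro zero_count_superset) auto
  also have "\<dots> = k + l + m" using assms by (auto simp: \<mu>_def)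
  finally show ?thesis using sub assms finite_subset[OF sub]
    by (intro exI[of _ \<mu>]) (auto simp: has_zeros_def vanishes_def \<mu>_def split: if_splits)
qed

lemma dis_three_points:
  assumes "dis M x y" "hom M U" "vanishes U k u" "vanishes U l v" "vanishes U m w"
    and "u \<in> {x..y}" "v \<in> {x..y}" "w \<in> {x..y}" "u \<noteq> v" "u \<noteq> w" "v \<noteq> w" "n \<le> k + l + m"
  shows "trivial U"
  using has_zeros_three[OF assms(3-5), of "{x..y}"] assms unfolding dis_def by metis

lemma dis_two_points:
  assumes "dis M x y" "hom M U" "vanishes U k u" "vanishes U l v"
    and "u \<in> {x..y}" "v \<in> {x..y}" "u \<noteq> v" "n \<le> k + l"
  shows "trivial U"
  \<comment> \<open>The midpoint, with order \<open>0\<close>, fills the third slot.\<close>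
  by (rule dis_three_points[where w = "(u + v) / 2" and m = 0, OF assms(1-4)])
    (use assms in \<open>auto simp: vanishes_def\<close>)

lemma dis_nonsingular: "dis M a b \<Longrightarrow> a \<le> x \<Longrightarrow> x < y \<Longrightarrow> y \<le> b \<Longrightarrow> k \<le> n \<Longrightarrow> \<not> singular M k x y"
  unfolding singular_def using dis_two_points[of M a b _ k x "n - k" y] by auto

lemma dis_subinterval: "dis M a b \<Longrightarrow> a \<le> x \<Longrightarrow> y \<le> b \<Longrightarrow> dis M x y"
  unfolding dis_def has_zeros_def by (meson atLeastatMost_subset_iff order.trans)

text \<open>The first \<open>k\<close> functions of the chain span the solutions with a zero of order \<open>n - k\<close> at \<open>s\<close>,
  so that the Wronskians of the chain vanish exactly at the two-point conjugate points of \<open>s\<close>.\<close>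

lemma principal_chain:
  assumes ns: "\<And>k t. 1 \<le> k \<Longrightarrow> k < n \<Longrightarrow> t \<in> {s<..b} \<Longrightarrow> \<not> singular M k s t"
  obtains F where "\<And>q. q < n \<Longrightarrow> hom M (F q)"
    and "\<And>q i. q < n \<Longrightarrow> i < n \<Longrightarrow> F q i s = (if i + q + 1 = n then 1 else 0)"
    and "\<And>k t \<alpha>. 1 \<le> k \<Longrightarrow> k \<le> n \<Longrightarrow> t \<in> {s<..b} \<Longrightarrow>
      (\<And>i. i < k \<Longrightarrow> (\<Sum>q<k. \<alpha> q * F q i t) = 0) \<Longrightarrow> (\<forall>q<k. \<alpha> q = 0)"
proof -
  obtain Y where Y: "\<And>q. q < n \<Longrightarrow> hom M (Y q)"
    "\<And>q i. q < n \<Longrightarrow> i < n \<Longrightarrow> Y q i s = (if i = q then 1 else 0)"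
    using basis_exists[of M s] by blast
  define F where "F q = Y (n - 1 - q)" for q
  have F: "hom M (F q)" if "q < n" for q using Y that by (simp add: F_def)
  have Fs: "F q i s = (if i + q + 1 = n then 1 else 0)" if "q < n" "i < n" for q i
    using Y(2)[of "n - 1 - q" i] that by (auto simp: F_def)
  have "\<forall>q<k. \<alpha> q = 0" if k: "1 \<le> k" "k \<le> n" and t: "t \<in> {s<..b}"
    and z: "\<And>i. i < k \<Longrightarrow> (\<Sum>q<k. \<alpha> q * F q i t) = 0" for k t \<alpha>
  proof -
    define V where "V i t = (\<Sum>q<k. \<alpha> q * F q i t)" for i t
    have V: "hom M V" unfolding V_def[abs_def] by (rule hom_sum) (use F k in auto)
    have Vt: "vanishes V k t" using z by (simp add: vanishes_def V_def)
    have Vs: "vanishes V (n - k) s" unfolding vanishes_def V_def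
      using Fs k by (intro allI impI sum.neutral) auto
    have "trivial V"
    proof (cases "k = n")
      case True
      then show ?thesis using hom_trivial[OF V] Vt by simp
    next
      case False
      then have "1 \<le> n - k" "n - k < n" "n - (n - k) = k" using k by auto
      then show ?thesis using ns[of "n - k" t] t V Vt Vs unfolding singular_def by metis
    qed
    have "\<alpha> q = 0" if "q < k" for q
    proof -
      have "V (n - 1 - q) s = (\<Sum>j<k. if j = q then \<alpha> q else 0)"
        unfolding V_def using Fs k that by (intro sum.cong) auto
      also have "\<dots> = \<alpha> q" using that by (simp add: sum.delta)
      finally show ?thesis using \<open>trivial V\<close> by (simp add: trivial_def)
    qed
    then show ?thesis by blast
  qed
  then show ?thesis using that F Fs by blast
qed

text \<open>The zero at \<open>s\<close> is split off: \<open>U\<close> lies in the span of the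
  first \<open>N = n - \<mu> s\<close> functions of the principal chain, and at least
  \<open>N\<close> zeros remain to the right of \<open>s\<close>. If one of them alone has order
  \<open>N\<close>, nondegeneracy there suffices; otherwise the Chebyshev bound applies.\<close>

lemma nonsingular_imp_dis:
  assumes ns: "\<And>k t. 1 \<le> k \<Longrightarrow> k < n \<Longrightarrow> t \<in> {s<..b} \<Longrightarrow> \<not> singular M k s t" and "s < b"
  shows "dis M s b"
  unfolding dis_def
proof (intro allI impI, elim conjE)
  fix U \<mu> assume U: "hom M U" and z: "has_zeros U \<mu> {s..b}" "n \<le> zero_count \<mu>"
  obtain F where F: "\<And>q. q < n \<Longrightarrow> hom M (F q)"
    "\<And>q i. q < n \<Longrightarrow> i < n \<Longrightarrow> F q i s = (if i + q + 1 = n then 1 else 0)"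
    and nd: "\<And>k t \<alpha>. 1 \<le> k \<Longrightarrow> k \<le> n \<Longrightarrow> t \<in> {s<..b} \<Longrightarrow>
      (\<And>i. i < k \<Longrightarrow> (\<Sum>q<k. \<alpha> q * F q i t) = 0) \<Longrightarrow> (\<forall>q<k. \<alpha> q = 0)"
    using principal_chain[of s b M] ns by blast
  show "trivial U"
  proof (cases "\<mu> s \<ge> n")
    case True
    then show ?thesis using hom_trivial[OF U, of s] z by (auto simp: has_zeros_def vanishes_def)
  next
    case False
    define N where "N = n - \<mu> s"
    have N: "1 \<le> N" "N \<le> n" using False by (auto simp: N_def)
    define \<alpha> where "\<alpha> q = U (n - 1 - q) s" for q
    have rep: "U i t = (\<Sum>q<N. \<alpha> q * F q i t)" if "i \<le> n" for i t
    proof (rule sol_unique[OF U _ _ that])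
      show "hom M (\<lambda>i t. \<Sum>q<N. \<alpha> q * F q i t)" by (rule hom_sum) (use F N in auto)
      fix i assume i: "i < n"
      have "(\<Sum>q<N. \<alpha> q * F q i s) = (\<Sum>q<N. if q = n - 1 - i then U i s else 0)"
        unfolding \<alpha>_def using F(2) i N by (intro sum.cong) auto
      also have "\<dots> = U i s"
        using i z N by (auto simp: sum.delta has_zeros_def N_def)
      finally show "U i s = (\<Sum>q<N. \<alpha> q * F q i s)" by simp
    qed
    \<comment> \<open>\<open>lo\<close> will separate the other zeros from \<open>s\<close>, where
      the Wronskians of the first \<open>k < n\<close> functions vanish. Inserting \<open>b\<close>
      makes \<open>Z\<close> nonempty and puts \<open>lo\<close> below \<open>b\<close>.\<close>
    define Z where "Z = insert b ({t. \<mu> t > 0} - {s})"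
    have Z: "finite Z" "Z \<subseteq> {s<..b}" "b \<in> Z" using z \<open>s < b\<close> by (auto simp: Z_def has_zeros_def)
    define lo where "lo = (s + Min Z) / 2"
    have "Min Z \<in> Z" using Z by (intro Min_in) auto
    then have "s < Min Z" using Z(2) by auto
    then have lo: "s < lo" "\<And>t. t \<in> Z \<Longrightarrow> lo < t"
      using Min_le[OF Z(1)] by (fastforce simp: lo_def)+
    have \<alpha>0: "\<forall>q<N. \<alpha> q = 0"
    proof (cases "\<exists>t\<in>{s<..b}. \<mu> t \<ge> N")
      case True
      then obtain t where t: "t \<in> {s<..b}" "\<mu> t \<ge> N" by blast
      show ?thesis
      proof (rule nd[OF N t(1)])
        fix i assume "i < N"
        then show "(\<Sum>q<N. \<alpha> q * F q i t) = 0"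
          using rep[of i t] z t N by (auto simp: has_zeros_def)
      qed
    next
      case False
      define \<nu> where "\<nu> t = (if t = s then 0 else \<mu> t)" for t
      show ?thesis
      proof (rule chebyshev_zero_bound[where F = F and lo = lo and hi = b and \<mu> = \<nu>])
        show "(F q i has_real_derivative F q (Suc i) t) (at t)" if "q < N" "i < N - 1" for q i t
          by (rule sol_deriv[OF F(1)]) (use that N in auto)
        show "\<forall>q<k. \<beta> q = 0" if "1 \<le> k" "k \<le> N" "t \<in> {lo..b}"
          "\<And>i. i < k \<Longrightarrow> (\<Sum>q<k. \<beta> q * F q i t) = 0" for k t \<beta>
          using nd[of k t \<beta>] that N lo by auto
        have sub: "{t. \<nu> t > 0} \<subseteq> {lo..b}"
        proof
          fix t assume "t \<in> {t. \<nu> t > 0}"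
          then have "t \<in> Z" by (auto simp: \<nu>_def Z_def split: if_splits)
          then show "t \<in> {lo..b}" using lo(2)[of t] Z by auto
        qed
        have "{t. \<nu> t > 0} \<subseteq> Z" by (auto simp: \<nu>_def Z_def split: if_splits)
        then have fin: "finite {t. \<nu> t > 0}" using Z finite_subset by blast
        have lt: "\<nu> t < N" for t
        proof (cases "t \<in> {s<..b}")
          case True
          then show ?thesis using False N by (force simp: \<nu>_def not_le)
        next
          case False
          then have "\<mu> t = 0 \<or> t = s" using z(1) by (force simp: has_zeros_def)
          then show ?thesis using N by (auto simp: \<nu>_def)
        qed
        show "has_zeros (\<lambda>i t. \<Sum>q<N. \<alpha> q * F q i t) \<nu> {lo..b}"
          unfolding has_zeros_def
        proof (intro conjI fin sub allI impI)
          fix t i assume i: "i < \<nu> t"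
          then have "U i t = 0" using z by (auto simp: has_zeros_def \<nu>_def split: if_splits)
          then show "(\<Sum>q<N. \<alpha> q * F q i t) = 0" using rep[of i t] lt[of t] i N by simp
        qed
        show "\<nu> lo < N" "\<nu> b < N" by (rule lt)+
        have "finite (insert s {t. \<mu> t > 0})" using z by (simp add: has_zeros_def)
        moreover from this have "zero_count \<mu> = (\<Sum>t\<in>insert s {t. \<mu> t > 0}. \<mu> t)"
          by (intro zero_count_superset) auto
        moreover from calculation have "zero_count \<nu> = (\<Sum>t\<in>insert s {t. \<mu> t > 0} - {s}. \<nu> t)"
          by (intro zero_count_superset) (auto simp: \<nu>_def split: if_splits)
        moreover have "(\<Sum>t\<in>insert s {t. \<mu> t > 0} - {s}. \<nu> t) = (\<Sum>t\<in>insert s {t. \<mu> t > 0} - {s}. \<mu> t)"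
          by (intro sum.cong) (auto simp: \<nu>_def)
        ultimately have "zero_count \<mu> = \<mu> s + zero_count \<nu>"
          using sum.remove[of "insert s {t. \<mu> t > 0}" s \<mu>] by simp
        then show "N \<le> zero_count \<nu>" using z by (simp add: N_def)
      qed (use N in auto)
    qed
    then show ?thesis unfolding trivial_def using rep by simp
  qed
qed

section \<open>Limits of conjugate points\<close>

text \<open>Normalised solutions converge by \<open>sol_compactness\<close>. The point is that
  \<open>x\<close> and \<open>y\<close> stay apart: if they coincided, every derivative of order
  below \<open>n\<close> would have zeros in the shrinking intervals between \<open>xs\<close> and
  \<open>ys\<close>, and the limit would be trivial.\<close>

lemma singular_limit:
  assumes Ms: "Ms \<longlonglongrightarrow> M" and xs: "xs \<longlonglongrightarrow> x" and ys: "ys \<longlonglongrightarrow> y" "\<And>j. xs j < ys j"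
    and sing: "\<And>j. singular (Ms j) k (xs j) (ys j)" and k: "k \<le> n"
  shows "x < y \<and> singular M k x y"
proof -
  have "\<exists>U. hom (Ms j) U \<and> energy U x = 1 \<and> vanishes U k (xs j) \<and> vanishes U (n - k) (ys j)" for j
  proof -
    obtain U where U: "hom (Ms j) U" "\<not> trivial U" "vanishes U k (xs j)" "vanishes U (n - k) (ys j)"
      using sing[of j] by (auto simp: singular_def)
    show ?thesis
      using sol_divide[OF U(1), of "sqrt (energy U x)"] energy_normalize[OF energy_pos[OF U(1,2)]] U(3,4)
      by (intro exI[of _ "\<lambda>i t. U i t / sqrt (energy U x)"]) (auto simp: vanishes_def)
  qed
  then obtain Us where Us: "\<And>j. hom (Ms j) (Us j)" "\<And>j. energy (Us j) x = 1"
    "\<And>j. vanishes (Us j) k (xs j)" "\<And>j. vanishes (Us j) (n - k) (ys j)" by metis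
  obtain X where X: "\<And>j. \<bar>xs j\<bar> \<le> X"
    using convergent_imp_bounded[OF xs] by (auto simp: bounded_iff)
  obtain Y where Y: "\<And>j. \<bar>ys j\<bar> \<le> Y"
    using convergent_imp_bounded[OF ys(1)] by (auto simp: bounded_iff)
  define lo hi where "lo = - X - Y - \<bar>x\<bar>" and "hi = X + Y + \<bar>x\<bar>"
  have XY: "X \<ge> 0" "Y \<ge> 0" using X[of 0] Y[of 0] by linarith+
  have mem: "xs j \<in> {lo..hi}" "ys j \<in> {lo..hi}" "x \<in> {lo..hi}" for j
    using X[of j] Y[of j] XY by (auto simp: lo_def hi_def)
  have "\<exists>r U. strict_mono r \<and> hom M U \<and> energy U x = 1 \<and>
    (\<forall>i T t. i < n \<longrightarrow> (\<forall>j. T j \<in> {lo..hi}) \<longrightarrow> T \<longlonglongrightarrow> t \<longrightarrow> (\<lambda>j. Us (r j) i (T j)) \<longlonglongrightarrow> U i t)"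
    by (rule sol_compactness[where \<epsilon> = "\<lambda>_. 0", OF Ms Us(1)]) (use mem Us(2) in auto)
  then obtain r U where r: "strict_mono r" and U: "hom M U" "energy U x = 1"
    and lim: "\<And>i T t. i < n \<Longrightarrow> (\<And>j. T j \<in> {lo..hi}) \<Longrightarrow> T \<longlonglongrightarrow> t \<Longrightarrow> (\<lambda>j. Us (r j) i (T j)) \<longlonglongrightarrow> U i t"
    by blast
  have xr: "(\<lambda>j. xs (r j)) \<longlonglongrightarrow> x" and yr: "(\<lambda>j. ys (r j)) \<longlonglongrightarrow> y"
    using LIMSEQ_subseq_LIMSEQ[OF xs r] LIMSEQ_subseq_LIMSEQ[OF ys(1) r] by (auto simp: o_def)
  have "energy U x = 0" if "trivial U" using that by (simp add: trivial_def energy_def)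
  then have nontriv: "\<not> trivial U" using U(2) by auto
  have limit0: "U i t = 0" if "i < n" "\<And>j. T j \<in> {lo..hi}" "T \<longlonglongrightarrow> t" "\<And>j. Us (r j) i (T j) = 0" for i T t
    using lim[OF that(1-3)] that(4) by (simp add: LIMSEQ_const_iff)
  have vx: "vanishes U k x" unfolding vanishes_def
  proof (intro allI impI)
    fix i assume "i < k"
    then show "U i x = 0"
      using limit0[of i "\<lambda>j. xs (r j)" x] mem xr Us(3) k by (auto simp: vanishes_def)
  qed
  have vy: "vanishes U (n - k) y" unfolding vanishes_def
  proof (intro allI impI)
    fix i assume "i < n - k"
    then show "U i y = 0"
      using limit0[of i "\<lambda>j. ys (r j)" y] mem yr Us(4) k by (auto simp: vanishes_def)
  qed
  have "x \<noteq> y"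
  proof
    assume "x = y"
    have "U i x = 0" if i: "i < n" for i
    proof -
      have "\<exists>t\<in>{xs (r j)..ys (r j)}. Us (r j) i t = 0" for j
      proof -
        define w where "w = (xs (r j) + ys (r j)) / 2"
        have w: "xs (r j) < w" "w < ys (r j)" using ys(2)[of "r j"] by (auto simp: w_def)
        have "\<exists>\<mu>. has_zeros (Us (r j)) \<mu> {xs (r j)..ys (r j)} \<and> zero_count \<mu> = k + (n - k) + 0 \<and>
            \<mu> (xs (r j)) = k \<and> \<mu> (ys (r j)) = n - k"
          by (rule has_zeros_three[where w = w, OF Us(3,4)]) (use w in \<open>auto simp: vanishes_def\<close>)
        then obtain \<mu> where \<mu>: "has_zeros (Us (r j)) \<mu> {xs (r j)..ys (r j)}" "zero_count \<mu> = n"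
          using k by auto
        show ?thesis
        proof (rule zeros_of_iterated_derivative[OF _ \<mu>(1)])
          show "(Us (r j) l has_real_derivative Us (r j) (Suc l) t) (at t)" if "l < i" for l t
            using sol_deriv[OF Us(1), of l "r j" t] that i by simp
        qed (use \<mu>(2) i in simp)
      qed
      then obtain T where T: "\<And>j. T j \<in> {xs (r j)..ys (r j)}" "\<And>j. Us (r j) i (T j) = 0" by metis
      have "T \<longlonglongrightarrow> x"
        by (rule tendsto_sandwich[OF _ _ xr yr[folded \<open>x = y\<close>]]) (use T in auto)
      moreover have "T j \<in> {lo..hi}" for j using T(1)[of j] mem(1,2)[of "r j"] by auto
      ultimately show ?thesis using limit0[of i T x] i T(2) by blast
    qed
    then show False using hom_trivial[OF U(1), of x] nontriv by (auto simp: vanishes_def)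
  qed
  moreover have "x \<le> y" using LIMSEQ_le[OF xs ys(1)] ys(2) by (meson less_imp_le)
  ultimately have "x < y" by simp
  moreover have "singular M k x y" unfolding singular_def using U(1) nontriv vx vy by blast
  ultimately show ?thesis by blast
qed

lemma singular_limit_in_interval:
  assumes Ms: "Ms \<longlonglongrightarrow> M" and xs: "xs \<longlonglongrightarrow> x"
    and sing: "\<And>j. \<exists>k y. 1 \<le> k \<and> k < n \<and> y \<in> {xs j<..b} \<and> singular (Ms j) k (xs j) y"
  shows "\<exists>k y. 1 \<le> k \<and> k < n \<and> y \<in> {x<..b} \<and> singular M k x y"
proof -
  obtain ks ys where ky: "\<And>j. 1 \<le> ks j \<and> ks j < n \<and> ys j \<in> {xs j<..b} \<and> singular (Ms j) (ks j) (xs j) (ys j)"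
  proof -
    have "\<exists>ks. \<forall>j. \<exists>y. 1 \<le> ks j \<and> ks j < n \<and> y \<in> {xs j<..b} \<and> singular (Ms j) (ks j) (xs j) y"
      by (rule choice) (use sing in blast)
    then obtain ks where "\<forall>j. \<exists>y. 1 \<le> ks j \<and> ks j < n \<and> y \<in> {xs j<..b} \<and> singular (Ms j) (ks j) (xs j) y" ..
    from choice[OF this] show ?thesis using that by blast
  qed
  obtain X where X: "\<And>j. \<bar>xs j\<bar> \<le> X"
    using convergent_imp_bounded[OF xs] by (auto simp: bounded_iff)
  \<comment> \<open>Points and orders are packed into one family, so that one subsequence serves
    both. A convergent sequence of integers is eventually constant, hence the shift by
    \<open>J\<close> below.\<close>
  have "\<bar>if i = 0 then ys j else real (ks j)\<bar> \<le> X + \<bar>b\<bar> + n" for i j :: nat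
    using X[of j] ky[of j] by auto
  then obtain r l where r: "strict_mono r"
    and l: "\<And>i::nat. i < 2 \<Longrightarrow> (\<lambda>j. if i = 0 then ys (r j) else real (ks (r j))) \<longlonglongrightarrow> l i"
    using bounded_sequences_convergent_subsequence[of 2 "\<lambda>j i. if i = 0 then ys j else real (ks j)"] by blast
  have ly: "(\<lambda>j. ys (r j)) \<longlonglongrightarrow> l 0" using l[of 0] by simp
  have lk: "(\<lambda>j. real (ks (r j))) \<longlonglongrightarrow> l 1" using l[of 1] by simp
  then have "Cauchy (\<lambda>j. real (ks (r j)))" by (rule LIMSEQ_imp_Cauchy)
  then obtain J where J: "\<And>i j. i \<ge> J \<Longrightarrow> j \<ge> J \<Longrightarrow> \<bar>real (ks (r i)) - real (ks (r j))\<bar> < 1"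
    unfolding Cauchy_def dist_real_def by (metis zero_less_one)
  define k where "k = ks (r J)"
  have k: "ks (r (J + j)) = k" for j using J[of "J + j" J] by (simp add: k_def)
  have rJ: "strict_mono (\<lambda>j. r (J + j))" using r by (simp add: strict_mono_def)
  have "x < l 0 \<and> singular M k x (l 0)"
  proof (rule singular_limit)
    show "(\<lambda>j. Ms (r (J + j))) \<longlonglongrightarrow> M" using LIMSEQ_subseq_LIMSEQ[OF Ms rJ] by (simp add: o_def)
    show "(\<lambda>j. xs (r (J + j))) \<longlonglongrightarrow> x" using LIMSEQ_subseq_LIMSEQ[OF xs rJ] by (simp add: o_def)
    show "(\<lambda>j. ys (r (J + j))) \<longlonglongrightarrow> l 0" using LIMSEQ_ignore_initial_segment[OF ly, of J] by (simp add: add.commute)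
    show "xs (r (J + j)) < ys (r (J + j))" for j using ky[of "r (J + j)"] by auto
    show "singular (Ms (r (J + j))) k (xs (r (J + j))) (ys (r (J + j)))" for j
      using ky[of "r (J + j)"] k by simp
    show "k \<le> n" using ky[of "r J"] by (simp add: k_def)
  qed
  moreover have "l 0 \<le> b" using LIMSEQ_le_const2[OF ly] ky by fastforce
  ultimately show ?thesis using ky[of "r J"] by (auto simp: k_def)
qed

text \<open>Makes the infimum of the failing parameters itself a failing one: each failure has a
  two-point witness with left zero at \<open>a\<close>, and such witnesses pass to the
  limit.\<close>

lemma not_dis_limit:
  assumes "Ms \<longlonglongrightarrow> M" "\<And>j. \<not> dis (Ms j) a b" "a < b"
  shows "\<not> dis M a b"
proof
  assume d: "dis M a b"
  have "\<exists>k y. 1 \<le> k \<and> k < n \<and> y \<in> {a<..b} \<and> singular (Ms j) k a y" for j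
    using nonsingular_imp_dis[of a b "Ms j"] assms(2)[of j] \<open>a < b\<close> by blast
  then obtain k y where "k < n" "y \<in> {a<..b}" "singular M k a y"
    using singular_limit_in_interval[OF assms(1) tendsto_const[of a]] by blast
  then show False using dis_nonsingular[OF d, of a y k] by auto
qed

text \<open>A principal chain started at \<open>a\<close> degenerates at \<open>a\<close> itself;
  started slightly to the left, it is nondegenerate on all of \<open>[a, b]\<close>. Conjugate
  points present for every \<open>s < a\<close> would persist in the limit at
  \<open>a\<close>.\<close>

lemma dis_left_extension:
  assumes "dis M a b" "a < b"
  obtains s where "s < a" "\<And>k t. 1 \<le> k \<Longrightarrow> k < n \<Longrightarrow> t \<in> {s<..b} \<Longrightarrow> \<not> singular M k s t"
proof (rule ccontr)
  note extension = that
  assume "\<not> thesis"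
  then have H: "\<exists>k y. 1 \<le> k \<and> k < n \<and> y \<in> {s<..b} \<and> singular M k s y" if "s < a" for s
    using extension[OF that] by blast
  have lim: "(\<lambda>j. a - 1 / real (Suc j)) \<longlonglongrightarrow> a - 0"
    by (intro tendsto_diff tendsto_const LIMSEQ_Suc[OF lim_1_over_n])
  have "\<exists>k y. 1 \<le> k \<and> k < n \<and> y \<in> {a<..b} \<and> singular M k a y"
    by (rule singular_limit_in_interval[OF tendsto_const[of M] lim[unfolded diff_zero]], rule H) simp
  then show False using dis_nonsingular[OF assms(1)] by force
qed

text \<open>\<open>u\<close> is appended to a nondegenerate chain of \<open>n\<close> homogeneous
  solutions. The Wronskian of all \<open>n + 1\<close> functions is that of the first
  \<open>n\<close> times \<open>f\<close>, so it does not vanish in the interior, and the Chebyshev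
  bound for \<open>n + 1\<close> functions applies.\<close>

lemma inhomogeneous_zero_bound:
  assumes d: "dis M a b" "a < b" and u: "sol M f u" and f: "\<And>t. t \<in> {a<..<b} \<Longrightarrow> f t \<noteq> 0"
    and z: "has_zeros u \<mu> {a..b}" "\<mu> a \<le> n" "\<mu> b \<le> n"
  shows "zero_count \<mu> \<le> n"
proof (rule ccontr)
  assume "\<not> zero_count \<mu> \<le> n"
  obtain s where s: "s < a" "\<And>k t. 1 \<le> k \<Longrightarrow> k < n \<Longrightarrow> t \<in> {s<..b} \<Longrightarrow> \<not> singular M k s t"
    using dis_left_extension[OF d] by blast
  obtain F where F: "\<And>q. q < n \<Longrightarrow> hom M (F q)"
    and "\<And>q i. q < n \<Longrightarrow> i < n \<Longrightarrow> F q i s = (if i + q + 1 = n then 1 else 0)"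
    and nd: "\<And>k t \<alpha>. 1 \<le> k \<Longrightarrow> k \<le> n \<Longrightarrow> t \<in> {s<..b} \<Longrightarrow>
      (\<And>i. i < k \<Longrightarrow> (\<Sum>q<k. \<alpha> q * F q i t) = 0) \<Longrightarrow> (\<forall>q<k. \<alpha> q = 0)"
    using principal_chain[of s b M] s(2) by blast
  define G where "G q = (if q < n then F q else u)" for q
  \<comment> \<open>These are the coefficients of \<open>u\<close> itself; their vanishing is the
    contradiction \<open>1 = 0\<close>.\<close>
  have "\<forall>q<Suc n. (if q = n then 1 else 0) = (0::real)"
  proof (rule chebyshev_zero_bound[where F = G and lo = a and hi = b and \<mu> = \<mu>])
    show "(G q i has_real_derivative G q (Suc i) t) (at t)" if "q < Suc n" "i < Suc n - 1" for q i t
      using that sol_deriv[OF F] sol_deriv[OF u] by (auto simp: G_def)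
    have "(\<Sum>q<Suc n. (if q = n then 1 else 0) * G q i t) = u i t" for i t
      by (simp add: G_def)
    then show "has_zeros (\<lambda>i t. \<Sum>q<Suc n. (if q = n then 1 else 0) * G q i t) \<mu> {a..b}"
      using z(1) by presburger
    fix k t \<alpha> assume k: "1 \<le> k" "k \<le> Suc n" and t: "t \<in> {a..b}" "k = Suc n \<Longrightarrow> t \<in> {a<..<b}"
      and zt: "\<And>i. i < k \<Longrightarrow> (\<Sum>q<k. \<alpha> q * G q i t) = 0"
    have ts: "t \<in> {s<..b}" using t s by auto
    show "\<forall>q<k. \<alpha> q = 0"
    proof (cases "k = Suc n")
      case True
      define V where "V i t = 1 * (\<Sum>q<n. \<alpha> q * F q i t) + \<alpha> n * u i t" for i t
      have V: "sol M (\<lambda>t. 1 * 0 + \<alpha> n * f t) V"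
        unfolding V_def[abs_def] by (intro sol_add hom_sum F u)
      have V0: "V i t = 0" if "i \<le> n" for i
        using zt[of i] that True by (simp add: V_def G_def)
      then have "\<alpha> n * f t = 0" using sol_L[OF V, of t] by (simp add: L_def)
      then have an: "\<alpha> n = 0" using f t True by auto
      have "\<forall>q<n. \<alpha> q = 0"
      proof (rule nd[OF _ _ ts])
        show "(\<Sum>q<n. \<alpha> q * F q i t) = 0" if "i < n" for i
          using V0[of i] that an by (simp add: V_def)
      qed (use order_pos in auto)
      then show ?thesis using an True by (auto simp: less_Suc_eq)
    next
      case False
      then show ?thesis using nd[OF k(1) _ ts, of \<alpha>] k zt by (simp add: G_def)
    qed
  qed (use z \<open>\<not> zero_count \<mu> \<le> n\<close> in auto)
  then show False by (auto dest: spec[of _ n])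
qed

end

section \<open>Signs of solutions of two-point problems\<close>

lemma sgn_constant_between_zeros:
  fixes f :: "real \<Rightarrow> real"
  assumes c: "\<And>t. isCont f t" and nz: "\<And>t. t \<in> {a<..<b} \<Longrightarrow> f t \<noteq> 0"
    and s: "s \<in> {a<..<b}" and t: "t \<in> {a<..<b}"
  shows "sgn (f s) = sgn (f t)"
proof -
  have *: "sgn (f u) = sgn (f v)" if uv: "u \<in> {a<..<b}" "v \<in> {a<..<b}" "u \<le> v" for u v
  proof (rule ccontr)
    assume "sgn (f u) \<noteq> sgn (f v)"
    then have "f u < 0 \<and> 0 < f v \<or> 0 < f u \<and> f v < 0"
      using nz[of u] nz[of v] uv by (auto simp: sgn_if split: if_splits)
    then have "\<exists>x. u \<le> x \<and> x \<le> v \<and> f x = 0"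
      using IVT[of f u 0 v] IVT2[of f v 0 u] uv c by (auto simp: less_imp_le)
    then show False using nz uv by force
  qed
  then show ?thesis using s t by (metis linear)
qed

context linear_ode
begin

lemma sgn_right_of_zero:
  assumes U: "sol M f U" "k \<le> n" "vanishes U k x" "U k x \<noteq> 0"
  shows "\<exists>e>0. \<forall>t\<in>{x<..<x+e}. sgn (U 0 t) = sgn (U k x)"
proof -
  define c where "c = sgn (U k x)"
  have "\<exists>e>0. \<forall>t\<in>{x<..<x+e}. c * U 0 t > 0"
  proof (rule sign_right_of_zero[where U = "\<lambda>i t. c * U i t" and k = k])
    show "((\<lambda>t. c * U i t) has_real_derivative c * U (Suc i) t) (at t)" if "i < k" for i t
      using that U(2) by (intro DERIV_cmult sol_deriv[OF U(1)]) simp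
    show "isCont (\<lambda>t. c * U k t) x" by (intro continuous_intros sol_isCont[OF U(1,2)])
  qed (use U in \<open>auto simp: vanishes_def c_def sgn_if\<close>)
  moreover have "sgn x = c" if "c * x > 0" for x
    using that U(4) by (auto simp: c_def sgn_if zero_less_mult_iff split: if_splits)
  ultimately show ?thesis unfolding c_def by blast
qed

lemma sgn_left_of_zero:
  assumes U: "sol M f U" "k \<le> n" "vanishes U k x" "U k x \<noteq> 0"
  shows "\<exists>e>0. \<forall>t\<in>{x-e<..<x}. sgn (U 0 t) = (-1) ^ k * sgn (U k x)"
proof -
  define c where "c = (-1) ^ k * sgn (U k x)"
  have c: "c = 1 \<or> c = -1" using U(4) by (cases "even k") (auto simp: c_def sgn_if)
  have "\<exists>e>0. \<forall>t\<in>{x-e<..<x}. c * U 0 t > 0"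
  proof (rule sign_left_of_zero[where U = "\<lambda>i t. c * U i t" and k = k])
    show "((\<lambda>t. c * U i t) has_real_derivative c * U (Suc i) t) (at t)" if "i < k" for i t
      using that U(2) by (intro DERIV_cmult sol_deriv[OF U(1)]) simp
    show "isCont (\<lambda>t. c * U k t) x" by (intro continuous_intros sol_isCont[OF U(1,2)])
    show "0 < (- 1) ^ k * (c * U k x)" using U(4) by (cases "even k") (auto simp: c_def sgn_if)
  qed (use U in \<open>auto simp: vanishes_def\<close>)
  moreover have "sgn x = c" if "c * x > 0" for x using that c by (auto simp: sgn_if)
  ultimately show ?thesis unfolding c_def by blast
qed

lemma sgn_from_left_end:
  assumes U: "sol M f U" "k \<le> n" "vanishes U k a" "U k a \<noteq> 0"
    and nz: "\<And>t. t \<in> {a<..<b} \<Longrightarrow> U 0 t \<noteq> 0" and t: "t \<in> {a<..<b}"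
  shows "sgn (U 0 t) = sgn (U k a)"
proof -
  obtain e where e: "e > 0" "\<And>t. t \<in> {a<..<a+e} \<Longrightarrow> sgn (U 0 t) = sgn (U k a)"
    using sgn_right_of_zero[OF U] by blast
  define m where "m = min e (b - a)"
  define s where "s = a + m / 2"
  have "0 < m" "m \<le> e" "m \<le> b - a" using e t by (auto simp: m_def)
  then have "s \<in> {a<..<a+e}" "s \<in> {a<..<b}" by (auto simp: s_def)
  then show ?thesis
    using e(2)[of s] sgn_constant_between_zeros[of "U 0" a b s t] nz t sol_isCont[OF U(1)] by auto
qed

lemma sgn_from_right_end:
  assumes U: "sol M f U" "k \<le> n" "vanishes U k b" "U k b \<noteq> 0"
    and nz: "\<And>t. t \<in> {a<..<b} \<Longrightarrow> U 0 t \<noteq> 0" and t: "t \<in> {a<..<b}"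
  shows "sgn (U 0 t) = (-1) ^ k * sgn (U k b)"
proof -
  obtain e where e: "e > 0" "\<And>t. t \<in> {b-e<..<b} \<Longrightarrow> sgn (U 0 t) = (-1) ^ k * sgn (U k b)"
    using sgn_left_of_zero[OF U] by blast
  define m where "m = min e (b - a)"
  define s where "s = b - m / 2"
  have "0 < m" "m \<le> e" "m \<le> b - a" using e t by (auto simp: m_def)
  then have "s \<in> {b-e<..<b}" "s \<in> {a<..<b}" by (auto simp: s_def)
  then show ?thesis
    using e(2)[of s] sgn_constant_between_zeros[of "U 0" a b s t] nz t sol_isCont[OF U(1)] by auto
qed

section \<open>The sign of the inverse in a two-point problem\<close>

lemma inhomogeneous_three_points:
  assumes d: "dis M a b" and u: "sol M f u" and f: "\<And>t. t \<in> {a<..<b} \<Longrightarrow> f t \<noteq> 0"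
    and z: "vanishes u k a" "vanishes u l b" "vanishes u m w" "k \<le> n" "l \<le> n" and w: "w \<in> {a<..<b}"
  shows "k + l + m \<le> n"
proof -
  have "\<exists>\<mu>. has_zeros u \<mu> {a..b} \<and> zero_count \<mu> = k + l + m \<and> \<mu> a = k \<and> \<mu> b = l"
    by (rule has_zeros_three[OF z(1-3)]) (use w in auto)
  then obtain \<mu> where "has_zeros u \<mu> {a..b}" "zero_count \<mu> = k + l + m" "\<mu> a = k" "\<mu> b = l" by blast
  then show ?thesis using inhomogeneous_zero_bound[OF d _ u f, of \<mu>] w z by auto
qed

text \<open>Comparing the solutions \<open>w\<close> and \<open>u\<close> for the boundary conditions with \<open>n - m\<close>, \<open>m\<close> and with
  \<open>n - m - 1\<close>, \<open>m + 1\<close> zeros: their difference solves the homogeneous equation and has no zero in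
  the interior; near \<open>a\<close> it has the sign of \<open>- u\<close> and near \<open>b\<close> that of \<open>w\<close>.\<close>

lemma bvp_strict_sign:
  assumes d: "dis M a b" and f: "continuous_on UNIV f" "\<And>t. \<bar>f t\<bar> \<le> C"
    and pos: "\<And>t. t \<in> {a..b} \<Longrightarrow> f t > 0"
    and "m \<le> n" "sol M f u" "vanishes u (n - m) a" "vanishes u m b" and t: "t \<in> {a<..<b}"
  shows "sgn (u 0 t) = (-1) ^ m"
  using assms(5-8)
proof (induction m arbitrary: u)
  have ab: "a < b" using t by auto
  have fnz: "f t \<noteq> 0" if "t \<in> {a<..<b}" for t using pos[of t] that by auto
  have three: "k + l + i \<le> n" if "sol M f u" "vanishes u k a" "vanishes u l b" "vanishes u i w"
    "k \<le> n" "l \<le> n" "w \<in> {a<..<b}" for u k l i w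
    by (rule inhomogeneous_three_points[OF d that(1) fnz that(2-7)])
  {
    case 0
    have nz: "u 0 s \<noteq> 0" if "s \<in> {a<..<b}" for s
      using three[OF 0(2), of n 0 1 s] 0 that by (auto simp: vanishes_def)
    \<comment> \<open>With all \<open>n\<close> zeros at \<open>a\<close>, the equation gives
      \<open>u n a = f a\<close>, which fixes the sign.\<close>
    have "u i a = 0" if "i < n" for i using 0 that by (simp add: vanishes_def)
    then have "u n a = f a" using sol_top[OF 0(2), of a] order_pos by simp
    then have un: "u n a > 0" using pos[of a] ab by simp
    have "sgn (u 0 t) = sgn (u n a)"
      by (rule sgn_from_left_end[OF 0(2) order.refl _ _ nz t]) (use 0 un in auto)
    then show ?case using un by simp
  next
    case (Suc m)
    have u: "sol M f u" "vanishes u (n - Suc m) a" "vanishes u (Suc m) b" "m < n" using Suc.prems by auto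
    have "\<exists>w. sol M f w \<and> vanishes w (n - m) a \<and> vanishes w (n - (n - m)) b"
      by (rule bvp_exists[OF _ _ f]) (use dis_nonsingular[OF d, of a b "n - m"] ab in auto)
    then obtain w where w: "sol M f w" "vanishes w (n - m) a" "vanishes w m b" using u(4) by auto
    define d where "d i t = 1 * w i t + (-1) * u i t" for i t
    have Sm: "n - m = Suc (n - Suc m)" using u(4) by simp
    have "sol M (\<lambda>t. 1 * f t + (-1) * f t) d" unfolding d_def[abs_def] by (rule sol_add[OF w(1) u(1)])
    then have dh: "hom M d" by simp
    have da: "vanishes d (n - Suc m) a" unfolding d_def[abs_def]
      by (rule vanishes_combination) (use w u vanishes_mono[OF w(2)] Sm in auto)
    have db: "vanishes d m b" unfolding d_def[abs_def]
      by (rule vanishes_combination) (use w u vanishes_mono[OF u(3)] in auto)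
    have nontriv: "\<not> trivial d"
    proof
      assume "trivial d"
      then have "u i s = w i s" if "i \<le> n" for i s using that by (simp add: trivial_def d_def)
      then have "vanishes u (n - m) a" using w(2) by (simp add: vanishes_def)
      then show False using three[OF u(1) _ u(3), of "n - m" 0 t] t u(4) by (auto simp: vanishes_def)
    qed
    have two: "vanishes d k a \<Longrightarrow> vanishes d l b \<Longrightarrow> k + l < n" for k l
      using dis_two_points[OF assms(1) dh, of k a l b] nontriv ab by force
    have dnz: "d 0 s \<noteq> 0" if "s \<in> {a<..<b}" for s
    proof
      assume "d 0 s = 0"
      then have "vanishes d 1 s" by (simp add: vanishes_def)
      then show False
        using dis_three_points[OF assms(1) dh da db, of 1 s] that nontriv u(4) by auto
    qed
    have "d (n - Suc m) a \<noteq> 0" using two[OF _ db, of "n - m"] da u(4) unfolding Sm vanishes_Suc by force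
    moreover have "d m b \<noteq> 0" using two[OF da, of "Suc m"] db u(4) unfolding vanishes_Suc by force
    ultimately have s1: "sgn (d 0 t) = sgn (d (n - Suc m) a)" "sgn (d 0 t) = (-1) ^ m * sgn (d m b)"
      using sgn_from_left_end[OF dh _ da _ dnz t] sgn_from_right_end[OF dh _ db _ dnz t] u(4) by auto
    have da': "d (n - Suc m) a = - u (n - Suc m) a" using w(2) u(4) by (simp add: d_def vanishes_def)
    have db': "d m b = w m b" using u(3) by (simp add: d_def vanishes_def)
    have unz: "u 0 s \<noteq> 0" if "s \<in> {a<..<b}" for s
      using three[OF u(1-3), of 1 s] that u(4) by (auto simp: vanishes_def)
    have wnz: "w 0 s \<noteq> 0" if "s \<in> {a<..<b}" for s
      using three[OF w, of 1 s] that u(4) by (auto simp: vanishes_def)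
    have "sgn (u 0 t) = sgn (u (n - Suc m) a)"
      by (rule sgn_from_left_end[OF u(1) _ u(2) _ unz t])
        (use da' \<open>d (n - Suc m) a \<noteq> 0\<close> in auto)
    moreover have "sgn (w 0 t) = (-1) ^ m * sgn (w m b)"
      by (rule sgn_from_right_end[OF w(1) _ w(3) _ wnz t]) (use db' \<open>d m b \<noteq> 0\<close> u(4) in auto)
    moreover have "sgn (w 0 t) = (-1) ^ m" by (rule Suc.IH) (use w u in auto)
    ultimately show ?case using s1 by (simp add: da' db' sgn_minus)
  }
qed

text \<open>\<open>bvp_strict_sign\<close> wants a source that is bounded on the line and strictly
  positive on \<open>[a, b]\<close>. So the source is frozen outside \<open>[a, b]\<close>, which
  does not affect the solution inside, and \<open>\<epsilon>\<close> times the solution for the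
  source \<open>1\<close> is added before \<open>\<epsilon>\<close> tends to \<open>0\<close>. The
  scalar \<open>c\<close> serves both signs of the source.\<close>

lemma bvp_weak_sign:
  assumes d: "dis M a b" and ab: "a < b" and k: "1 \<le> k" "k < n"
    and u: "sol M f u" "vanishes u k a" "vanishes u (n - k) b"
    and f: "\<And>t. t \<in> {a..b} \<Longrightarrow> c * f t \<ge> 0" and t: "t \<in> {a..b}"
  shows "(-1) ^ (n - k) * (c * u 0 t) \<ge> 0"
proof (cases "t = a \<or> t = b")
  case True
  then show ?thesis using u k by (auto simp: vanishes_def)
next
  case False
  then have t': "t \<in> {a<..<b}" using t by auto
  define g where "g t = c * f (max a (min t b))" for t
  have clamp: "max a (min t b) \<in> {a..b}" for t using ab by auto
  have fc: "continuous_on UNIV f" using u(1) by (simp add: sol_def)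
  have gc: "continuous_on UNIV g" unfolding g_def[abs_def]
    by (intro continuous_on_mult_left continuous_on_compose2[OF fc] continuous_intros) auto
  have "compact ((\<lambda>t. c * f t) ` {a..b})"
    by (intro compact_continuous_image continuous_intros continuous_on_subset[OF fc]) auto
  then obtain C where "\<forall>t\<in>{a..b}. \<bar>c * f t\<bar> \<le> C"
    by (auto dest!: compact_imp_bounded simp: bounded_iff)
  then have C: "\<bar>c * f t\<bar> \<le> C" if "t \<in> {a..b}" for t using that by blast
  have gC: "\<bar>g t\<bar> \<le> C" for t using C[OF clamp] by (simp add: g_def)
  obtain v where v: "sol M g v" "\<And>i. i < n \<Longrightarrow> v i a = c * u i a"
    using sol_exists[OF gc gC, of M a "\<lambda>i. c * u i a"] by auto
  have cu: "sol M (\<lambda>t. c * f t + 0 * f t) (\<lambda>i t. c * u i t + 0 * u i t)" by (rule sol_add[OF u(1) u(1)])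
  have vu: "v i s = c * u i s" if "s \<in> {a..b}" "i \<le> n" for i s
    using sol_unique_on[OF v(1) cu, of a b a s i] that ab v(2) by (auto simp: g_def)
  have "\<exists>w. sol M (\<lambda>_. 1) w \<and> vanishes w k a \<and> vanishes w (n - k) b"
    by (rule bvp_exists[where C = 1]) (use dis_nonsingular[OF d, of a b k] ab k in auto)
  then obtain w where w: "sol M (\<lambda>_. 1) w" "vanishes w k a" "vanishes w (n - k) b" by blast
  define \<sigma> where "\<sigma> = (-1::real) ^ (n - k)"
  have \<sigma>: "\<sigma> * \<sigma> = 1" by (cases "even (n - k)") (auto simp: \<sigma>_def)
  have pos: "\<sigma> * v 0 t + \<epsilon> * (\<sigma> * w 0 t) > 0" if \<epsilon>: "\<epsilon> > 0" for \<epsilon>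
  proof -
    have "sgn (1 * v 0 t + \<epsilon> * w 0 t) = (-1) ^ (n - k)"
    proof (rule bvp_strict_sign[OF d, where u = "\<lambda>i t. 1 * v i t + \<epsilon> * w i t"
          and f = "\<lambda>t. 1 * g t + \<epsilon> * 1" and C = "C + \<epsilon>"])
      show "sol M (\<lambda>t. 1 * g t + \<epsilon> * 1) (\<lambda>i t. 1 * v i t + \<epsilon> * w i t)" by (rule sol_add[OF v(1) w(1)])
      show "continuous_on UNIV (\<lambda>t. 1 * g t + \<epsilon> * 1)" by (intro continuous_intros gc)
      show "\<bar>1 * g t + \<epsilon> * 1\<bar> \<le> C + \<epsilon>" for t using gC[of t] \<epsilon> by (simp add: abs_le_iff)
      show "0 < 1 * g t + \<epsilon> * 1" if "t \<in> {a..b}" for t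
        using f[OF clamp, of t] \<epsilon> by (simp add: g_def add_nonneg_pos)
      show "vanishes (\<lambda>i t. 1 * v i t + \<epsilon> * w i t) (n - (n - k)) a"
        using vu u(2) w(2) k ab by (auto simp: vanishes_def)
      show "vanishes (\<lambda>i t. 1 * v i t + \<epsilon> * w i t) (n - k) b"
        using vu u(3) w(3) k ab by (auto simp: vanishes_def)
    qed (use t' in auto)
    then have "sgn (1 * v 0 t + \<epsilon> * w 0 t) = \<sigma>" by (simp add: \<sigma>_def)
    then have "\<sigma> * (v 0 t + \<epsilon> * w 0 t) > 0"
      using \<sigma> by (metis mult.left_neutral mult_sgn_abs sgn_mult sgn_greater zero_less_one sgn_sgn)
    then show ?thesis by (simp add: algebra_simps)
  qed
  have "\<sigma> * v 0 t \<ge> 0"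
  proof (rule field_le_epsilon)
    fix e :: real assume e: "e > 0"
    define \<epsilon> where "\<epsilon> = e / (\<bar>\<sigma> * w 0 t\<bar> + 1)"
    have \<epsilon>: "\<epsilon> > 0" using e by (simp add: \<epsilon>_def)
    have "\<epsilon> * (\<sigma> * w 0 t) \<le> \<epsilon> * (\<bar>\<sigma> * w 0 t\<bar> + 1)" using \<epsilon> by (intro mult_left_mono) auto
    also have "\<dots> = e" by (simp add: \<epsilon>_def)
    finally show "0 \<le> \<sigma> * v 0 t + e" using pos[OF \<epsilon>] by linarith
  qed
  then show ?thesis using vu[OF t, of 0] by (simp add: \<sigma>_def)
qed

lemma hom_zero_on_interval:
  assumes "hom M U" "a < b" "\<And>t. t \<in> {a<..<b} \<Longrightarrow> U 0 t = 0"
  shows "trivial U"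
proof -
  have z: "U i t = 0" if "i \<le> n" "t \<in> {a<..<b}" for i t
    using that
  proof (induction i arbitrary: t)
    case 0
    then show ?case using assms(3) by simp
  next
    case (Suc i)
    have "(U i has_real_derivative U (Suc i) t) (at t)" using sol_deriv[OF assms(1)] Suc.prems by simp
    moreover have "(U i has_real_derivative 0) (at t)"
      by (rule has_field_derivative_transform_within_open[of "\<lambda>_. 0" _ _ "{a<..<b}"])
        (use Suc in auto)
    ultimately show ?case by (rule DERIV_unique)
  qed
  have "vanishes U n ((a + b) / 2)" using z \<open>a < b\<close> by (auto simp: vanishes_def)
  then show ?thesis by (rule hom_trivial[OF assms(1)])
qed

section \<open>Comparison of solutions for different parameters\<close>

lemma sol_bounded_on:
  assumes "sol M f u"
  obtains C where "C > 0" "\<And>t. t \<in> {a..b} \<Longrightarrow> \<bar>u 0 t\<bar> \<le> C"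
proof -
  have "compact (u 0 ` {a..b})" using sol_continuous_on[OF assms] by (intro compact_continuous_image) auto
  then obtain C where C: "C > 0" "\<forall>x\<in>u 0 ` {a..b}. norm x \<le> C"
    using compact_imp_bounded bounded_pos by metis
  then show thesis by (intro that[of C]) auto
qed

text \<open>If \<open>\<beta> < \<kappa>\<close>, then \<open>y\<close> is a strict supersolution for the eigenvalue \<open>\<beta>\<close>: a bound \<open>\<bar>u\<bar> \<le> m y\<close>
  improves to \<open>\<bar>u\<bar> \<le> (\<beta> / \<kappa>) m y\<close>.\<close>

lemma no_eigenvalue_between:
  assumes d: "dis M a b" "dis (M - \<sigma> * \<kappa>) a b" and ab: "a < b" and k: "1 \<le> k" "k < n"
    and \<sigma>: "\<sigma> = (-1) ^ (n - k)" and \<beta>: "0 < \<beta>" "\<beta> \<le> \<kappa>"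
  shows "\<not> singular (M - \<sigma> * \<beta>) k a b"
proof (cases "\<beta> = \<kappa>")
  case True
  then show ?thesis using dis_nonsingular[OF d(2), of a b k] ab k by auto
next
  case False
  then have \<beta>\<kappa>: "\<beta> < \<kappa>" using \<beta> by simp
  have \<sigma>2: "\<sigma> * \<sigma> = 1" by (cases "even (n - k)") (auto simp: \<sigma>)
  have \<sigma>m: "\<sigma> * (\<sigma> * x) = x" for x using \<sigma>2 by (simp add: mult.assoc[symmetric])
  show ?thesis
  proof
    assume "singular (M - \<sigma> * \<beta>) k a b"
    then obtain u where u: "hom (M - \<sigma> * \<beta>) u" "\<not> trivial u" "vanishes u k a" "vanishes u (n - k) b"
      by (auto simp: singular_def)
    have "\<exists>y. sol (M - \<sigma> * \<kappa>) (\<lambda>_. \<sigma>) y \<and> vanishes y k a \<and> vanishes y (n - k) b"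
      by (rule bvp_exists[where C = "\<bar>\<sigma>\<bar>"]) (use dis_nonsingular[OF d(2), of a b k] ab k in auto)
    then obtain y where y: "sol (M - \<sigma> * \<kappa>) (\<lambda>_. \<sigma>) y" "vanishes y k a" "vanishes y (n - k) b" by blast
    have y0: "y 0 t \<ge> 0" if "t \<in> {a..b}" for t
      using bvp_weak_sign[OF d(2) ab k y _ that, of \<sigma>] by (simp add: \<sigma>[symmetric] \<sigma>2 \<sigma>m)
    have yM: "sol M (\<lambda>t. \<sigma> + (M - (M - \<sigma> * \<kappa>)) * y 0 t) y" by (rule sol_shift[OF y(1)])
    have uM: "sol M (\<lambda>t. 0 + (M - (M - \<sigma> * \<beta>)) * u 0 t) u" by (rule sol_shift[OF u(1)])
    \<comment> \<open>At parameter \<open>M\<close>, the sources of \<open>y\<close> and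
      \<open>u\<close> are \<open>\<sigma> (1 + \<kappa> y)\<close> and
      \<open>\<sigma> \<beta> u\<close>; the sign of the inverse turns a bound between sources into
      one between \<open>u\<close> and \<open>y\<close>.\<close>
    have compare: "s * u 0 t \<le> C * y 0 t"
      if C: "\<And>t. t \<in> {a..b} \<Longrightarrow> \<beta> * (s * u 0 t) \<le> C + C * \<kappa> * y 0 t" and t: "t \<in> {a..b}" for C s t
    proof -
      have "0 \<le> (-1) ^ (n - k) * (\<sigma> * (C * y 0 t + (- s) * u 0 t))"
      proof (rule bvp_weak_sign[OF d(1) ab k sol_add[OF yM uM] _ _ _ t])
        fix t assume "t \<in> {a..b}"
        have *: "\<sigma> * (C * (\<sigma> + (M - (M - \<sigma> * \<kappa>)) * y 0 t) + - s * (0 + (M - (M - \<sigma> * \<beta>)) * u 0 t))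
            = (\<sigma> * \<sigma>) * (C + C * \<kappa> * y 0 t - \<beta> * (s * u 0 t))" by (simp add: algebra_simps)
        show "0 \<le> \<sigma> * (C * (\<sigma> + (M - (M - \<sigma> * \<kappa>)) * y 0 t) + - s * (0 + (M - (M - \<sigma> * \<beta>)) * u 0 t))"
          unfolding * \<sigma>2 using C[OF \<open>t \<in> {a..b}\<close>] by simp
      qed (intro vanishes_combination y(2,3) u(3,4))+
      then show ?thesis by (simp add: \<sigma>[symmetric] \<sigma>m)
    qed
    obtain C where C: "C > 0" "\<And>t. t \<in> {a..b} \<Longrightarrow> \<bar>u 0 t\<bar> \<le> C"
      using sol_bounded_on[OF u(1)] by blast
    \<comment> \<open>The constant source of \<open>y\<close> starts the induction, when only
      \<open>\<bar>u\<bar> \<le> C\<close> is known; each later step uses the source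
      \<open>\<kappa> y\<close>.\<close>
    have bound: "\<bar>u 0 t\<bar> \<le> (\<beta> / \<kappa>) ^ j * (\<beta> * C) * y 0 t" if "t \<in> {a..b}" for j t
      using that
    proof (induction j arbitrary: t)
      case 0
      have "s * u 0 t \<le> (\<beta> * C) * y 0 t" if "\<bar>s\<bar> = 1" for s
      proof (rule compare[OF _ 0])
        fix t assume t: "t \<in> {a..b}"
        have "s * u 0 t \<le> \<bar>s * u 0 t\<bar>" by simp
        also have "\<dots> \<le> C" using C(2)[OF t] that by (simp add: abs_mult)
        finally have "\<beta> * (s * u 0 t) \<le> \<beta> * C" using \<beta> by simp
        moreover have "0 \<le> \<beta> * C * \<kappa> * y 0 t" using \<beta> C(1) y0[OF t] by simp
        ultimately show "\<beta> * (s * u 0 t) \<le> \<beta> * C + \<beta> * C * \<kappa> * y 0 t" by linarith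
      qed
      from this[of 1] this[of "-1"] show ?case by (simp add: abs_le_iff)
    next
      case (Suc j)
      define m where "m = (\<beta> / \<kappa>) ^ j * (\<beta> * C)"
      have m: "m \<ge> 0" using \<beta> C by (simp add: m_def)
      have "s * u 0 t \<le> (\<beta> / \<kappa> * m) * y 0 t" if "\<bar>s\<bar> = 1" for s
      proof (rule compare[OF _ Suc.prems])
        fix t assume t: "t \<in> {a..b}"
        have "s * u 0 t \<le> \<bar>s * u 0 t\<bar>" by simp
        also have "\<dots> \<le> m * y 0 t" using Suc.IH[OF t] that by (simp add: abs_mult m_def)
        finally have "\<beta> * (s * u 0 t) \<le> \<beta> * (m * y 0 t)" using \<beta> by simp
        moreover have "\<beta> / \<kappa> * m * \<kappa> * y 0 t = \<beta> * (m * y 0 t)" using \<beta> by simp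
        moreover have "0 \<le> \<beta> / \<kappa> * m" using \<beta> m by simp
        ultimately show "\<beta> * (s * u 0 t) \<le> \<beta> / \<kappa> * m + \<beta> / \<kappa> * m * \<kappa> * y 0 t" by linarith
      qed
      from this[of 1] this[of "-1"] show ?case by (simp add: abs_le_iff m_def)
    qed
    have "u 0 t = 0" if "t \<in> {a<..<b}" for t
    proof -
      have "(\<lambda>j. (\<beta> / \<kappa>) ^ j * (\<beta> * C) * y 0 t) \<longlonglongrightarrow> 0 * (\<beta> * C) * y 0 t"
        using \<beta> \<beta>\<kappa> by (intro tendsto_mult tendsto_const LIMSEQ_realpow_zero) auto
      then have "\<bar>u 0 t\<bar> \<le> 0 * (\<beta> * C) * y 0 t"
        by (rule LIMSEQ_le_const) (use bound that in auto)
      then show ?thesis by simp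
    qed
    then show False using hom_zero_on_interval[OF u(1) ab] u(2) by blast
  qed
qed

text \<open>For \<open>(-1)\<^sup>n\<^sup>-\<^sup>k = - \<tau>\<close> the inverse operators decrease as \<open>\<kappa>\<close> grows, so they stay bounded up
  to \<open>\<beta>\<close> and no eigenfunction can appear.\<close>

lemma eigenvalue_parity:
  assumes d: "\<And>\<kappa>. 0 \<le> \<kappa> \<Longrightarrow> \<kappa> < \<beta> \<Longrightarrow> dis (M - \<tau> * \<kappa>) a c" and \<tau>: "\<tau> = 1 \<or> \<tau> = -1"
    and \<beta>: "\<beta> > 0" and ac: "a < c" and k: "1 \<le> k" "k < n" and sing: "singular (M - \<tau> * \<beta>) k a c"
  shows "(-1) ^ (n - k) = \<tau>"
proof (rule ccontr)
  assume ne: "(-1) ^ (n - k) \<noteq> \<tau>"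
  define \<sigma> where "\<sigma> = - \<tau>"
  have \<sigma>: "(-1) ^ (n - k) = \<sigma>" using ne \<tau> by (cases "even (n - k)") (auto simp: \<sigma>_def)
  have \<sigma>2: "\<sigma> * \<sigma> = 1" using \<tau> by (auto simp: \<sigma>_def)
  have \<sigma>m: "\<sigma> * (\<sigma> * x) = x" for x using \<sigma>2 by (simp add: mult.assoc[symmetric])
  have M\<kappa>: "M - \<tau> * \<kappa> = M + \<sigma> * \<kappa>" for \<kappa> by (simp add: \<sigma>_def)
  have d': "dis (M + \<sigma> * \<kappa>) a c" if "0 \<le> \<kappa>" "\<kappa> < \<beta>" for \<kappa> using d[OF that] by (simp add: M\<kappa>)
  have d0: "dis M a c" using d'[of 0] \<beta> by simp
  obtain u where u: "hom (M + \<sigma> * \<beta>) u" "\<not> trivial u" "vanishes u k a" "vanishes u (n - k) c"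
    using sing by (auto simp: singular_def M\<kappa>)
  obtain C where C: "C > 0" "\<And>t. t \<in> {a..c} \<Longrightarrow> \<bar>u 0 t\<bar> \<le> C"
    using sol_bounded_on[OF u(1)] by blast
  have ex: "\<exists>w. sol (M + \<sigma> * \<kappa>) (\<lambda>_. \<sigma>) w \<and> vanishes w k a \<and> vanishes w (n - k) c"
    if "0 \<le> \<kappa>" "\<kappa> < \<beta>" for \<kappa>
    by (rule bvp_exists[where C = "\<bar>\<sigma>\<bar>"]) (use dis_nonsingular[OF d'[OF that], of a c k] ac k in auto)
  obtain w0 where w0: "sol M (\<lambda>_. \<sigma>) w0" "vanishes w0 k a" "vanishes w0 (n - k) c"
    using ex[of 0] \<beta> by auto
  \<comment> \<open>At parameter \<open>M + \<sigma> \<kappa>\<close>, the source of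
    \<open>u\<close> is \<open>- \<sigma> (\<beta> - \<kappa>) u\<close>. It tends to
    \<open>0\<close> as \<open>\<kappa>\<close> tends to \<open>\<beta>\<close>, while
    \<open>w \<le> w0\<close> holds for every \<open>\<kappa>\<close>.\<close>
  have bound: "\<bar>u 0 t\<bar> \<le> (\<beta> - \<kappa>) * C * w0 0 t" if \<kappa>: "0 \<le> \<kappa>" "\<kappa> < \<beta>" and t: "t \<in> {a..c}" for \<kappa> t
  proof -
    obtain w where w: "sol (M + \<sigma> * \<kappa>) (\<lambda>_. \<sigma>) w" "vanishes w k a" "vanishes w (n - k) c"
      using ex[OF \<kappa>] by blast
    have w_pos: "w 0 t \<ge> 0" if "t \<in> {a..c}" for t
      using bvp_weak_sign[OF d'[OF \<kappa>] ac k w _ that, of \<sigma>] by (simp add: \<sigma> \<sigma>2 \<sigma>m)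
    have wM: "sol M (\<lambda>t. \<sigma> + (M - (M + \<sigma> * \<kappa>)) * w 0 t) w" by (rule sol_shift[OF w(1)])
    have "0 \<le> (-1) ^ (n - k) * (\<sigma> * (1 * w0 0 t + (-1) * w 0 t))"
    proof (rule bvp_weak_sign[OF d0 ac k sol_add[OF w0(1) wM] _ _ _ t])
      fix t assume "t \<in> {a..c}"
      have *: "\<sigma> * (1 * \<sigma> + - 1 * (\<sigma> + (M - (M + \<sigma> * \<kappa>)) * w 0 t)) = (\<sigma> * \<sigma>) * (\<kappa> * w 0 t)"
        by (simp add: algebra_simps)
      show "0 \<le> \<sigma> * (1 * \<sigma> + - 1 * (\<sigma> + (M - (M + \<sigma> * \<kappa>)) * w 0 t))"
        unfolding * \<sigma>2 using w_pos[OF \<open>t \<in> {a..c}\<close>] \<kappa> by simp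
    qed (intro vanishes_combination w(2,3) w0(2,3))+
    then have ww: "w 0 t \<le> w0 0 t" by (simp add: \<sigma> \<sigma>m)
    have uM: "sol (M + \<sigma> * \<kappa>) (\<lambda>t. 0 + ((M + \<sigma> * \<kappa>) - (M + \<sigma> * \<beta>)) * u 0 t) u" by (rule sol_shift[OF u(1)])
    have "s * u 0 t \<le> ((\<beta> - \<kappa>) * C) * w 0 t" if s: "\<bar>s\<bar> = 1" for s
    proof -
      have "0 \<le> (-1) ^ (n - k) * (\<sigma> * (((\<beta> - \<kappa>) * C) * w 0 t + (- s) * u 0 t))"
      proof (rule bvp_weak_sign[OF d'[OF \<kappa>] ac k sol_add[OF w(1) uM] _ _ _ t])
        fix t assume t: "t \<in> {a..c}"
        have *: "\<sigma> * (((\<beta> - \<kappa>) * C) * \<sigma> + (- s) * (0 + ((M + \<sigma> * \<kappa>) - (M + \<sigma> * \<beta>)) * u 0 t))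
            = (\<sigma> * \<sigma>) * ((\<beta> - \<kappa>) * (C + s * u 0 t))" by (simp add: algebra_simps)
        have "\<bar>s * u 0 t\<bar> \<le> C" using C(2)[OF t] s by (simp add: abs_mult)
        then have "0 \<le> C + s * u 0 t" by linarith
        then show "0 \<le> \<sigma> * (((\<beta> - \<kappa>) * C) * \<sigma> + (- s) * (0 + ((M + \<sigma> * \<kappa>) - (M + \<sigma> * \<beta>)) * u 0 t))"
          unfolding * \<sigma>2 using \<kappa> by simp
      qed (intro vanishes_combination w(2,3) u(3,4))+
      then show ?thesis by (simp add: \<sigma> \<sigma>m)
    qed
    from this[of 1] this[of "-1"] have "\<bar>u 0 t\<bar> \<le> ((\<beta> - \<kappa>) * C) * w 0 t" by (simp add: abs_le_iff)
    also have "\<dots> \<le> ((\<beta> - \<kappa>) * C) * w0 0 t" using ww \<kappa> C(1) by (intro mult_left_mono) auto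
    finally show ?thesis .
  qed
  have "u 0 t = 0" if t: "t \<in> {a<..<c}" for t
  proof -
    have "(\<lambda>j. (\<beta> - (\<beta> - \<beta> / real (Suc j))) * C * w0 0 t) \<longlonglongrightarrow> (\<beta> - (\<beta> - 0)) * C * w0 0 t"
      by (intro tendsto_intros LIMSEQ_Suc[OF lim_const_over_n])
    then have "\<bar>u 0 t\<bar> \<le> (\<beta> - (\<beta> - 0)) * C * w0 0 t"
    proof (rule LIMSEQ_le_const, intro exI allI impI)
      fix j :: nat
      have "\<beta> / real (Suc j) \<le> \<beta>" "\<beta> / real (Suc j) > 0" using \<beta> by (auto simp: divide_le_eq)
      then show "\<bar>u 0 t\<bar> \<le> (\<beta> - (\<beta> - \<beta> / real (Suc j))) * C * w0 0 t"
        using t by (intro bound) auto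
    qed
    then show ?thesis by simp
  qed
  then show False using hom_zero_on_interval[OF u(1) ac] u(2) by blast
qed

section \<open>Two-point eigenvalues\<close>

lemma boundary_eigenvalue:
  assumes d: "\<And>\<kappa>. 0 \<le> \<kappa> \<Longrightarrow> \<kappa> < \<beta> \<Longrightarrow> dis (M - \<tau> * \<kappa>) a b" and \<tau>: "\<tau> = 1 \<or> \<tau> = -1"
    and \<beta>: "\<beta> > 0" and ab: "a < b" and nd: "\<not> dis (M - \<tau> * \<beta>) a b"
  shows "\<exists>k. 1 \<le> k \<and> k < n \<and> (-1) ^ (n - k) = \<tau> \<and> singular (M - \<tau> * \<beta>) k a b"
proof -
  obtain k c where k: "1 \<le> k" "k < n" and c: "c \<in> {a<..b}" and sing: "singular (M - \<tau> * \<beta>) k a c"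
    using nonsingular_imp_dis[OF _ ab] nd by blast
  have ac: "a < c" using c by simp
  have dc: "dis (M - \<tau> * \<kappa>) a c" if "0 \<le> \<kappa>" "\<kappa> < \<beta>" for \<kappa>
    using dis_subinterval[OF d[OF that]] c by simp
  have parity: "(-1) ^ (n - j) = \<tau>" if "1 \<le> j" "j < n" "singular (M - \<tau> * \<beta>) j a c" for j
    by (rule eigenvalue_parity[OF dc \<tau> \<beta> ac that])
  have par: "(-1) ^ (n - k) = \<tau>" by (rule parity[OF k sing])
  define m where "m = n - k"
  have m: "1 \<le> m" "m < n" and conds: "k + (m - 1) < n" "n \<le> k + m" "n \<le> k + (m - 1) + 1"
    using k by (auto simp: m_def)
  \<comment> \<open>Moving one zero from \<open>c\<close> to \<open>a\<close> changes the parity of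
    \<open>n - k\<close>, which \<open>parity\<close> forbids. If \<open>Suc k = n\<close>, all
    \<open>n\<close> zeros are at \<open>a\<close> instead.\<close>
  have up: "trivial U" if U: "hom (M - \<tau> * \<beta>) U" "vanishes U (Suc k) a" "vanishes U (m - 1) c" for U
  proof (cases "Suc k = n")
    case True
    then show ?thesis using hom_trivial U by metis
  next
    case False
    show ?thesis
    proof (rule ccontr)
      assume "\<not> trivial U"
      moreover have nm: "n - Suc k = m - 1" by (simp add: m_def)
      ultimately have "singular (M - \<tau> * \<beta>) (Suc k) a c" using U by (auto simp: singular_def)
      then have "(-1) ^ (n - Suc k) = \<tau>" by (rule parity[rotated 2]) (use False k in auto)
      then have "(-1) ^ (m - 1) = \<tau>" unfolding nm .
      moreover have "(-1::real) ^ m = - ((-1) ^ (m - 1))" using m by (cases m) auto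
      ultimately show False using par \<tau> by (auto simp: m_def)
    qed
  qed
  have down: "trivial U" if U: "hom (M - \<tau> * \<beta>) U" "vanishes U k a" "vanishes U (Suc m) c" for U
  proof (cases "k = 1")
    case True
    then have "Suc m = n" using k by (simp add: m_def)
    then show ?thesis using hom_trivial[OF U(1), of c] U(3) by simp
  next
    case False
    show ?thesis
    proof (rule ccontr)
      assume "\<not> trivial U"
      moreover have "vanishes U (k - 1) a" using vanishes_mono[OF U(2)] by simp
      moreover have "n - (k - 1) = Suc m" using k by (simp add: m_def)
      ultimately have "singular (M - \<tau> * \<beta>) (k - 1) a c" using U by (auto simp: singular_def)
      then have "(-1) ^ (n - (k - 1)) = \<tau>" by (rule parity[rotated 2]) (use False k in auto)
      then have "(-1) ^ Suc m = \<tau>" using \<open>n - (k - 1) = Suc m\<close> by simp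
      then show False using par \<tau> by (auto simp: m_def)
    qed
  qed
  obtain q where q: "hom (M - \<tau> * \<beta>) q" "\<not> trivial q" "vanishes q k a" "vanishes q m c"
    using sing by (auto simp: singular_def m_def)
  have qa: "q k a \<noteq> 0"
    using up[OF q(1) _ vanishes_mono[OF q(4)]] q by (auto simp: vanishes_Suc)
  have qc: "q m c \<noteq> 0" using down[OF q(1,3)] q by (auto simp: vanishes_Suc)
  have "c = b"
  proof (rule ccontr)
    assume "c \<noteq> b"
    then have cb: "c < b" using c by simp
    define \<kappa> where "\<kappa> j = \<beta> - \<beta> / real (Suc j)" for j
    have \<kappa>: "0 \<le> \<kappa> j" "\<kappa> j < \<beta>" for j using \<beta> by (auto simp: \<kappa>_def divide_le_eq)
    have "\<kappa> \<longlonglongrightarrow> \<beta> - 0" unfolding \<kappa>_def[abs_def] by (intro tendsto_intros LIMSEQ_Suc[OF lim_const_over_n])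
    then have Mlim: "(\<lambda>j. M - \<tau> * \<kappa> j) \<longlonglongrightarrow> M - \<tau> * \<beta>" by (intro tendsto_intros) simp
    \<comment> \<open>Only \<open>k + (m - 1) = n - 1\<close> zeros are imposed, so such a solution
      exists; by disconjugacy it has no further zero in \<open>[a, b]\<close>.\<close>
    have "\<exists>z. hom (M - \<tau> * \<kappa> j) z \<and> energy z a = 1 \<and> vanishes z k a \<and> vanishes z (m - 1) c" for j
    proof -
      obtain z where z: "hom (M - \<tau> * \<kappa> j) z" "\<not> trivial z" "vanishes z k a" "vanishes z (m - 1) c"
        using two_point_hom[OF conds(1)] by blast
      show ?thesis
        using sol_divide[OF z(1), of "sqrt (energy z a)"] energy_normalize[OF energy_pos[OF z(1,2)]] z(3,4)
        by (intro exI[of _ "\<lambda>i t. z i t / sqrt (energy z a)"]) (auto simp: vanishes_def)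
    qed
    then obtain zs where zs: "\<And>j. hom (M - \<tau> * \<kappa> j) (zs j)" "\<And>j. energy (zs j) a = 1"
      "\<And>j. vanishes (zs j) k a" "\<And>j. vanishes (zs j) (m - 1) c" by metis
    have "\<exists>r z. strict_mono r \<and> hom (M - \<tau> * \<beta>) z \<and> energy z a = 1 \<and>
      (\<forall>i T t. i < n \<longrightarrow> (\<forall>j. T j \<in> {a..b}) \<longrightarrow> T \<longlonglongrightarrow> t \<longrightarrow> (\<lambda>j. zs (r j) i (T j)) \<longlonglongrightarrow> z i t)"
      by (rule sol_compactness[where \<epsilon> = "\<lambda>_. 0", OF Mlim zs(1)]) (use ab zs(2) in auto)
    then obtain r z where z: "hom (M - \<tau> * \<beta>) z" "energy z a = 1"
      and conv: "\<And>i T t. i < n \<Longrightarrow> (\<And>j. T j \<in> {a..b}) \<Longrightarrow> T \<longlonglongrightarrow> t \<Longrightarrow> (\<lambda>j. zs (r j) i (T j)) \<longlonglongrightarrow> z i t"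
      by blast
    have lim: "(\<lambda>j. zs (r j) i t) \<longlonglongrightarrow> z i t" if "i < n" "t \<in> {a..b}" for i t
      by (rule conv[OF that(1), of "\<lambda>_. t"]) (use that in auto)
    have "energy z a = 0" if "trivial z" using that by (simp add: energy_def trivial_def)
    then have znt: "\<not> trivial z" using z(2) by auto
    have limit0: "z i t = 0" if "i < n" "t \<in> {a..b}" "\<And>j. zs (r j) i t = 0" for i t
      using lim[OF that(1,2)] that(3) by (simp add: LIMSEQ_const_iff)
    have za: "vanishes z k a" using limit0[of _ a] zs(3) ab k by (auto simp: vanishes_def)
    have zc: "vanishes z (m - 1) c" using limit0[of _ c] zs(4) ac cb m by (auto simp: vanishes_def)
    \<comment> \<open>The \<open>k\<close>-th derivative at \<open>a\<close> cancels in this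
      combination, so \<open>up\<close> applies: \<open>z\<close> is a multiple of \<open>q\<close>
      and inherits the missing zero at \<open>c\<close>.\<close>
    have "trivial (\<lambda>i t. q k a * z i t + (- z k a) * q i t)"
    proof (rule up)
      show "hom (M - \<tau> * \<beta>) (\<lambda>i t. q k a * z i t + (- z k a) * q i t)" by (rule hom_combination[OF z(1) q(1)])
      show "vanishes (\<lambda>i t. q k a * z i t + (- z k a) * q i t) (Suc k) a"
        unfolding vanishes_Suc by (intro conjI vanishes_combination za q(3)) simp
      show "vanishes (\<lambda>i t. q k a * z i t + (- z k a) * q i t) (m - 1) c"
        by (intro vanishes_combination zc vanishes_mono[OF q(4)]) simp
    qed
    then have zq: "z i t = z k a / q k a * q i t" if "i \<le> n" for i t
      using qa that by (auto simp: trivial_def field_simps)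
    have "z k a \<noteq> 0" using zq znt by (auto simp: trivial_def)
    then have zmc: "z m c \<noteq> 0" using zq[of m c] qa qc m by simp
    have zm: "vanishes z m c" using q(4) zq m by (auto simp: vanishes_def)
    obtain e1 where e1: "e1 > 0" "\<And>t. t \<in> {c<..<c+e1} \<Longrightarrow> sgn (z 0 t) = sgn (z m c)"
      using sgn_right_of_zero[OF z(1) _ zm zmc] m by auto
    obtain e2 where e2: "e2 > 0" "\<And>t. t \<in> {c-e2<..<c} \<Longrightarrow> sgn (z 0 t) = (-1) ^ m * sgn (z m c)"
      using sgn_left_of_zero[OF z(1) _ zm zmc] m by auto
    obtain y where y: "c < y" "y < min b (c + e1)" using dense[of c "min b (c + e1)"] cb e1(1) by auto
    obtain x where x: "max a (c - e2) < x" "x < c" using dense[of "max a (c - e2)" c] ac e2(1) by auto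
    \<comment> \<open>Across \<open>c\<close> the limit has the sign change \<open>(-1) ^ m\<close>,
      the approximants have \<open>(-1) ^ (m - 1)\<close>. A point \<open>y\<close> to the right of
      \<open>c\<close> is available because \<open>c < b\<close>.\<close>
    have zxy: "sgn (z 0 x * z 0 y) = (-1) ^ m"
      using e1(2)[of y] e2(2)[of x] x y zmc by (simp add: sgn_mult mult.assoc)
    have "(-1) ^ (m - 1) * (z 0 x * z 0 y) \<ge> 0"
    proof (rule LIMSEQ_le_const)
      show "(\<lambda>j. (-1) ^ (m - 1) * (zs (r j) 0 x * zs (r j) 0 y)) \<longlonglongrightarrow> (-1) ^ (m - 1) * (z 0 x * z 0 y)"
        using x y order_pos by (intro tendsto_intros lim) auto
      have "0 \<le> (-1) ^ (m - 1) * (zs j 0 x * zs j 0 y)" for j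
      proof -
        have zj: "hom (M - \<tau> * \<kappa> j) (zs j)" "vanishes (zs j) k a" "vanishes (zs j) (m - 1) c"
          using zs by auto
        have dj: "dis (M - \<tau> * \<kappa> j) a b" by (rule d[OF \<kappa>])
        have "energy (zs j) a = 0" if "trivial (zs j)" using that by (simp add: energy_def trivial_def)
        then have nt: "\<not> trivial (zs j)" using zs(2)[of j] by auto
        have ne: "zs j (m - 1) c \<noteq> 0"
        proof
          assume "zs j (m - 1) c = 0"
          then have "vanishes (zs j) m c" using zj(3) m vanishes_Suc[of "zs j" "m - 1" c] by simp
          then show False using dis_two_points[OF dj zj(1,2), of m c] nt conds(2) ac cb by auto
        qed
        have nz: "zs j 0 t \<noteq> 0" if "t \<in> {a<..<c} \<or> t \<in> {c<..<b}" for t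
        proof
          assume "zs j 0 t = 0"
          then have "vanishes (zs j) 1 t" by (simp add: vanishes_def)
          then show False using dis_three_points[OF dj zj, of 1 t] nt conds(3) that ac cb by auto
        qed
        have "sgn (zs j 0 x) = (-1) ^ (m - 1) * sgn (zs j (m - 1) c)"
          by (rule sgn_from_right_end[OF zj(1) _ zj(3) ne, where a = a]) (use nz x m in auto)
        moreover have "sgn (zs j 0 y) = sgn (zs j (m - 1) c)"
          by (rule sgn_from_left_end[OF zj(1) _ zj(3) ne, where b = b]) (use nz y m in auto)
        ultimately have "sgn ((-1) ^ (m - 1) * (zs j 0 x * zs j 0 y)) =
            (sgn ((-1) ^ (m - 1)) * (-1) ^ (m - 1)) * (sgn (zs j (m - 1) c) * sgn (zs j (m - 1) c))"
          by (simp only: sgn_mult ac_simps)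
        also have "sgn ((-1::real) ^ (m - 1)) * (-1) ^ (m - 1) = 1" by (cases "even (m - 1)") simp_all
        also have "sgn (zs j (m - 1) c) * sgn (zs j (m - 1) c) = 1" using ne by (simp add: sgn_if)
        finally have "sgn ((-1) ^ (m - 1) * (zs j 0 x * zs j 0 y)) = 1" by simp
        then show ?thesis by (simp add: sgn_if split: if_splits)
      qed
      then show "\<exists>N. \<forall>j\<ge>N. 0 \<le> (-1) ^ (m - 1) * (zs (r j) 0 x * zs (r j) 0 y)" by blast
    qed
    moreover have "(-1::real) ^ m = - ((-1) ^ (m - 1))" using m by (cases m) auto
    ultimately show False
      using zxy by (cases "even (m - 1)") (auto simp: sgn_if split: if_splits)
  qed
  then show ?thesis using k par sing by blast
qed

section \<open>Existence of the extremal eigenvalues\<close>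

text \<open>The boundary conditions already use up all \<open>n\<close> zeros that
  \<open>inhomogeneous_three_points\<close> allows. This excludes interior zeros and makes the
  orders at the endpoints exact.\<close>

lemma bvp_positive:
  assumes d: "dis M a b" and ab: "a < b" and k: "1 \<le> k" "k < n" and \<sigma>: "\<sigma> = (-1) ^ (n - k)"
    and u: "sol M f u" "vanishes u k a" "vanishes u (n - k) b"
    and f: "\<And>t. t \<in> {a..b} \<Longrightarrow> \<sigma> * f t \<ge> 0" "\<And>t. t \<in> {a<..<b} \<Longrightarrow> f t \<noteq> 0"
  shows "\<And>t. t \<in> {a<..<b} \<Longrightarrow> u 0 t > 0" and "u k a > 0" and "\<sigma> * u (n - k) b > 0"
proof -
  have \<sigma>m: "\<sigma> * (\<sigma> * x) = x" for x by (cases "even (n - k)") (auto simp: \<sigma>)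
  have weak: "u 0 t \<ge> 0" if "t \<in> {a..b}" for t
    using bvp_weak_sign[OF d ab k u f(1) that] by (simp add: \<sigma>[symmetric] \<sigma>m)
  have three: "i + l + j \<le> n" if "vanishes u i a" "vanishes u l b" "vanishes u j w" "i \<le> n" "l \<le> n" "w \<in> {a<..<b}"
    for i l j w by (rule inhomogeneous_three_points[OF d u(1) f(2) that])
  have nz: "u 0 t \<noteq> 0" if "t \<in> {a<..<b}" for t
    using three[OF u(2,3), of 1 t] that k by (auto simp: vanishes_def)
  show pos: "u 0 t > 0" if "t \<in> {a<..<b}" for t
    using weak[of t] nz[OF that] that by (simp add: less_le)
  define w where "w = (a + b) / 2"
  have w: "w \<in> {a<..<b}" using ab by (auto simp: w_def)
  have w0: "vanishes u 0 w" by (simp add: vanishes_def)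
  have ka: "u k a \<noteq> 0" using three[OF _ u(3) w0 _ _ w, of "Suc k"] u(2) k by (auto simp: vanishes_Suc)
  have "Suc (n - k) \<le> n" using k by simp
  then have kb: "u (n - k) b \<noteq> 0" using three[OF u(2) _ w0 _ _ w, of "Suc (n - k)"] u(3) k by (auto simp: vanishes_Suc)
  show "u k a > 0"
    using sgn_from_left_end[OF u(1) _ u(2) ka nz w] pos[OF w] k by (auto simp: sgn_if split: if_splits)
  show "\<sigma> * u (n - k) b > 0"
    using sgn_from_right_end[OF u(1) _ u(3) kb nz w] pos[OF w] k
    by (cases "even (n - k)") (auto simp: \<sigma> sgn_if split: if_splits)
qed

text \<open>Both functions have zeros of exact orders \<open>k\<close> and \<open>n - k\<close> at the endpoints, so their quotient
  is bounded away from \<open>0\<close>.\<close>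

lemma bvp_domination:
  assumes d: "dis M a b" and ab: "a < b" and k: "1 \<le> k" "k < n" and \<sigma>: "\<sigma> = (-1) ^ (n - k)"
    and u: "sol M f u" "vanishes u k a" "vanishes u (n - k) b"
    and f: "\<And>t. t \<in> {a..b} \<Longrightarrow> \<sigma> * f t \<ge> 0" "\<And>t. t \<in> {a<..<b} \<Longrightarrow> f t \<noteq> 0"
    and g: "sol M h g" "vanishes g k a" "vanishes g (n - k) b"
    and h: "\<And>t. t \<in> {a..b} \<Longrightarrow> \<sigma> * h t \<ge> 0" "\<And>t. t \<in> {a<..<b} \<Longrightarrow> h t \<noteq> 0"
  shows "\<exists>\<delta>>0. \<forall>t\<in>{a..b}. \<delta> * g 0 t \<le> u 0 t"
proof -
  have up: "\<And>t. t \<in> {a<..<b} \<Longrightarrow> u 0 t > 0" "u k a > 0" "\<sigma> * u (n - k) b > 0"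
    using bvp_positive[OF d ab k \<sigma> u f] by blast+
  have gp: "\<And>t. t \<in> {a<..<b} \<Longrightarrow> g 0 t > 0" "g k a > 0" "\<sigma> * g (n - k) b > 0"
    using bvp_positive[OF d ab k \<sigma> g h] by blast+
  \<comment> \<open>Half of the smaller of the two limits of \<open>u / g\<close> at
    \<open>a\<close> and at \<open>b\<close>.\<close>
  define \<delta>0 where "\<delta>0 = min (u k a / g k a) (\<sigma> * u (n - k) b / (\<sigma> * g (n - k) b)) / 2"
  note p = divide_pos_pos[OF up(2) gp(2)] divide_pos_pos[OF up(3) gp(3)]
  have half_min: "min x y / 2 > 0 \<and> min x y / 2 < x \<and> min x y / 2 < y" if "x > 0" "y > 0" for x y :: real
    using that by (auto simp: min_def)
  have \<delta>0: "\<delta>0 > 0" "\<delta>0 < u k a / g k a" "\<delta>0 < \<sigma> * u (n - k) b / (\<sigma> * g (n - k) b)"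
    using half_min[OF p] unfolding \<delta>0_def by blast+
  define V where "V i t = 1 * u i t + (- \<delta>0) * g i t" for i t
  have V: "sol M (\<lambda>t. 1 * f t + (- \<delta>0) * h t) V" unfolding V_def[abs_def] by (rule sol_add[OF u(1) g(1)])
  have Va: "vanishes V k a" and Vb: "vanishes V (n - k) b"
    unfolding V_def[abs_def] by (intro vanishes_combination u g)+
  have Vka: "V k a > 0" using \<delta>0(2) gp(2) by (simp add: V_def less_divide_eq)
  have "\<sigma> * u (n - k) b - \<delta>0 * (\<sigma> * g (n - k) b) > 0"
    using \<delta>0(3)[unfolded pos_less_divide_eq[OF gp(3)]] by linarith
  then have Vkb: "\<sigma> * V (n - k) b > 0" by (simp add: V_def algebra_simps)
  obtain e1 where e1: "e1 > 0" "\<And>t. t \<in> {a<..<a+e1} \<Longrightarrow> sgn (V 0 t) = sgn (V k a)"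
    using sgn_right_of_zero[OF V _ Va] Vka k by auto
  have "V (n - k) b \<noteq> 0" using Vkb by auto
  then obtain e2 where e2: "e2 > 0" "\<And>t. t \<in> {b-e2<..<b} \<Longrightarrow> sgn (V 0 t) = (-1) ^ (n - k) * sgn (V (n - k) b)"
    using sgn_left_of_zero[OF V _ Vb] by auto
  have near_a: "\<delta>0 * g 0 t \<le> u 0 t" if "t \<in> {a<..<a+e1}" for t
    using e1(2)[OF that] Vka by (auto simp: V_def sgn_if split: if_splits)
  have s1: "(-1) ^ (n - k) * sgn (V (n - k) b) = 1"
    using Vkb by (cases "even (n - k)") (auto simp: \<sigma> sgn_if split: if_splits)
  have near_b: "\<delta>0 * g 0 t \<le> u 0 t" if "t \<in> {b-e2<..<b}" for t
    using e2(2)[OF that] unfolding s1 by (auto simp: V_def sgn_if split: if_splits)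
  define e where "e = min (min e1 e2) (b - a) / 2"
  have e: "e > 0" "e < e1" "e < e2" "e \<le> (b - a) / 2" using e1 e2 ab by (auto simp: e_def min_def)
  have "continuous_on {a+e..b-e} (u 0)" using sol_continuous_on[OF u(1)] by simp
  then obtain t0 where t0: "t0 \<in> {a+e..b-e}" "\<And>t. t \<in> {a+e..b-e} \<Longrightarrow> u 0 t0 \<le> u 0 t"
    using continuous_attains_inf[of "{a+e..b-e}" "u 0"] e by auto
  have ut0: "u 0 t0 > 0" using up(1)[of t0] t0(1) e by auto
  obtain C where C: "C > 0" "\<And>t. t \<in> {a..b} \<Longrightarrow> \<bar>g 0 t\<bar> \<le> C" using sol_bounded_on[OF g(1)] by blast
  define \<delta> where "\<delta> = min \<delta>0 (u 0 t0 / C)"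
  have \<delta>: "\<delta> > 0" "\<delta> \<le> \<delta>0" "\<delta> * C \<le> u 0 t0" using \<delta>0 ut0 C by (auto simp: \<delta>_def min_def field_simps)
  have "\<delta> * g 0 t \<le> u 0 t" if t: "t \<in> {a..b}" for t
  proof -
    consider "t = a \<or> t = b" | "t \<in> {a<..<a+e1} \<or> t \<in> {b-e2<..<b}" "t \<in> {a<..<b}" | "t \<in> {a+e..b-e}"
      using t e by force
    then show ?thesis
    proof cases
      case 1
      then show ?thesis using u g k by (auto simp: vanishes_def)
    next
      case 2
      then have "\<delta> * g 0 t \<le> \<delta>0 * g 0 t" using gp(1)[of t] \<delta>(2) by (intro mult_right_mono) auto
      then show ?thesis using near_a[of t] near_b[of t] 2 by linarith
    next
      case 3
      have "\<delta> * g 0 t \<le> \<delta> * C" using C(2)[OF t] \<delta>(1) by (intro mult_left_mono) auto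
      then show ?thesis using t0(2)[OF 3] \<delta>(3) by linarith
    qed
  qed
  then show ?thesis using \<delta>(1) by blast
qed

text \<open>Positivity of the inverse of \<open>\<sigma> T[M]\<close> under the boundary conditions
  of \<open>X_space n k a b\<close>, phrased for given solutions so that it does not presuppose
  solvability.\<close>

definition pos_inverse :: "real \<Rightarrow> real \<Rightarrow> nat \<Rightarrow> real \<Rightarrow> real \<Rightarrow> bool" where
  "pos_inverse \<sigma> M k a b \<longleftrightarrow> (\<forall>f u. sol M f u \<longrightarrow> vanishes u k a \<longrightarrow> vanishes u (n - k) b \<longrightarrow>
     (\<forall>t\<in>{a..b}. \<sigma> * f t \<ge> 0) \<longrightarrow> (\<forall>t\<in>{a..b}. u 0 t \<ge> 0))"

text \<open>If the solutions were unbounded, normalising them at \<open>a\<close> would send their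
  sources to \<open>0\<close>, and a limit would be an eigenfunction for some
  \<open>\<kappa> \<ge> 0\<close>. The bound is uniform in \<open>\<kappa>\<close>, so
  \<open>eigenvalue_exists\<close> can advance with a fixed step length.\<close>

lemma inverse_bounded:
  assumes ns: "\<And>\<kappa>. \<kappa> \<ge> 0 \<Longrightarrow> \<not> singular (M - \<sigma> * \<kappa>) k a b" and k: "k \<le> n" and ab: "a < b"
    and \<sigma>: "\<bar>\<sigma>\<bar> = 1" and \<Lambda>: "\<Lambda> \<ge> 0"
  shows "\<exists>\<rho>>0. \<forall>\<kappa> w t. 0 \<le> \<kappa> \<longrightarrow> \<kappa> \<le> \<Lambda> \<longrightarrow> sol (M - \<sigma> * \<kappa>) (\<lambda>_. \<sigma>) w \<longrightarrow>
    vanishes w k a \<longrightarrow> vanishes w (n - k) b \<longrightarrow> t \<in> {a..b} \<longrightarrow> \<bar>w 0 t\<bar> \<le> \<rho>"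
proof (rule ccontr)
  define P where "P \<rho> \<longleftrightarrow> (\<forall>\<kappa> w t. 0 \<le> \<kappa> \<longrightarrow> \<kappa> \<le> \<Lambda> \<longrightarrow> sol (M - \<sigma> * \<kappa>) (\<lambda>_. \<sigma>) w \<longrightarrow>
    vanishes w k a \<longrightarrow> vanishes w (n - k) b \<longrightarrow> t \<in> {a..b} \<longrightarrow> \<bar>w 0 t\<bar> \<le> \<rho>)" for \<rho>
  assume "\<not> ?thesis"
  then have "\<not> P \<rho>" if "\<rho> > 0" for \<rho> using that unfolding P_def[symmetric] by blast
  then have H: "\<exists>\<kappa> w t. 0 \<le> \<kappa> \<and> \<kappa> \<le> \<Lambda> \<and> sol (M - \<sigma> * \<kappa>) (\<lambda>_. \<sigma>) w \<and>
    vanishes w k a \<and> vanishes w (n - k) b \<and> t \<in> {a..b} \<and> \<bar>w 0 t\<bar> > \<rho>" if "\<rho> > 0" for \<rho>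
    using that unfolding P_def not_all not_imp not_le by blast
  define R where "R = \<bar>M\<bar> + \<Lambda>"
  define K where "K = exp (growth R * (b - a))"
  have R0: "growth R \<ge> 0" using \<Lambda> B_nonneg by (simp add: growth_def R_def)
  have "\<exists>\<kappa> V. 0 \<le> \<kappa> \<and> \<kappa> \<le> \<Lambda> \<and> vanishes V k a \<and> vanishes V (n - k) b \<and> energy V a = 1 \<and>
      (\<exists>c. \<bar>c\<bar> \<le> sqrt (inverse (real (Suc j))) \<and> sol (M - \<sigma> * \<kappa>) (\<lambda>_. c) V)" for j
  proof -
    \<comment> \<open>Gronwall gives \<open>(w 0 t)\<^sup>2 \<le> (energy w a + 1) * K\<close>, so
      exceeding this threshold means \<open>energy w a > j + 1\<close>.\<close>
    have "sqrt (K * (real j + 2)) > 0" by (simp add: K_def)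
    then obtain \<kappa> w t where w: "0 \<le> \<kappa>" "\<kappa> \<le> \<Lambda>" "sol (M - \<sigma> * \<kappa>) (\<lambda>_. \<sigma>) w"
      "vanishes w k a" "vanishes w (n - k) b" "t \<in> {a..b}" "\<bar>w 0 t\<bar> > sqrt (K * (real j + 2))"
      using H by blast
    have "energy w t + 1\<^sup>2 \<le> (energy w a + 1\<^sup>2) * exp (growth R * \<bar>t - a\<bar>)"
    proof (rule energy_growth[where x = a and y = b and M = "M - \<sigma> * \<kappa>"])
      show "(w i has_real_derivative w (Suc i) t) (at t within {a..b})" if "i < n" for i t
        using sol_deriv[OF w(3) that] has_field_derivative_at_within by blast
      show "\<bar>L (M - \<sigma> * \<kappa>) w t\<bar> \<le> 1" for t using \<sigma> by (simp add: sol_L[OF w(3)])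
      have "\<bar>\<sigma> * \<kappa>\<bar> \<le> \<Lambda>" using \<sigma> w(1,2) by (simp add: abs_mult)
      then show "\<bar>M - \<sigma> * \<kappa>\<bar> \<le> R" unfolding R_def by linarith
    qed (use w ab in auto)
    also have "\<dots> \<le> (energy w a + 1\<^sup>2) * K"
      unfolding K_def using w(6) R0 energy_nonneg[of w a] by (intro mult_left_mono) (auto intro!: mult_left_mono)
    finally have "(w 0 t)\<^sup>2 \<le> (energy w a + 1) * K"
      using component_le_energy[of 0 w t] order_pos by simp
    moreover have "(w 0 t)\<^sup>2 > K * (real j + 2)"
      using w(7) by (metis real_sqrt_abs real_sqrt_less_iff)
    ultimately have "K * (real j + 2) < K * (energy w a + 1)" by (simp add: mult.commute)
    then have E: "energy w a > real (Suc j)" by (simp add: K_def)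
    define V where "V i t = w i t / sqrt (energy w a)" for i t
    have "sol (M - \<sigma> * \<kappa>) (\<lambda>_. \<sigma> / sqrt (energy w a)) V"
      unfolding V_def[abs_def] by (rule sol_divide[OF w(3)])
    moreover have "inverse (energy w a) \<le> inverse (real (Suc j))" using E by (intro le_imp_inverse_le) auto
    then have "\<bar>\<sigma> / sqrt (energy w a)\<bar> \<le> sqrt (inverse (real (Suc j)))"
      using \<sigma> energy_nonneg[of w a]
      by (simp add: abs_divide real_sqrt_inverse[symmetric] inverse_eq_divide[symmetric])
    moreover have "energy V a = 1" unfolding V_def[abs_def] using E by (intro energy_normalize) simp
    moreover have "vanishes V k a" "vanishes V (n - k) b" using w by (auto simp: V_def vanishes_def)
    ultimately show ?thesis using w(1,2) by blast
  qed
  then obtain \<kappa>s Vs where V: "\<And>j. 0 \<le> \<kappa>s j \<and> \<kappa>s j \<le> \<Lambda> \<and> vanishes (Vs j) k a \<and> vanishes (Vs j) (n - k) b \<and>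
      energy (Vs j) a = 1 \<and> (\<exists>c. \<bar>c\<bar> \<le> sqrt (inverse (real (Suc j))) \<and> sol (M - \<sigma> * \<kappa>s j) (\<lambda>_. c) (Vs j))"
    by metis
  then obtain cs where cs: "\<And>j. \<bar>cs j\<bar> \<le> sqrt (inverse (real (Suc j)))"
    "\<And>j. sol (M - \<sigma> * \<kappa>s j) (\<lambda>_. cs j) (Vs j)" by metis
  have "\<bar>\<kappa>s j\<bar> \<le> \<Lambda>" for j using V[of j] by simp
  then obtain r0 l where r0: "strict_mono r0" "\<And>p. p < 1 \<Longrightarrow> (\<lambda>j. \<kappa>s (r0 j)) \<longlonglongrightarrow> l (p::nat)"
    using bounded_sequences_convergent_subsequence[of 1 "\<lambda>j p. \<kappa>s j" \<Lambda>] by blast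
  then have lim\<kappa>: "(\<lambda>j. \<kappa>s (r0 j)) \<longlonglongrightarrow> l 0" by simp
  then have Mlim: "(\<lambda>j. M - \<sigma> * \<kappa>s (r0 j)) \<longlonglongrightarrow> M - \<sigma> * l 0" by (intro tendsto_intros)
  have l0: "l 0 \<ge> 0" by (rule LIMSEQ_le_const[OF lim\<kappa>]) (use V in blast)
  have "(\<lambda>j. sqrt (inverse (real (Suc j)))) \<longlonglongrightarrow> sqrt 0"
    by (intro tendsto_real_sqrt LIMSEQ_inverse_real_of_nat)
  then have e0: "(\<lambda>j. sqrt (inverse (real (Suc (r0 j))))) \<longlonglongrightarrow> 0"
    using LIMSEQ_subseq_LIMSEQ[OF _ r0(1)] by (fastforce simp: o_def)
  have "\<exists>r U. strict_mono r \<and> hom (M - \<sigma> * l 0) U \<and> energy U a = 1 \<and>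
      (\<forall>i T t. i < n \<longrightarrow> (\<forall>j. T j \<in> {a..b}) \<longrightarrow> T \<longlonglongrightarrow> t \<longrightarrow> (\<lambda>j. Vs (r0 (r j)) i (T j)) \<longlonglongrightarrow> U i t)"
    by (rule sol_compactness[OF Mlim cs(2) _ e0]) (use ab V cs(1) in auto)
  then obtain r U where U: "hom (M - \<sigma> * l 0) U" "energy U a = 1"
    and conv: "\<And>i T t. i < n \<Longrightarrow> (\<And>j. T j \<in> {a..b}) \<Longrightarrow> T \<longlonglongrightarrow> t \<Longrightarrow> (\<lambda>j. Vs (r0 (r j)) i (T j)) \<longlonglongrightarrow> U i t"
    by blast
  have lim: "(\<lambda>j. Vs (r0 (r j)) i t) \<longlonglongrightarrow> U i t" if "i < n" "t \<in> {a..b}" for i t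
    by (rule conv[OF that(1), of "\<lambda>_. t"]) (use that in auto)
  have limit0: "U i t = 0" if "i < n" "t \<in> {a..b}" "\<And>j. Vs (r0 (r j)) i t = 0" for i t
    using lim[OF that(1,2)] that(3) by (simp add: LIMSEQ_const_iff)
  have "vanishes U k a" using limit0[of _ a] V ab k by (auto simp: vanishes_def)
  moreover have "vanishes U (n - k) b" using limit0[of _ b] V ab k by (auto simp: vanishes_def)
  moreover have "energy U a = 0" if "trivial U" using that by (simp add: energy_def trivial_def)
  then have "\<not> trivial U" using U(2) by auto
  ultimately show False using ns[OF l0] U(1) unfolding singular_def by blast
qed

text \<open>Evaluate at a minimum point of \<open>u\<close>: a negative minimum \<open>- m\<close> would force
  \<open>u \<ge> - m (\<mu> - \<kappa>) w > - m\<close>.\<close>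

lemma pos_inverse_step:
  assumes pos: "pos_inverse \<sigma> (M - \<sigma> * \<kappa>) k a b" and k: "1 \<le> k" "k < n" and ab: "a < b"
    and \<sigma>: "\<sigma> * \<sigma> = 1"
    and w: "sol (M - \<sigma> * \<kappa>) (\<lambda>_. \<sigma>) w" "vanishes w k a" "vanishes w (n - k) b"
    and \<rho>: "\<And>t. t \<in> {a..b} \<Longrightarrow> \<bar>w 0 t\<bar> \<le> \<rho>" and \<mu>: "\<kappa> \<le> \<mu>" "(\<mu> - \<kappa>) * \<rho> < 1"
  shows "pos_inverse \<sigma> (M - \<sigma> * \<mu>) k a b"
  unfolding pos_inverse_def
proof (intro allI impI)
  fix f u assume u: "sol (M - \<sigma> * \<mu>) f u" "vanishes u k a" "vanishes u (n - k) b"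
    and f: "\<forall>t\<in>{a..b}. 0 \<le> \<sigma> * f t"
  obtain t0 where t0: "t0 \<in> {a..b}" "\<And>t. t \<in> {a..b} \<Longrightarrow> u 0 t0 \<le> u 0 t"
    using continuous_attains_inf[of "{a..b}" "u 0"] sol_continuous_on[OF u(1)] ab by auto
  have "u 0 t0 \<ge> 0"
  proof (rule ccontr)
    assume neg: "\<not> u 0 t0 \<ge> 0"
    define m where "m = - u 0 t0"
    have m: "m > 0" using neg by (simp add: m_def)
    \<comment> \<open>At parameter \<open>\<kappa>\<close>, \<open>u\<close> has the extra source
      \<open>\<sigma> (\<mu> - \<kappa>) u\<close>. After multiplication by \<open>\<sigma>\<close>
      it is at least \<open>- m (\<mu> - \<kappa>)\<close>, and adding \<open>c w\<close>
      compensates it.\<close>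
    define c where "c = m * (\<mu> - \<kappa>)"
    define g where "g t = 1 * (f t + ((M - \<sigma> * \<kappa>) - (M - \<sigma> * \<mu>)) * u 0 t) + c * \<sigma>" for t
    have v: "sol (M - \<sigma> * \<kappa>) g (\<lambda>i t. 1 * u i t + c * w i t)"
      unfolding g_def[abs_def] by (rule sol_add[OF sol_shift[OF u(1)] w(1)])
    have vz: "vanishes (\<lambda>i t. 1 * u i t + c * w i t) k a" "vanishes (\<lambda>i t. 1 * u i t + c * w i t) (n - k) b"
      by (intro vanishes_combination u w)+
    have g0: "0 \<le> \<sigma> * g t" if t: "t \<in> {a..b}" for t
    proof -
      have eq: "\<sigma> * g t = \<sigma> * f t + (\<sigma> * \<sigma>) * ((\<mu> - \<kappa>) * (u 0 t + m))"
        by (simp add: g_def c_def algebra_simps)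
      have "u 0 t + m \<ge> 0" using t0(2)[OF t] by (simp add: m_def)
      then show ?thesis unfolding eq \<sigma> using f t \<mu>(1) by simp
    qed
    have "\<forall>t\<in>{a..b}. 0 \<le> 1 * u 0 t + c * w 0 t"
      using pos v vz g0 unfolding pos_inverse_def by blast
    then have "0 \<le> u 0 t0 + c * w 0 t0" using t0(1) by auto
    moreover have "c * w 0 t0 \<le> c * \<rho>"
      using \<rho>[OF t0(1)] m \<mu>(1) by (intro mult_left_mono) (auto simp: c_def)
    moreover have "c * \<rho> < m" using mult_strict_left_mono[OF \<mu>(2) m] by (simp add: c_def mult.assoc)
    ultimately show False by (simp add: m_def)
  qed
  then show "\<forall>t\<in>{a..b}. 0 \<le> u 0 t" using t0(2) by force
qed

text \<open>If there were no eigenvalue, the resolvent would stay positive for all \<open>\<kappa> \<ge> 0\<close>; but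
  \<open>K g \<ge> \<delta> g\<close> for the inverse \<open>K\<close> makes it blow up at \<open>\<kappa> = 1 / \<delta>\<close> at the latest.\<close>

lemma eigenvalue_exists:
  assumes d: "dis M a b" and ab: "a < b" and k: "1 \<le> k" "k < n" and \<sigma>: "\<sigma> = (-1) ^ (n - k)"
  shows "\<exists>\<kappa>>0. singular (M - \<sigma> * \<kappa>) k a b"
proof (rule ccontr)
  assume no: "\<not> ?thesis"
  have \<sigma>2: "\<sigma> * \<sigma> = 1" and \<sigma>1: "\<bar>\<sigma>\<bar> = 1" by (cases "even (n - k)"; simp add: \<sigma>)+
  have \<sigma>m: "\<sigma> * (\<sigma> * x) = x" for x using \<sigma>2 by (simp add: mult.assoc[symmetric])
  have ns0: "\<not> singular M k a b" using dis_nonsingular[OF d, of a b k] ab k by simp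
  have ns: "\<not> singular (M - \<sigma> * \<kappa>) k a b" if "\<kappa> \<ge> 0" for \<kappa>
    using no ns0 that by (cases "\<kappa> = 0") auto
  have pos0: "pos_inverse \<sigma> M k a b"
    unfolding pos_inverse_def
  proof (intro allI impI ballI)
    fix f u t assume "sol M f u" "vanishes u k a" "vanishes u (n - k) b"
      and f: "\<forall>t\<in>{a..b}. 0 \<le> \<sigma> * f t" and t: "t \<in> {a..b}"
    then show "0 \<le> u 0 t"
      using bvp_weak_sign[OF d ab k, of f u \<sigma> t] by (simp add: \<sigma>[symmetric] \<sigma>m)
  qed
  have pos: "pos_inverse \<sigma> (M - \<sigma> * \<Lambda>) k a b" if \<Lambda>: "\<Lambda> \<ge> 0" for \<Lambda>
  proof -
    obtain \<rho> where \<rho>: "\<rho> > 0" "\<And>\<kappa> w t. 0 \<le> \<kappa> \<Longrightarrow> \<kappa> \<le> \<Lambda> \<Longrightarrow> sol (M - \<sigma> * \<kappa>) (\<lambda>_. \<sigma>) w \<Longrightarrow>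
      vanishes w k a \<Longrightarrow> vanishes w (n - k) b \<Longrightarrow> t \<in> {a..b} \<Longrightarrow> \<bar>w 0 t\<bar> \<le> \<rho>"
      using inverse_bounded[OF ns _ ab \<sigma>1 \<Lambda>] k by (metis less_imp_le)
    \<comment> \<open>Each of \<open>N\<close> steps raises \<open>\<kappa>\<close> by
      \<open>\<Lambda> / N\<close>, and \<open>\<Lambda> * \<rho> / N < 1\<close> is what
      \<open>pos_inverse_step\<close> requires.\<close>
    obtain N :: nat where N: "\<Lambda> * \<rho> < N" using reals_Archimedean2 by blast
    have "\<Lambda> * \<rho> \<ge> 0" using \<Lambda> \<rho>(1) by simp
    then have N0: "real N > 0" using N by linarith
    have "pos_inverse \<sigma> (M - \<sigma> * (\<Lambda> * real i / N)) k a b" if "i \<le> N" for i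
      using that
    proof (induction i)
      case 0
      then show ?case using pos0 by simp
    next
      case (Suc i)
      define \<kappa> where "\<kappa> = \<Lambda> * real i / N"
      have \<kappa>: "0 \<le> \<kappa>" "\<kappa> \<le> \<Lambda>"
        using Suc.prems \<Lambda> N0 by (auto simp: \<kappa>_def divide_le_eq intro!: mult_left_mono)
      have "\<exists>w. sol (M - \<sigma> * \<kappa>) (\<lambda>_. \<sigma>) w \<and> vanishes w k a \<and> vanishes w (n - k) b"
        by (rule bvp_exists[where C = 1]) (use ns[OF \<kappa>(1)] k \<sigma>1 in auto)
      then obtain w where w: "sol (M - \<sigma> * \<kappa>) (\<lambda>_. \<sigma>) w" "vanishes w k a" "vanishes w (n - k) b" by blast
      have step: "\<Lambda> * real (Suc i) / N - \<kappa> = \<Lambda> / N" by (simp add: \<kappa>_def field_simps diff_divide_distrib[symmetric])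
      show ?case
      proof (rule pos_inverse_step[OF _ k ab \<sigma>2 w])
        show "pos_inverse \<sigma> (M - \<sigma> * \<kappa>) k a b" using Suc by (simp add: \<kappa>_def)
        show "\<bar>w 0 t\<bar> \<le> \<rho>" if "t \<in> {a..b}" for t by (rule \<rho>(2)[OF \<kappa> w that])
        have "\<Lambda> / N \<ge> 0" using \<Lambda> by simp
        then show "\<kappa> \<le> \<Lambda> * real (Suc i) / N" using step by linarith
        show "(\<Lambda> * real (Suc i) / N - \<kappa>) * \<rho> < 1"
          unfolding step using N N0 by (simp add: divide_less_eq)
      qed
    qed
    from this[of N] show ?thesis using N0 by simp
  qed
  have "\<exists>g. sol M (\<lambda>_. \<sigma>) g \<and> vanishes g k a \<and> vanishes g (n - k) b"
    by (rule bvp_exists[where C = 1]) (use ns0 k \<sigma>1 in auto)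
  then obtain g where g: "sol M (\<lambda>_. \<sigma>) g" "vanishes g k a" "vanishes g (n - k) b" by blast
  have \<sigma>0: "\<sigma> \<noteq> 0" using \<sigma>2 by auto
  have hp: "0 \<le> \<sigma> * \<sigma>" using \<sigma>2 by simp
  note gpos = bvp_positive[OF d ab k \<sigma> g hp \<sigma>0]
  have g0: "g 0 t \<ge> 0" if "t \<in> {a..b}" for t
    using gpos(1)[of t] g(2,3) k that by (cases "t = a \<or> t = b") (auto simp: vanishes_def less_imp_le)
  \<comment> \<open>With \<open>K\<close> the inverse of \<open>\<sigma> T[M]\<close>,
    \<open>g = K 1\<close>, and the source \<open>h\<close> makes \<open>u = K g\<close>. Freezing
    it outside \<open>[a, b]\<close> keeps it bounded.\<close>
  define h where "h t = \<sigma> * g 0 (max a (min t b))" for t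
  have hg: "h t = \<sigma> * g 0 t" if "t \<in> {a..b}" for t using that by (simp add: h_def)
  have hc: "continuous_on UNIV h" unfolding h_def[abs_def]
    by (intro continuous_on_mult_left continuous_on_compose2[OF sol_continuous_on[OF g(1), of 0 UNIV]]
        continuous_intros) auto
  obtain C where C: "C > 0" "\<And>t. t \<in> {a..b} \<Longrightarrow> \<bar>g 0 t\<bar> \<le> C" using sol_bounded_on[OF g(1)] by blast
  have hC: "\<bar>h t\<bar> \<le> C" for t using C(2)[of "max a (min t b)"] \<sigma>1 ab by (simp add: h_def abs_mult)
  have "\<exists>u. sol M h u \<and> vanishes u k a \<and> vanishes u (n - k) b"
    by (rule bvp_exists[OF ns0 _ hc hC]) (use k in simp)
  then obtain u where u: "sol M h u" "vanishes u k a" "vanishes u (n - k) b" by blast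
  have h1: "\<sigma> * h t \<ge> 0" if "t \<in> {a..b}" for t using g0[OF that] hg[OF that] by (simp add: \<sigma>m)
  have h2: "h t \<noteq> 0" if "t \<in> {a<..<b}" for t using gpos(1)[OF that] hg[of t] that \<sigma>0 by auto
  have upos: "u 0 t > 0" if "t \<in> {a<..<b}" for t
    by (rule bvp_positive(1)[OF d ab k \<sigma> u h1 h2 that])
  obtain \<delta> where \<delta>: "\<delta> > 0" "\<And>t. t \<in> {a..b} \<Longrightarrow> \<delta> * g 0 t \<le> u 0 t"
    using bvp_domination[OF d ab k \<sigma> u h1 h2 g hp \<sigma>0] by blast
  define \<Lambda> where "\<Lambda> = 1 / \<delta>"
  have \<Lambda>: "\<Lambda> > 0" "\<Lambda> * \<delta> = 1" using \<delta>(1) by (auto simp: \<Lambda>_def)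
  have "\<exists>w. sol (M - \<sigma> * \<Lambda>) h w \<and> vanishes w k a \<and> vanishes w (n - k) b"
    by (rule bvp_exists[OF ns _ hc hC]) (use k \<Lambda> in auto)
  then obtain w where w: "sol (M - \<sigma> * \<Lambda>) h w" "vanishes w k a" "vanishes w (n - k) b" by blast
  have wM: "sol M (\<lambda>t. h t + (M - (M - \<sigma> * \<Lambda>)) * w 0 t) w" by (rule sol_shift[OF w(1)])
  \<comment> \<open>Formally \<open>w = K (g + \<Lambda> w)\<close>. If \<open>w \<ge> j u\<close>,
    then \<open>\<Lambda> w \<ge> j \<Lambda> \<delta> g = j g\<close>, hence
    \<open>w \<ge> (j + 1) K g = (j + 1) u\<close>.\<close>
  have grow: "real j * u 0 t \<le> w 0 t" if "t \<in> {a..b}" for j t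
    using that
  proof (induction j arbitrary: t)
    case 0
    then show ?case using pos[of \<Lambda>] \<Lambda>(1) w h1 unfolding pos_inverse_def by force
  next
    case (Suc j)
    define f where "f t = 1 * (h t + (M - (M - \<sigma> * \<Lambda>)) * w 0 t) + (- real (Suc j)) * h t" for t
    have v: "sol M f (\<lambda>i t. 1 * w i t + (- real (Suc j)) * u i t)"
      unfolding f_def[abs_def] by (rule sol_add[OF wM u(1)])
    have vz: "vanishes (\<lambda>i t. 1 * w i t + (- real (Suc j)) * u i t) k a"
      "vanishes (\<lambda>i t. 1 * w i t + (- real (Suc j)) * u i t) (n - k) b"
      by (intro vanishes_combination u w)+
    have f0: "0 \<le> \<sigma> * f t" if t: "t \<in> {a..b}" for t
    proof -
      have "real j * (\<delta> * g 0 t) \<le> real j * u 0 t" using \<delta>(2)[OF t] by (intro mult_left_mono) auto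
      also have "\<dots> \<le> w 0 t" by (rule Suc.IH[OF t])
      finally have "\<Lambda> * (real j * (\<delta> * g 0 t)) \<le> \<Lambda> * w 0 t" using \<Lambda>(1) by (intro mult_left_mono) auto
      moreover have "\<Lambda> * (real j * (\<delta> * g 0 t)) = (\<Lambda> * \<delta>) * (real j * g 0 t)" by (simp only: ac_simps)
      ultimately have "0 \<le> \<Lambda> * w 0 t - real j * g 0 t" unfolding \<Lambda>(2) by simp
      moreover have "\<sigma> * f t = (\<sigma> * \<sigma>) * (\<Lambda> * w 0 t - real j * g 0 t)"
        unfolding f_def hg[OF t] by (simp add: algebra_simps)
      ultimately show ?thesis unfolding \<sigma>2 by simp
    qed
    have "\<forall>t\<in>{a..b}. 0 \<le> 1 * w 0 t + (- real (Suc j)) * u 0 t"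
      using pos0 v vz f0 unfolding pos_inverse_def by blast
    then show ?case using Suc.prems by (auto simp: algebra_simps)
  qed
  define x where "x = (a + b) / 2"
  have x: "x \<in> {a<..<b}" using ab by (auto simp: x_def)
  have "u 0 x > 0" by (rule upos[OF x])
  then obtain j where "w 0 x < real j * u 0 x" using reals_Archimedean3 by blast
  then show False using grow[of x j] x by auto
qed

text \<open>By \<open>singular_limit\<close> the infimum is again an eigenvalue up to sign, unless
  it is \<open>0\<close>, which disconjugacy at \<open>M\<close> excludes.\<close>

lemma least_eigenvalue_exists:
  assumes d: "dis M a b" and ab: "a < b" and k: "1 \<le> k" "k < n" and \<sigma>: "\<sigma> = (-1) ^ (n - k)"
  shows "\<exists>\<kappa>>0. singular (M - \<sigma> * \<kappa>) k a b \<and> (\<forall>\<mu>>0. singular (M - \<sigma> * \<mu>) k a b \<longrightarrow> \<kappa> \<le> \<mu>)"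
proof -
  define A where "A = {\<kappa>. \<kappa> > 0 \<and> singular (M - \<sigma> * \<kappa>) k a b}"
  have A: "A \<noteq> {}" "bdd_below A"
    using eigenvalue_exists[OF assms] by (auto simp: A_def intro!: bdd_belowI[of _ 0])
  then have "Inf A \<in> closure A" by (rule closure_contains_Inf)
  then obtain \<kappa>s where \<kappa>s: "\<And>j. \<kappa>s j \<in> A" "\<kappa>s \<longlonglongrightarrow> Inf A" unfolding closure_sequential by blast
  have lim: "(\<lambda>j. M - \<sigma> * \<kappa>s j) \<longlonglongrightarrow> M - \<sigma> * Inf A" by (intro tendsto_intros \<kappa>s(2))
  have "a < b \<and> singular (M - \<sigma> * Inf A) k a b"
    by (rule singular_limit[OF lim tendsto_const tendsto_const ab]) (use \<kappa>s(1) k in \<open>auto simp: A_def\<close>)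
  moreover have "Inf A \<ge> 0" using A by (intro cInf_greatest) (auto simp: A_def)
  moreover have "Inf A \<noteq> 0"
    using calculation(1) dis_nonsingular[OF d, of a b k] ab k by auto
  moreover have "Inf A \<le> \<mu>" if "\<mu> > 0" "singular (M - \<sigma> * \<mu>) k a b" for \<mu>
    using that A by (intro cInf_lower) (auto simp: A_def)
  ultimately show ?thesis by (intro exI[of _ "Inf A"]) auto
qed

text \<open>\<open>\<tau> = 1\<close> treats the parameters below \<open>M\<close>,
  \<open>\<tau> = -1\<close> those above; on each side only the \<open>k\<close> of one parity
  matter.\<close>

lemma dis_iff_no_eigenvalue:
  assumes d: "dis M a b" and ab: "a < b" and \<tau>: "\<tau> = 1 \<or> \<tau> = -1" and \<kappa>: "\<kappa> \<ge> 0"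
  shows "dis (M - \<tau> * \<kappa>) a b \<longleftrightarrow>
    (\<forall>k \<beta>. 1 \<le> k \<longrightarrow> k < n \<longrightarrow> (-1) ^ (n - k) = \<tau> \<longrightarrow> 0 < \<beta> \<longrightarrow> \<beta> \<le> \<kappa> \<longrightarrow> \<not> singular (M - \<tau> * \<beta>) k a b)"
proof
  assume "dis (M - \<tau> * \<kappa>) a b"
  then show "\<forall>k \<beta>. 1 \<le> k \<longrightarrow> k < n \<longrightarrow> (-1) ^ (n - k) = \<tau> \<longrightarrow> 0 < \<beta> \<longrightarrow> \<beta> \<le> \<kappa> \<longrightarrow> \<not> singular (M - \<tau> * \<beta>) k a b"
    using no_eigenvalue_between[OF d _ ab] by blast
next
  assume no: "\<forall>k \<beta>. 1 \<le> k \<longrightarrow> k < n \<longrightarrow> (-1) ^ (n - k) = \<tau> \<longrightarrow> 0 < \<beta> \<longrightarrow> \<beta> \<le> \<kappa> \<longrightarrow> \<not> singular (M - \<tau> * \<beta>) k a b"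
  show "dis (M - \<tau> * \<kappa>) a b"
  proof (rule ccontr)
    assume nd: "\<not> dis (M - \<tau> * \<kappa>) a b"
    define A where "A = {\<mu>. \<mu> \<ge> 0 \<and> \<not> dis (M - \<tau> * \<mu>) a b}"
    have A: "\<kappa> \<in> A" "bdd_below A" using nd \<kappa> by (auto simp: A_def intro!: bdd_belowI[of _ 0])
    then have "Inf A \<in> closure A" by (intro closure_contains_Inf) auto
    then obtain \<kappa>s where \<kappa>s: "\<And>j. \<kappa>s j \<in> A" "\<kappa>s \<longlonglongrightarrow> Inf A" unfolding closure_sequential by blast
    have lim: "(\<lambda>j. M - \<tau> * \<kappa>s j) \<longlonglongrightarrow> M - \<tau> * Inf A" by (intro tendsto_intros \<kappa>s(2))
    have ndi: "\<not> dis (M - \<tau> * Inf A) a b"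
      by (rule not_dis_limit[OF lim _ ab]) (use \<kappa>s(1) in \<open>auto simp: A_def\<close>)
    have "Inf A \<ge> 0" using A by (intro cInf_greatest) (auto simp: A_def)
    moreover have "Inf A \<noteq> 0" using ndi d by auto
    ultimately have i0: "Inf A > 0" by simp
    have below: "dis (M - \<tau> * \<mu>) a b" if "0 \<le> \<mu>" "\<mu> < Inf A" for \<mu>
      using cInf_lower[OF _ A(2), of \<mu>] that by (auto simp: A_def)
    have "Inf A \<le> \<kappa>" using A by (intro cInf_lower)
    then show False using boundary_eigenvalue[OF below \<tau> i0 ab ndi] no i0 by blast
  qed
qed

end

section \<open>Classical solutions on the interval\<close>

lemma nth_deriv_0 [simp]: "nth_deriv I 0 u = u"
  by (simp add: nth_deriv_def)

lemma nth_deriv_Suc: "nth_deriv I (Suc j) u t = vector_derivative (nth_deriv I j u) (at t within I)"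
  by (simp add: nth_deriv_def)

lemma C_space_derivative:
  assumes "u \<in> C_space m I" "i < m" "t \<in> I"
  shows "(nth_deriv I i u has_real_derivative nth_deriv I (Suc i) u t) (at t within I)"
proof -
  have "nth_deriv I i u differentiable (at t within I)"
    using assms by (auto simp: C_space_def differentiable_on_def)
  then show ?thesis
    by (simp add: nth_deriv_Suc has_real_derivative_iff_has_vector_derivative vector_derivative_works)
qed

lemma C_space_continuous_on:
  assumes "u \<in> C_space m I"
  shows "continuous_on I u"
proof (cases "m = 0")
  case True
  then show ?thesis using assms by (simp add: C_space_def)
next
  case False
  then have "u differentiable_on I" using assms by (force simp: C_space_def)
  then show ?thesis by (rule differentiable_imp_continuous_on)
qed

text \<open>Ties the iterated one-sided derivatives to a given chain; \<open>a < b\<close> makes the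
  derivative within \<open>{a..b}\<close> unique at the endpoints.\<close>

lemma nth_deriv_chain:
  assumes ab: "a < b"
    and d: "\<And>i t. i < m \<Longrightarrow> t \<in> {a..b} \<Longrightarrow> (U i has_real_derivative U (Suc i) t) (at t within {a..b})"
    and u: "\<And>t. t \<in> {a..b} \<Longrightarrow> u t = U 0 t"
    and "j \<le> m" "t \<in> {a..b}"
  shows "nth_deriv {a..b} j u t = U j t"
    and "j < m \<Longrightarrow> (nth_deriv {a..b} j u has_real_derivative U (Suc j) t) (at t within {a..b})"
proof -
  have step: "(nth_deriv {a..b} j u has_real_derivative U (Suc j) t) (at t within {a..b})"
    if "j < m" "t \<in> {a..b}" "\<And>s. s \<in> {a..b} \<Longrightarrow> nth_deriv {a..b} j u s = U j s" for j t
    by (rule has_field_derivative_transform_within[OF d[OF that(1,2)], of 1]) (use that in auto)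
  have eq: "nth_deriv {a..b} j u t = U j t" if "j \<le> m" "t \<in> {a..b}" for j t
    using that
  proof (induction j arbitrary: t)
    case 0
    then show ?case using u by simp
  next
    case (Suc j)
    have "(nth_deriv {a..b} j u has_vector_derivative U (Suc j) t) (at t within {a..b})"
      using step[of j t] Suc by (simp add: has_real_derivative_iff_has_vector_derivative)
    then show ?case
      unfolding nth_deriv_Suc using Suc.prems ab
      by (intro vector_derivative_within_cbox[of a b, unfolded cbox_interval]) auto
  qed
  then show "nth_deriv {a..b} j u t = U j t" using assms by blast
  show "(nth_deriv {a..b} j u has_real_derivative U (Suc j) t) (at t within {a..b})" if "j < m"
    using step[OF that \<open>t \<in> {a..b}\<close>] eq that by simp
qed

lemma T_op_shift: "T_op n c I M u t = l * u t \<longleftrightarrow> T_op n c I (M - l) u t = 0"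
  by (auto simp: T_op_def algebra_simps)

section \<open>Transfer between the interval and the line\<close>

locale interval_ode =
  fixes n :: nat and a b :: real and c :: "nat \<Rightarrow> real \<Rightarrow> real"
  assumes n2: "n \<ge> 2" and ab: "a < b"
    and coeff: "\<And>i. i \<in> {1..n} \<Longrightarrow> continuous_on {a..b} (c i)"
begin

text \<open>The coefficients are extended by constants, so that solutions live on the whole line.\<close>

definition p :: "nat \<Rightarrow> real \<Rightarrow> real" where
  "p i t = c (n - i) (max a (min t b))"

lemma coefficients_bounded: "\<exists>B. \<forall>i<n. \<forall>t. \<bar>p i t\<bar> \<le> B"
proof -
  have "\<exists>B. \<forall>t\<in>{a..b}. \<bar>c i t\<bar> \<le> B" if "i \<in> {1..n}" for i
  proof -
    have "bounded (c i ` {a..b})"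
      by (intro compact_imp_bounded compact_continuous_image coeff that) simp
    then show ?thesis by (auto simp: bounded_iff)
  qed
  then obtain B where B: "\<And>i t. i \<in> {1..n} \<Longrightarrow> t \<in> {a..b} \<Longrightarrow> \<bar>c i t\<bar> \<le> B i" by metis
  have "\<bar>p i t\<bar> \<le> (\<Sum>j=1..n. \<bar>B j\<bar>)" if "i < n" for i t
  proof -
    have i: "n - i \<in> {1..n}" using that by simp
    have "\<bar>p i t\<bar> \<le> B (n - i)" unfolding p_def using i ab by (intro B) auto
    also have "\<dots> \<le> \<bar>B (n - i)\<bar>" by simp
    also have "\<dots> \<le> (\<Sum>j=1..n. \<bar>B j\<bar>)" using i by (intro member_le_sum) auto
    finally show ?thesis .
  qed
  then show ?thesis by blast
qed

sublocale linear_ode n p "SOME B. \<forall>i<n. \<forall>t. \<bar>p i t\<bar> \<le> B"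
proof
  show "1 \<le> n" using n2 by simp
  show "continuous_on UNIV (p i)" if "i < n" for i
    unfolding p_def[abs_def]
    by (rule continuous_on_compose2[OF coeff, of "n - i"]) (use that ab in \<open>auto intro!: continuous_intros\<close>)
  show "\<bar>p i t\<bar> \<le> (SOME B. \<forall>i<n. \<forall>t. \<bar>p i t\<bar> \<le> B)" if "i < n" for i t
    using someI_ex[OF coefficients_bounded] that by blast
qed

abbreviation T :: "real \<Rightarrow> (real \<Rightarrow> real) \<Rightarrow> real \<Rightarrow> real" where
  "T \<equiv> T_op n c {a..b}"

lemma T_eq_L:
  assumes t: "t \<in> {a..b}" and u: "\<And>j. j \<le> n \<Longrightarrow> nth_deriv {a..b} j u t = U j t"
  shows "T M u t = L M U t"
proof -
  have pt: "p i t = c (n - i) t" for i using t by (simp add: p_def)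
  have "(\<Sum>i<n. p i t * U i t) = p 0 t * U 0 t + (\<Sum>i\<in>{..<n} - {0}. p i t * U i t)"
    using n2 sum.remove[of "{..<n}" 0 "\<lambda>i. p i t * U i t"] by simp
  also have "{..<n} - {0} = {1..n-1}" by auto
  also have "(\<Sum>i=1..n-1. p i t * U i t) = (\<Sum>i=1..n-1. p (n - i) t * U (n - i) t)"
    by (rule sum.reindex_bij_witness[of _ "\<lambda>i. n - i" "\<lambda>i. n - i"]) auto
  also have "\<dots> = (\<Sum>i=1..n-1. c i t * nth_deriv {a..b} (n - i) u t)"
    using u by (intro sum.cong) (auto simp: pt)
  finally have "(\<Sum>i<n. p i t * U i t) =
    c n t * U 0 t + (\<Sum>i=1..n-1. c i t * nth_deriv {a..b} (n - i) u t)" by (simp add: pt)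
  then show ?thesis using u[of 0] u[of n] by (simp add: T_op_def L_def algebra_simps)
qed

lemma hom_nth_deriv:
  assumes "hom M U" "j \<le> n" "t \<in> {a..b}"
  shows "nth_deriv {a..b} j (U 0) t = U j t"
  by (rule nth_deriv_chain(1)[OF ab, where m = n])
    (use assms sol_deriv[OF assms(1)] has_field_derivative_at_within in blast)+

lemma hom_classical:
  assumes U: "hom M U"
  shows "U 0 \<in> C_space n {a..b}" and "\<And>t. t \<in> {a..b} \<Longrightarrow> T M (U 0) t = 0"
proof -
  have eq: "nth_deriv {a..b} j (U 0) t = U j t" if "j \<le> n" "t \<in> {a..b}" for j t
    by (rule hom_nth_deriv[OF U that])
  have dU: "(U i has_real_derivative U (Suc i) t) (at t within {a..b})" if "i < n" for i t
    by (rule has_field_derivative_at_within[OF sol_deriv[OF U that]])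
  have "(nth_deriv {a..b} j (U 0) has_real_derivative U (Suc j) t) (at t within {a..b})"
    if "j < n" "t \<in> {a..b}" for j t
    by (rule nth_deriv_chain(2)[OF ab, where m = n]) (use that dU in auto)
  then have "nth_deriv {a..b} j (U 0) differentiable_on {a..b}" if "j < n" for j
    using that unfolding differentiable_on_def real_differentiable_def by blast
  moreover have "continuous_on {a..b} (nth_deriv {a..b} n (U 0))"
    by (rule continuous_on_eq[OF sol_continuous_on[OF U order.refl]]) (simp add: eq)
  ultimately show "U 0 \<in> C_space n {a..b}" by (simp add: C_space_def)
  show "T M (U 0) t = 0" if "t \<in> {a..b}" for t
  proof -
    have "T M (U 0) t = L M U t" by (rule T_eq_L[OF that]) (rule eq[OF _ that])
    then show ?thesis using sol_L[OF U] by simp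
  qed
qed

text \<open>The solution on the line with the same initial values at \<open>a\<close> extends
  \<open>u\<close>: the difference has only one-sided derivatives at the endpoints, which is all
  that \<open>sol_zero_on\<close> asks for.\<close>

lemma classical_hom:
  assumes u: "u \<in> C_space n {a..b}" "\<And>t. t \<in> {a..b} \<Longrightarrow> T M u t = 0"
  shows "\<exists>U. hom M U \<and> (\<forall>j\<le>n. \<forall>t\<in>{a..b}. nth_deriv {a..b} j u t = U j t)"
proof -
  define V where "V j = nth_deriv {a..b} j u" for j
  obtain U where U: "hom M U" "\<And>i. i < n \<Longrightarrow> U i a = V i a"
    using sol_exists[of "\<lambda>_. 0" 0 M a "\<lambda>i. V i a"] by auto
  define D where "D j t = 1 * V j t + (-1) * U j t" for j t
  have "D j t = 0" if "j \<le> n" "t \<in> {a..b}" for j t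
  proof (rule sol_zero_on[where x = a and y = b and s = a and M = M, OF _ _ _ _ that(2,1)])
    show "(D i has_real_derivative D (Suc i) t) (at t within {a..b})" if "i < n" "t \<in> {a..b}" for i t
      unfolding D_def[abs_def] V_def
      by (intro DERIV_add DERIV_cmult C_space_derivative[OF u(1) that]
          has_field_derivative_at_within[OF sol_deriv[OF U(1) that(1)]])
    show "L M D t = 0" if "t \<in> {a..b}" for t
    proof -
      have "T M u t = L M V t" by (rule T_eq_L[OF that]) (simp add: V_def)
      then show ?thesis unfolding D_def[abs_def] L_add using u(2)[OF that] sol_L[OF U(1), of t] by simp
    qed
  qed (use ab U(2) in \<open>auto simp: D_def\<close>)
  then show ?thesis using U(1) by (intro exI[of _ U]) (auto simp: D_def V_def)
qed

lemma multiplicity_properties: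
  assumes U: "hom M U" "\<not> trivial U" and t: "t \<in> {a..b}"
    and u: "\<And>j. j \<le> n \<Longrightarrow> nth_deriv {a..b} j u t = U j t"
  shows "zero_multiplicity {a..b} u t < n" and "U (zero_multiplicity {a..b} u t) t \<noteq> 0"
    and "\<And>i. i < zero_multiplicity {a..b} u t \<Longrightarrow> U i t = 0"
proof -
  define m where "m = zero_multiplicity {a..b} u t"
  have "\<not> vanishes U n t" using hom_trivial[OF U(1)] U(2) by blast
  then obtain i where i: "i < n" "U i t \<noteq> 0" by (auto simp: vanishes_def)
  then have "nth_deriv {a..b} i u t \<noteq> 0" using u[of i] by simp
  then have m: "nth_deriv {a..b} m u t \<noteq> 0" "m \<le> i"
    unfolding m_def zero_multiplicity_def by (rule LeastI, rule Least_le)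
  then show mn: "m < n" using i by simp
  then show "U m t \<noteq> 0" using u[of m] m by simp
  show "U j t = 0" if "j < m" for j
    using not_less_Least[OF that[unfolded m_def zero_multiplicity_def]] u[of j] that mn by simp
qed

lemma disconjugate_iff_dis: "disconjugate n (T M) {a..b} \<longleftrightarrow> dis M a b"
proof
  assume D: "disconjugate n (T M) {a..b}"
  show "dis M a b"
    unfolding dis_def
  proof (intro allI impI, elim conjE, rule ccontr)
    fix U \<mu> assume U: "hom M U" and z: "has_zeros U \<mu> {a..b}" "n \<le> zero_count \<mu>" and nt: "\<not> trivial U"
    define Z where "Z = {t \<in> {a..b}. U 0 t = 0}"
    have "\<exists>t\<in>{a..b}. U 0 t \<noteq> 0" using hom_zero_on_interval[OF U ab] nt by force
    then have Z: "finite Z" "(\<Sum>t\<in>Z. zero_multiplicity {a..b} (U 0) t) \<le> n - 1"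
      using D hom_classical[OF U] unfolding disconjugate_def Z_def by blast+
    have sub: "{t. \<mu> t > 0} \<subseteq> Z" using z(1) by (auto simp: has_zeros_def Z_def)
    have "\<mu> t \<le> zero_multiplicity {a..b} (U 0) t" if "t \<in> {t. \<mu> t > 0}" for t
    proof -
      have t: "t \<in> {a..b}" using that z(1) by (auto simp: has_zeros_def)
      then have "U (zero_multiplicity {a..b} (U 0) t) t \<noteq> 0"
        using multiplicity_properties(2)[OF U nt t hom_nth_deriv[OF U _ t]] by blast
      then show ?thesis using z(1) unfolding has_zeros_def by (meson not_le)
    qed
    then have "zero_count \<mu> \<le> (\<Sum>t | \<mu> t > 0. zero_multiplicity {a..b} (U 0) t)"
      unfolding zero_count_def by (intro sum_mono)
    also have "\<dots> \<le> (\<Sum>t\<in>Z. zero_multiplicity {a..b} (U 0) t)" using Z(1) sub by (intro sum_mono2) auto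
    finally show False using z(2) Z(2) n2 by linarith
  qed
next
  assume D: "dis M a b"
  show "disconjugate n (T M) {a..b}"
    unfolding disconjugate_def
  proof (intro ballI impI, elim conjE)
    fix u assume u: "u \<in> C_space n {a..b}" "\<forall>t\<in>{a..b}. T M u t = 0" "\<exists>t\<in>{a..b}. u t \<noteq> 0"
    obtain U where U: "hom M U" and eq: "\<And>j t. j \<le> n \<Longrightarrow> t \<in> {a..b} \<Longrightarrow> nth_deriv {a..b} j u t = U j t"
      using classical_hom[OF u(1), of M] u(2) by blast
    have u0: "u t = U 0 t" if "t \<in> {a..b}" for t using eq[of 0 t] that by simp
    have nt: "\<not> trivial U" using u(3) u0 by (auto simp: trivial_def)
    define z where "z t = zero_multiplicity {a..b} u t" for t
    note zp = multiplicity_properties[OF U nt _ eq, folded z_def]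
    have zpos: "z t \<ge> 1" if "t \<in> {a..b}" "u t = 0" for t
    proof (rule ccontr)
      assume "\<not> z t \<ge> 1"
      then have "z t = 0" by simp
      then show False using zp(2)[OF that(1)] that u0 by simp
    qed
    \<comment> \<open>Stated for finite subsets, since finiteness of the zero set is derived from
      it: \<open>n\<close> distinct zeros would already be too many.\<close>
    have bound: "(\<Sum>t\<in>Z. z t) \<le> n - 1" if Z: "finite Z" "Z \<subseteq> {t\<in>{a..b}. u t = 0}" for Z
    proof (rule ccontr)
      assume neg: "\<not> (\<Sum>t\<in>Z. z t) \<le> n - 1"
      define \<mu> where "\<mu> t = (if t \<in> Z then z t else 0)" for t
      have sub: "{t. \<mu> t > 0} \<subseteq> Z" by (auto simp: \<mu>_def)
      have "has_zeros U \<mu> {a..b}" unfolding has_zeros_def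
        using finite_subset[OF sub Z(1)] sub Z zp(3) by (auto simp: \<mu>_def)
      moreover have "zero_count \<mu> = (\<Sum>t\<in>Z. z t)"
        unfolding zero_count_superset[OF Z(1) sub] by (simp add: \<mu>_def)
      moreover from this have "n \<le> zero_count \<mu>" using neg n2 by linarith
      ultimately show False using D U nt unfolding dis_def by blast
    qed
    have fin: "finite {t\<in>{a..b}. u t = 0}"
    proof (rule ccontr)
      assume "infinite {t\<in>{a..b}. u t = 0}"
      then obtain Z where Z: "finite Z" "card Z = n" "Z \<subseteq> {t\<in>{a..b}. u t = 0}"
        using infinite_arbitrarily_large by blast
      have "card Z \<le> (\<Sum>t\<in>Z. z t)"
        unfolding card_eq_sum using Z zpos by (intro sum_mono) auto
      then show False using bound[OF Z(1,3)] Z(2) n2 by linarith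
    qed
    then show "finite {t\<in>{a..b}. u t = 0} \<and>
        (\<Sum>t | t \<in> {a..b} \<and> u t = 0. zero_multiplicity {a..b} u t) \<le> n - 1"
      using bound[OF fin] by (simp add: z_def)
  qed
qed

lemma eigenvalue_iff_singular:
  assumes k: "1 \<le> k" "k < n"
  shows "eigenvalue_in (T M) {a..b} (X_space n k a b) l \<longleftrightarrow> singular (M - l) k a b"
proof
  assume "eigenvalue_in (T M) {a..b} (X_space n k a b) l"
  then obtain u where u: "u \<in> X_space n k a b" "\<exists>t\<in>{a..b}. u t \<noteq> 0" "\<forall>t\<in>{a..b}. T (M - l) u t = 0"
    unfolding eigenvalue_in_def T_op_shift by blast
  then obtain U where U: "hom (M - l) U"
    and eq: "\<And>j t. j \<le> n \<Longrightarrow> t \<in> {a..b} \<Longrightarrow> nth_deriv {a..b} j u t = U j t"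
    using classical_hom[of u "M - l"] by (auto simp: X_space_def)
  have "\<not> trivial U" using u(2) eq[of 0] by (auto simp: trivial_def)
  moreover have "vanishes U k a" "vanishes U (n - k) b"
    using u(1) eq ab k by (auto simp: vanishes_def X_space_def)
  ultimately show "singular (M - l) k a b" using U by (auto simp: singular_def)
next
  assume "singular (M - l) k a b"
  then obtain U where U: "hom (M - l) U" "\<not> trivial U" "vanishes U k a" "vanishes U (n - k) b"
    by (auto simp: singular_def)
  have "\<exists>t\<in>{a..b}. U 0 t \<noteq> 0" using hom_zero_on_interval[OF U(1) ab] U(2) by force
  moreover have "U 0 \<in> X_space n k a b"
    using hom_classical(1)[OF U(1)] hom_nth_deriv[OF U(1)] U(3,4) ab k
    by (auto simp: X_space_def vanishes_def)
  ultimately show "eigenvalue_in (T M) {a..b} (X_space n k a b) l"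
    unfolding eigenvalue_in_def T_op_shift using hom_classical(2)[OF U(1)] by blast
qed

section \<open>The spectral description of disconjugacy\<close>

lemma disconjugate_spectral:
  assumes d: "disconjugate n (T Mbar) {a..b}"
  shows "disconjugate n (T M) {a..b} \<longleftrightarrow>
    ereal M \<in> {ereal Mbar - lambda1 n c a b Mbar <..< ereal (Mbar - lambda2 n c a b Mbar)}"
proof -
  have D: "dis Mbar a b" using d by (simp add: disconjugate_iff_dis)
  have "\<exists>\<kappa>>0. singular (Mbar - (-1) ^ (n - k) * \<kappa>) k a b \<and>
      (\<forall>\<mu>>0. singular (Mbar - (-1) ^ (n - k) * \<mu>) k a b \<longrightarrow> \<kappa> \<le> \<mu>)" if "1 \<le> k" "k < n" for k
    by (rule least_eigenvalue_exists[OF D ab that refl])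
  \<comment> \<open>\<open>\<Lambda> k\<close> is the modulus of the eigenvalue of sign
    \<open>(-1) ^ (n - k)\<close> closest to \<open>0\<close>, so least positive and biggest
    negative eigenvalues are treated at once.\<close>
  then obtain \<Lambda> where \<Lambda>: "\<And>k. 1 \<le> k \<Longrightarrow> k < n \<Longrightarrow> \<Lambda> k > 0"
    "\<And>k. 1 \<le> k \<Longrightarrow> k < n \<Longrightarrow> singular (Mbar - (-1) ^ (n - k) * \<Lambda> k) k a b"
    "\<And>k \<mu>. 1 \<le> k \<Longrightarrow> k < n \<Longrightarrow> \<mu> > 0 \<Longrightarrow> singular (Mbar - (-1) ^ (n - k) * \<mu>) k a b \<Longrightarrow> \<Lambda> k \<le> \<mu>"
    by metis
  have dis_iff: "dis (Mbar - \<tau> * \<kappa>) a b \<longleftrightarrow> (\<forall>k. 1 \<le> k \<longrightarrow> k < n \<longrightarrow> (-1) ^ (n - k) = \<tau> \<longrightarrow> \<kappa> < \<Lambda> k)"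
    if "\<tau> = 1 \<or> \<tau> = -1" "\<kappa> \<ge> 0" for \<tau> \<kappa>
  proof -
    have "(\<forall>\<beta>. 0 < \<beta> \<longrightarrow> \<beta> \<le> \<kappa> \<longrightarrow> \<not> singular (Mbar - \<tau> * \<beta>) k a b) \<longleftrightarrow> \<kappa> < \<Lambda> k"
      if k: "1 \<le> k" "k < n" "(-1) ^ (n - k) = \<tau>" for k
      using \<Lambda>[OF k(1,2)] unfolding k(3) by force
    then show ?thesis unfolding dis_iff_no_eigenvalue[OF D ab that] by blast
  qed
  define E O' where "E = {k \<in> {1..n-1}. even (n - k)}" and "O' = {k \<in> {1..n-1}. odd (n - k)}"
  have lp: "least_pos_eigenvalue n c a b Mbar k = \<Lambda> k" if "k \<in> E" for k
  proof -
    have k: "1 \<le> k" "k < n" "even (n - k)" using that by (auto simp: E_def)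
    show ?thesis unfolding least_pos_eigenvalue_def eigenvalue_iff_singular[OF k(1,2)]
      by (rule Least_equality) (use \<Lambda>[OF k(1,2)] k(3) in auto)
  qed
  have bn: "biggest_neg_eigenvalue n c a b Mbar k = - \<Lambda> k" if "k \<in> O'" for k
  proof -
    have k: "1 \<le> k" "k < n" "odd (n - k)" using that by (auto simp: O'_def)
    show ?thesis unfolding biggest_neg_eigenvalue_def eigenvalue_iff_singular[OF k(1,2)]
    proof (rule Greatest_equality)
      show "- \<Lambda> k < 0 \<and> singular (Mbar - - \<Lambda> k) k a b" using \<Lambda>(1,2)[OF k(1,2)] k(3) by simp
      fix y assume "y < 0 \<and> singular (Mbar - y) k a b"
      then show "y \<le> - \<Lambda> k" using \<Lambda>(3)[OF k(1,2), of "- y"] k(3) by simp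
    qed
  qed
  have fin: "finite E" "finite O'" by (simp_all add: E_def O'_def)
  have "n - 1 \<in> O'" using n2 by (auto simp: O'_def)
  then have O_ne: "O' \<noteq> {}" by blast
  have O_mem: "k \<in> O' \<longleftrightarrow> 1 \<le> k \<and> k < n \<and> (-1::real) ^ (n - k) = -1" for k
    using n2 by (cases "even (n - k)") (auto simp: O'_def)
  have E_mem: "k \<in> E \<longleftrightarrow> 1 \<le> k \<and> k < n \<and> (-1::real) ^ (n - k) = 1" for k
    using n2 by (cases "even (n - k)") (auto simp: E_def)
  \<comment> \<open>For \<open>n = 2\<close> only \<open>k = 1\<close> is available and
    \<open>n - k\<close> is odd; the value \<open>\<infinity>\<close> then expresses an empty
    condition.\<close>
  have E_ne: "E \<noteq> {} \<longleftrightarrow> n \<noteq> 2"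
  proof
    assume "E \<noteq> {}"
    then obtain k where "1 \<le> k" "k < n" "even (n - k)" by (auto simp: E_def)
    then show "n \<noteq> 2" by (auto simp: less_Suc_eq numeral_2_eq_2)
  next
    assume "n \<noteq> 2"
    then have "n - 2 \<in> E" using n2 by (auto simp: E_def)
    then show "E \<noteq> {}" by blast
  qed
  have l2: "lambda2 n c a b Mbar = Max ((\<lambda>k. - \<Lambda> k) ` O')"
    unfolding lambda2_def O'_def[symmetric] using bn by (intro arg_cong[where f = Max] image_cong) auto
  have l2_less: "lambda2 n c a b Mbar < x \<longleftrightarrow> (\<forall>k\<in>O'. - \<Lambda> k < x)" for x
    unfolding l2 using fin O_ne by (subst Max_less_iff) auto
  have l1: "lambda1 n c a b Mbar = (if n = 2 then \<infinity> else ereal (Min (\<Lambda> ` E)))"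
    unfolding lambda1_def E_def[symmetric] using lp by (auto intro!: arg_cong[where f = Min] image_cong)
  have l1_less: "ereal Mbar - lambda1 n c a b Mbar < ereal x \<longleftrightarrow> (\<forall>k\<in>E. Mbar - x < \<Lambda> k)" for x
  proof (cases "n = 2")
    case True
    then have "lambda1 n c a b Mbar = \<infinity>" "E = {}" using l1 E_ne by simp_all
    then show ?thesis by simp
  next
    case False
    then have "Mbar - x < Min (\<Lambda> ` E) \<longleftrightarrow> (\<forall>k\<in>E. Mbar - x < \<Lambda> k)"
      using fin E_ne by (subst Min_gr_iff) auto
    then show ?thesis using False by (auto simp: l1 algebra_simps)
  qed
  have rhs: "ereal M \<in> {ereal Mbar - lambda1 n c a b Mbar <..< ereal (Mbar - lambda2 n c a b Mbar)} \<longleftrightarrow>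
      (\<forall>k\<in>E. Mbar - M < \<Lambda> k) \<and> (\<forall>k\<in>O'. M - Mbar < \<Lambda> k)"
    using l1_less[of M] l2_less[of "Mbar - M"] by (auto simp: algebra_simps)
  have pos: "\<Lambda> k > 0" if "k \<in> E \<or> k \<in> O'" for k using that \<Lambda>(1) by (auto simp: E_mem O_mem)
  show ?thesis
  \<comment> \<open>On either side of \<open>Mbar\<close> one half of the condition is automatic,
    since the corresponding difference is not positive and every \<open>\<Lambda> k\<close>
    is.\<close>
  proof (cases "M \<le> Mbar")
    case True
    have "dis M a b \<longleftrightarrow> (\<forall>k\<in>E. Mbar - M < \<Lambda> k)"
      using dis_iff[of 1 "Mbar - M"] True by (auto simp: E_mem)
    moreover have "\<forall>k\<in>O'. M - Mbar < \<Lambda> k" using pos True by force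
    ultimately show ?thesis unfolding rhs disconjugate_iff_dis by blast
  next
    case False
    have "dis M a b \<longleftrightarrow> (\<forall>k\<in>O'. M - Mbar < \<Lambda> k)"
      using dis_iff[of "-1" "M - Mbar"] False by (auto simp: O_mem)
    moreover have "\<forall>k\<in>E. Mbar - M < \<Lambda> k" using pos False by force
    ultimately show ?thesis unfolding rhs disconjugate_iff_dis by blast
  qed
qed

end

theorem theorem2p1:
  fixes n :: nat and a b Mbar M :: real and c :: "nat \<Rightarrow> real \<Rightarrow> real"
  assumes "n \<ge> 2" and "a < b"
    and "\<And>i. i \<in> {1..n} \<Longrightarrow> c i \<in> C_space (n - i) {a..b}"
    and "disconjugate n (T_op n c {a..b} Mbar) {a..b}"
  shows "disconjugate n (T_op n c {a..b} M) {a..b} \<longleftrightarrow>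
    ereal M \<in> {ereal Mbar - lambda1 n c a b Mbar <..< ereal (Mbar - lambda2 n c a b Mbar)}"
proof -
  interpret interval_ode n a b c
    by unfold_locales (use assms C_space_continuous_on in blast)+
  show ?thesis by (rule disconjugate_spectral[OF assms(4)])
qed

end
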